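(* Let $0<\delta<1$. Suppose that $D=\{(x_i,y_i)\}_{i=1}^m$ satisfies $y_i=f^*(x_i)$ for $i=1,\dots,m$, that $f^*=\mathcal L_K^rh^*$ for some $h^*\in L^2_{\rho_X}$ and some $r\ge1/2$, and that $\Xi=\{x_i\}_{i=1}^m$ are drawn independently and identically according to $\rho_X$. Then with confidence (probability) at least $1-\delta$, the kernel interpolant $f_D$ satisfies $$\|f_D-f^*\|_\rho\le C_1\log^6\frac{16}{\delta}\begin{cases}\min\limits_{\lambda>0}\{\lambda^r(\mathcal A_{D,\lambda}+1)^{2r}\}, & 1/2\le r\le1,\\ \frac1{\sqrt m}\min\limits_{\lambda>0}\{\sqrt\lambda(\mathcal A_{D,\lambda}+1)\}, & r>1,\end{cases}$$ where $C_1$ is a constant depending only on $\kappa$, $\|h^*\|_\rho$ and $r$.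
   Context: Setting. $\mathcal X\subset\mathbb R^d$ is a compact domain with Lipschitz boundary; $K:\mathcal X\times\mathcal X\to\mathbb R$ is a continuous, symmetric, strictly positive-definite kernel; $K_x:=K(x,\cdot)$; $\kappa:=\sqrt{\sup_{x,x'\in\mathcal X}K(x,x')}$. $\rho_X$ is a probability measure on $\mathcal X$ and $\|\cdot\|_\rho$ is the norm of $L^2_{\rho_X}$. $\mathcal L_K:L^2_{\rho_X}\to L^2_{\rho_X}$, $\mathcal L_Kf=\int_{\mathcal X}f(x)K_x\,d\rho_X$, with powers defined by spectral calculus. Data and interpolant. $D=\{(x_i,y_i)\}_{i=1}^m$, the $x_i\in\mathcal X$ being (almost surely) pairwise distinct; $y_D=(y_1,\dots,y_m)^T$; $\mathbb K=(K(x_i,x_j))_{i,j=1}^m$; $f_D=\sum_{i=1}^m a_iK_{x_i}$ with $(a_1,\dots,a_m)^T=\mathbb K^{-1}y_D$. Let $\sigma_{1,\mathbb K}\ge\dots\ge\sigma_{m,\mathbb K}>0$ be the eigenvalues of $\mathbb K$ and $$\mathcal A_{D,\lambda}:=\left(\frac1{m\lambda}+\frac1{\sqrt{m\lambda}}\right)\max\left\{1,\sqrt{\sum_{\ell=1}^m\frac{\sigma_{\ell,\mathbb K}}{\lambda m+\sigma_{\ell,\mathbb K}}}\right\}.$$ *)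

theory Defs
  imports
    "HOL-Probability.Probability"
    "Jordan_Normal_Form.Gauss_Jordan_Elimination"
    "Jordan_Normal_Form.Char_Poly"
begin

text \<open>The Euclidean space of dimension \<open>d\<close> is the library's \<^const>\<open>Euclidean_space\<close>: the points are the
  functions \<open>x :: nat \<Rightarrow> real\<close> with \<open>x i = 0\<close> for \<open>i \<ge> d\<close>.  The dimension is then an ordinary
  number, so a constant can be required not to depend on it.\<close>

type_synonym point = "nat \<Rightarrow> real"
type_synonym kernel = "point \<Rightarrow> point \<Rightarrow> real"

definition edist :: "nat \<Rightarrow> point \<Rightarrow> point \<Rightarrow> real" where
  "edist d x y = L2_set (\<lambda>i. x i - y i) {..<d}"

text \<open>Near each boundary point, after a Euclidean isometry \<open>T\<close>, the set is the closed epigraph of a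
  Lipschitz function \<open>\<gamma>\<close> of the first \<open>d - 1\<close> coordinates.\<close>

definition lipschitz_boundary :: "nat \<Rightarrow> point set \<Rightarrow> bool" where
  "lipschitz_boundary d X \<longleftrightarrow>
    (\<forall>p \<in> Euclidean_space d frontier_of X. \<exists>T s \<gamma> L.
        bij_betw T (topspace (Euclidean_space d)) (topspace (Euclidean_space d)) \<and>
        (\<forall>x \<in> topspace (Euclidean_space d). \<forall>y \<in> topspace (Euclidean_space d).
            edist d (T x) (T y) = edist d x y) \<and>
        s > 0 \<and>
        (\<forall>u \<in> topspace (Euclidean_space (d - 1)). \<forall>v \<in> topspace (Euclidean_space (d - 1)).
            \<bar>\<gamma> u - \<gamma> v\<bar> \<le> L * edist (d - 1) u v) \<and>
        (\<forall>x \<in> topspace (Euclidean_space d). edist d x p < s \<longrightarrow>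
            (x \<in> X \<longleftrightarrow> \<gamma> ((T x)(d - 1 := 0)) \<le> T x (d - 1))))"

text \<open>A compact domain is the (compact) closure of a nonempty connected open set.\<close>

definition compact_lipschitz_domain :: "nat \<Rightarrow> point set \<Rightarrow> bool" where
  "compact_lipschitz_domain d X \<longleftrightarrow>
    compactin (Euclidean_space d) X \<and>
    (\<exists>U. openin (Euclidean_space d) U \<and> connectedin (Euclidean_space d) U \<and> U \<noteq> {} \<and>
         X = Euclidean_space d closure_of U) \<and>
    lipschitz_boundary d X"

definition symmetric_kernel :: "point set \<Rightarrow> kernel \<Rightarrow> bool" where
  "symmetric_kernel X K \<longleftrightarrow> (\<forall>x \<in> X. \<forall>y \<in> X. K x y = K y x)"

definition strictly_positive_definite :: "point set \<Rightarrow> kernel \<Rightarrow> bool" where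
  "strictly_positive_definite X K \<longleftrightarrow>
    (\<forall>S a. finite S \<longrightarrow> S \<subseteq> X \<longrightarrow> (\<exists>x \<in> S. a x \<noteq> 0) \<longrightarrow>
       0 < (\<Sum>x\<in>S. \<Sum>y\<in>S. a x * a y * K x y))"

definition kappa :: "point set \<Rightarrow> kernel \<Rightarrow> real" where
  "kappa X K = sqrt (SUP (x, x') \<in> X \<times> X. K x x')"

text \<open>Elements of \<open>L\<^sup>2\<close> are represented by square-integrable functions, and equality in \<open>L\<^sup>2\<close> by
  equality almost everywhere.\<close>

definition L2_space :: "'a measure \<Rightarrow> ('a \<Rightarrow> real) set" where
  "L2_space \<rho> = {f \<in> borel_measurable \<rho>. integrable \<rho> (\<lambda>x. (f x)\<^sup>2)}"

definition L2_inner :: "'a measure \<Rightarrow> ('a \<Rightarrow> real) \<Rightarrow> ('a \<Rightarrow> real) \<Rightarrow> real" where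
  "L2_inner \<rho> f g = (\<integral>x. f x * g x \<partial>\<rho>)"

definition L2_norm :: "'a measure \<Rightarrow> ('a \<Rightarrow> real) \<Rightarrow> real" where
  "L2_norm \<rho> f = sqrt (\<integral>x. (f x)\<^sup>2 \<partial>\<rho>)"

definition LK :: "kernel \<Rightarrow> point measure \<Rightarrow> (point \<Rightarrow> real) \<Rightarrow> point \<Rightarrow> real" where
  "LK K \<rho> f = (\<lambda>x'. \<integral>x. f x * K x x' \<partial>\<rho>)"

text \<open>A complete orthonormal system \<open>(e k)\<close>, \<open>k \<in> I\<close>, of \<open>L\<^sup>2\<close> consisting of eigenfunctions of the
  integral operator, with eigenvalues \<open>\<mu> k\<close> (zero allowed).  For a continuous kernel on a compact set
  such a system exists by the spectral theorem; \<open>I\<close> is a proper subset of the naturals if \<open>L\<^sup>2\<close> is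
  finite-dimensional.\<close>

definition LK_eigenbasis ::
  "kernel \<Rightarrow> point measure \<Rightarrow> nat set \<Rightarrow> (nat \<Rightarrow> real) \<Rightarrow> (nat \<Rightarrow> point \<Rightarrow> real) \<Rightarrow> bool" where
  "LK_eigenbasis K \<rho> I \<mu> e \<longleftrightarrow>
    (\<forall>k \<in> I. e k \<in> L2_space \<rho>) \<and>
    (\<forall>j \<in> I. \<forall>k \<in> I. L2_inner \<rho> (e j) (e k) = (if j = k then 1 else 0)) \<and>
    (\<forall>g \<in> L2_space \<rho>. (\<forall>k \<in> I. L2_inner \<rho> g (e k) = 0) \<longrightarrow> (AE x in \<rho>. g x = 0)) \<and>
    (\<forall>k \<in> I. AE x in \<rho>. LK K \<rho> (e k) x = \<mu> k * e k x)"

text \<open>\<open>f\<close> represents the \<open>r\<close>-th power of the operator (\<open>r > 0\<close>) applied to \<open>h\<close>: the sum of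
  \<open>\<mu> k powr r * \<langle>h, e k\<rangle> * e k\<close>, converging in \<open>L\<^sup>2\<close>.  The sum does not depend on the choice of the
  eigenbasis, and \<open>0 powr r = 0\<close>.\<close>

definition is_LK_power ::
  "kernel \<Rightarrow> point measure \<Rightarrow> real \<Rightarrow> (point \<Rightarrow> real) \<Rightarrow> (point \<Rightarrow> real) \<Rightarrow> bool" where
  "is_LK_power K \<rho> r h f \<longleftrightarrow>
    f \<in> L2_space \<rho> \<and>
    (\<exists>I \<mu> e. LK_eigenbasis K \<rho> I \<mu> e \<and>
      (\<lambda>n. L2_norm \<rho> (\<lambda>x. f x -
          (\<Sum>k\<in>I \<inter> {..<n}. \<mu> k powr r * L2_inner \<rho> h (e k) * e k x))) \<longlonglongrightarrow> 0)"

definition kernel_matrix :: "kernel \<Rightarrow> nat \<Rightarrow> (nat \<Rightarrow> point) \<Rightarrow> real mat" where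
  "kernel_matrix K m x = Matrix.mat m m (\<lambda>(i, j). K (x i) (x j))"

definition interpolant ::
  "kernel \<Rightarrow> nat \<Rightarrow> (nat \<Rightarrow> point) \<Rightarrow> (nat \<Rightarrow> real) \<Rightarrow> point \<Rightarrow> real" where
  "interpolant K m x y =
    (let a = the (mat_inverse (kernel_matrix K m x)) *\<^sub>v Matrix.vec m y
     in (\<lambda>t. \<Sum>i<m. vec_index a i * K (x i) t))"

text \<open>The eigenvalues of the (real symmetric) kernel matrix, with multiplicity, are the roots of its
  characteristic polynomial.\<close>

definition A_D :: "kernel \<Rightarrow> nat \<Rightarrow> (nat \<Rightarrow> point) \<Rightarrow> real \<Rightarrow> real" where
  "A_D K m x lam =
    (1 / (real m * lam) + 1 / sqrt (real m * lam)) *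
    max 1 (sqrt (\<Sum>\<sigma>\<in>#proots (char_poly (kernel_matrix K m x)). \<sigma> / (lam * real m + \<sigma>)))"

end

theory Submission
  imports Defs
begin

text \<open>Let \<open>L\<close> be the integral operator of \<open>K\<close> on \<open>L\<^sup>2\<close> of the sampling measure.  A function of the form
  \<open>L g + (\<Sum>i. b i * K (z i))\<close> is treated as the potential of a signed measure with density \<open>g\<close> and point
  masses \<open>b i\<close>; the energy of that measure is the square of its norm in the reproducing kernel Hilbert
  space.  The target is first replaced by a partial sum of its expansion in eigenfunctions, for which
  \<open>g\<close> is square integrable, and the residual \<open>v\<close> of the interpolation is such a potential that vanishes
  at the sample points.  The error bound for \<open>v\<close> combines a bound of its norm by its energy, a bound of
  the energy itself, and a lower bound for the term with which both are to be compared.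

  Norm against energy.  Let \<open>Q\<close> be the kernel of \<open>L * (max L \<lambda>)\<^sup>-\<^sup>1\<close>, let \<open>N\<close> be the energy of \<open>v\<close>, and let
  \<open>n\<close> be the number of points in a part of the sample.  The kernel \<open>N * K - v \<otimes> v\<close> is positive
  semidefinite, and so is its Schur product with \<open>Q\<close>.  The energy of that product for the difference
  between the measure and the empirical measure is nonnegative, and \<open>v \<otimes> v\<close> contributes to it only
  through the measure, because \<open>v\<close> vanishes at the sample points.  So the form of \<open>v\<close> under \<open>Q\<close> is at
  most \<open>N\<close> times the deviation energy of \<open>Q * K\<close> (\<open>vanishing_potential_form_le\<close>), whose mean is of order
  \<open>D \<lambda> / n\<close>, where \<open>D \<lambda>\<close> is the integral of \<open>Q x x\<close>.  If the deviation energy is at most \<open>2 * \<lambda>\<close>, the squared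
  \<open>L\<^sup>2\<close> norm of \<open>v\<close> is at most \<open>4 * \<lambda> * N\<close> (\<open>vanishing_potential_norm_le\<close>).

  Bounds of the energy.  Since \<open>v\<close> vanishes at the sample points, \<open>N\<close> is the \<open>L\<^sup>2\<close> inner product of \<open>v\<close>
  with the source \<open>g\<close>.  For \<open>r \<le> 1\<close> this identity and the comparison of norm and energy bootstrap to the
  order \<open>\<lambda> powr r\<close> for the norm (\<open>source_condition_low\<close>).  For \<open>r > 1\<close> the source is square integrable with
  a bound that does not depend on the truncation; the energy is minimal among all choices of the
  coefficients (\<open>vanishing_energy_minimal\<close>), and the choice \<open>- g (x i) / n\<close> has mean energy of order
  \<open>1 / n\<close> (\<open>expected_sampling_energy\<close>), which gives the additional factor \<open>1 / sqrt m\<close>.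

  Probability.  All these statistics have bounded means, and conditions on a part of the sample suffice,
  as \<open>v\<close> vanishes on every part.  The sample is divided into about \<open>log 2 (3 / \<delta>)\<close> blocks; by Markov's
  inequality a block exceeds twice the mean with probability at most one half, and by independence all
  of them do so with probability at most \<open>\<delta> / 3\<close> (\<open>independent_blocks_Markov\<close>).  The confidence enters
  the bound through the number of blocks only, hence through powers of \<open>ln (16 / \<delta>)\<close>.

  The complexity term.  The scale \<open>\<lambda>\<close> is chosen minimal, up to a factor of two, such that \<open>D \<lambda>\<close> is at
  most of order \<open>n * \<lambda>\<close> (\<open>dimension_scale_choice\<close>).  By minimality \<open>D (\<lambda> / 2)\<close> is then at least of order
  \<open>n * \<lambda>\<close>, unless \<open>\<lambda>\<close> is itself of order \<open>1 / n\<close>.  The effective dimension of the kernel matrix of a good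
  block is at least of the order of \<open>D (\<lambda> / 2)\<close> (\<open>effective_dimension_from_trace_statistic\<close>), and that of
  the whole kernel matrix is at least that of a block (\<open>effective_dimension_submatrix_le\<close>).  Therefore
  \<open>l * (A + 1)\<^sup>2\<close>, with \<open>A\<close> the complexity of the sample at \<open>l\<close>, is bounded below by a multiple of
  \<open>\<lambda> * n / m\<close> for every \<open>l\<close> (\<open>complexity_ge\<close>), hence so is the infimum.

  Finally the partial sums converge to the target in the mean and, almost surely, at the sample points
  (\<open>operator_source_converges_AE\<close>), so that the bounds pass to the limit.\<close>

section \<open>Orthonormal eigenbases of symmetric matrices\<close>

text \<open>The form in which a first-order condition is extracted from the maximality of a quadratic form along
  a line.\<close>

lemma linear_term_vanishes:
  fixes a b :: real
  assumes "\<And>t. t * a \<le> t\<^sup>2 * b"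
  shows "a = 0"
proof (rule ccontr)
  assume a: "a \<noteq> 0"
  define t where "t = a / (\<bar>b\<bar> + 1)"
  have "a = t * (\<bar>b\<bar> + 1)" by (simp add: t_def)
  then have "t * a = t\<^sup>2 * (\<bar>b\<bar> + 1)" by (simp add: power2_eq_square)
  moreover have "t\<^sup>2 > 0" using a by (simp add: t_def)
  ultimately have "t * a > t\<^sup>2 * b"
    by (auto intro!: mult_strict_left_mono)
  then show False using assms[of t] by simp
qed

text \<open>The maximum of the quadratic form on the unit sphere of the orthogonal complement of the
  eigenvectors found so far is attained, and the first-order condition at a maximiser is the
  eigenvalue equation.  The complement is invariant because the matrix is symmetric.\<close>

lemma eigenvector_orthogonal_to_given:
  fixes A :: "'i \<Rightarrow> 'i \<Rightarrow> real" and u :: "'l \<Rightarrow> 'i \<Rightarrow> real"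
  assumes fin: "finite B"
    and sym: "\<And>i j. i \<in> B \<Longrightarrow> j \<in> B \<Longrightarrow> A i j = A j i"
    and ev: "\<And>l i. l \<in> S \<Longrightarrow> i \<in> B \<Longrightarrow> (\<Sum>j\<in>B. A i j * u l j) = \<sigma> l * u l i"
    and w0: "\<And>l. l \<in> S \<Longrightarrow> (\<Sum>i\<in>B. w i * u l i) = 0"
    and w1: "(\<Sum>i\<in>B. w i * w i) > 0"
  obtains v s where "(\<Sum>i\<in>B. v i * v i) = 1" "\<And>l. l \<in> S \<Longrightarrow> (\<Sum>i\<in>B. v i * u l i) = 0"
    "\<And>i. i \<in> B \<Longrightarrow> (\<Sum>j\<in>B. A i j * v j) = s * v i"
proof -
  define q where "q v = (\<Sum>i\<in>B. \<Sum>j\<in>B. v i * A i j * v j)" for v :: "'i \<Rightarrow> real"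
  define N where "N v = (\<Sum>i\<in>B. v i * v i)" for v :: "'i \<Rightarrow> real"
  define box where "box = Pi\<^sub>E UNIV (\<lambda>i. if i \<in> B then {-1..1} else {0::real})"
  define C where "C = {v \<in> box. N v = 1 \<and> (\<forall>l\<in>S. (\<Sum>i\<in>B. v i * u l i) = 0)}"
  have "compactin (product_topology (\<lambda>i. euclidean) UNIV) box"
    unfolding box_def by (auto simp: compactin_PiE)
  then have cbox: "compact box"
    by (simp add: euclidean_product_topology)
  have coord: "continuous_on UNIV (\<lambda>v::'i \<Rightarrow> real. v i)" for i
    by (rule continuous_on_product_coordinates)
  have cN: "continuous_on UNIV N" and cq: "continuous_on UNIV q"
    unfolding N_def q_def by (intro continuous_on_sum continuous_on_mult continuous_on_const coord)+
  have "closed {v. N v = 1}"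
    by (intro closed_Collect_eq continuous_on_const cN)
  moreover have "closed {v. (\<Sum>i\<in>B. v i * u l i) = 0}" for l
    by (intro closed_Collect_eq continuous_on_sum continuous_on_mult continuous_on_const coord)
  ultimately have "compact (box \<inter> ({v. N v = 1} \<inter> (\<Inter>l\<in>S. {v. (\<Sum>i\<in>B. v i * u l i) = 0})))"
    by (intro compact_Int_closed cbox closed_Int closed_INT) auto
  also have "\<dots> = C" by (auto simp: C_def)
  finally have "compact C" .
  have norm_le: "\<bar>v i\<bar> \<le> 1" if "N v = 1" "i \<in> B" for v i
  proof -
    have "v i * v i \<le> N v" unfolding N_def
      by (rule member_le_sum[OF that(2)]) (auto simp: fin)
    then have "(v i)\<^sup>2 \<le> 1" using that by (simp add: power2_eq_square)
    then show ?thesis by (simp add: abs_square_le_1)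
  qed
  have scaled: "(\<lambda>i. if i \<in> B then v i / sqrt (N v) else 0) \<in> C"
    if "N v > 0" "\<And>l. l \<in> S \<Longrightarrow> (\<Sum>i\<in>B. v i * u l i) = 0" for v
  proof -
    let ?v = "\<lambda>i. if i \<in> B then v i / sqrt (N v) else 0"
    have 1: "N ?v = 1"
    proof -
      have "N ?v = (\<Sum>i\<in>B. v i * v i / N v)"
        unfolding N_def using that(1)[unfolded N_def] by (intro sum.cong) (auto simp: real_sqrt_mult[symmetric])
      also have "\<dots> = 1" using that(1) by (simp add: sum_divide_distrib[symmetric] N_def)
      finally show ?thesis .
    qed
    have "(\<Sum>i\<in>B. ?v i * u l i) = 0" if l: "l \<in> S" for l
    proof -
      have "(\<Sum>i\<in>B. ?v i * u l i) = (\<Sum>i\<in>B. v i * u l i) / sqrt (N v)"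
        by (simp add: sum_divide_distrib)
      then show ?thesis using \<open>\<And>l. l \<in> S \<Longrightarrow> (\<Sum>i\<in>B. v i * u l i) = 0\<close>[OF l] by simp
    qed
    moreover have "?v \<in> box"
    proof -
      have "?v i \<in> {-1..1}" if "i \<in> B" for i
        using norm_le[OF 1 that] that by (simp only: if_True abs_le_iff atLeastAtMost_iff) simp
      then show ?thesis unfolding box_def by auto
    qed
    ultimately show ?thesis using 1 by (simp add: C_def)
  qed
  have "C \<noteq> {}" using scaled[of w] w0 w1 by (auto simp: N_def)
  then obtain v where vC: "v \<in> C" and vmax: "\<And>v'. v' \<in> C \<Longrightarrow> q v' \<le> q v"
    using continuous_attains_sup[OF \<open>compact C\<close> _ continuous_on_subset[OF cq]] by auto
  define s where "s = q v"
  have Nv: "N v = 1" and vu: "\<And>l. l \<in> S \<Longrightarrow> (\<Sum>i\<in>B. v i * u l i) = 0"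
    using vC by (auto simp: C_def)
  have qN: "q x \<le> s * N x" if x: "\<And>l. l \<in> S \<Longrightarrow> (\<Sum>i\<in>B. x i * u l i) = 0" for x
  proof (cases "N x = 0")
    case True
    then have "x i = 0" if "i \<in> B" for i
      using that fin by (simp add: N_def sum_nonneg_eq_0_iff)
    then show ?thesis using True by (simp add: q_def)
  next
    case False
    have "N x \<ge> 0" by (auto simp: N_def intro: sum_nonneg)
    then have pos: "N x > 0" using False by simp
    let ?y = "\<lambda>i. if i \<in> B then x i / sqrt (N x) else 0"
    have sq: "sqrt (N x) * sqrt (N x) = N x" using pos by simp
    have "q ?y = (\<Sum>i\<in>B. \<Sum>j\<in>B. x i * A i j * x j / (sqrt (N x) * sqrt (N x)))"
      unfolding q_def by (intro sum.cong refl) (simp add: mult_ac)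
    also have "\<dots> = (\<Sum>i\<in>B. \<Sum>j\<in>B. x i * A i j * x j / N x)" unfolding sq ..
    also have "\<dots> = q x / N x" by (simp add: q_def sum_divide_distrib)
    finally have "q x / N x \<le> s" using vmax[OF scaled[OF pos x]] by (simp add: s_def)
    then show ?thesis using pos by (simp add: field_simps)
  qed
  define z where "z i = (\<Sum>j\<in>B. A i j * v j) - s * v i" for i
  have zu: "(\<Sum>i\<in>B. z i * u l i) = 0" if l: "l \<in> S" for l
  proof -
    have "(\<Sum>i\<in>B. z i * u l i) = (\<Sum>i\<in>B. \<Sum>j\<in>B. A i j * v j * u l i) - s * (\<Sum>i\<in>B. v i * u l i)"
      by (simp add: z_def left_diff_distrib sum_subtractf sum_distrib_left sum_distrib_right mult.assoc)
    also have "(\<Sum>i\<in>B. \<Sum>j\<in>B. A i j * v j * u l i) = (\<Sum>j\<in>B. \<Sum>i\<in>B. A i j * v j * u l i)"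
      by (rule sum.swap)
    also have "\<dots> = (\<Sum>j\<in>B. v j * (\<Sum>i\<in>B. A j i * u l i))"
      unfolding sum_distrib_left by (intro sum.cong refl) (auto simp: sym mult_ac)
    also have "\<dots> = \<sigma> l * (\<Sum>j\<in>B. v j * u l j)"
      using ev[OF l] by (simp add: sum_distrib_left mult_ac)
    finally show ?thesis using vu[OF l] by simp
  qed
  have "2 * N z = 0"
  proof (rule linear_term_vanishes)
    fix t :: real
    define x where "x i = v i + t * z i" for i
    define X Y where "X = (\<Sum>i\<in>B. z i * (\<Sum>j\<in>B. A i j * v j))" and "Y = (\<Sum>i\<in>B. z i * v i)"
    have "q x \<le> s * N x"
    proof (rule qN)
      fix l assume "l \<in> S"
      then show "(\<Sum>i\<in>B. x i * u l i) = 0"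
        using vu[of l] zu[of l]
        by (simp add: x_def distrib_right sum.distrib mult.assoc sum_distrib_left[symmetric])
    qed
    moreover have "q x = q v + 2 * t * (\<Sum>i\<in>B. z i * (\<Sum>j\<in>B. A i j * v j)) + t\<^sup>2 * q z"
    proof -
      have "(\<Sum>i\<in>B. \<Sum>j\<in>B. v i * A i j * z j) = (\<Sum>j\<in>B. \<Sum>i\<in>B. v i * A i j * z j)"
        by (rule sum.swap)
      also have "\<dots> = (\<Sum>i\<in>B. \<Sum>j\<in>B. z i * A i j * v j)"
        by (intro sum.cong refl) (auto simp: sym mult_ac)
      finally have "(\<Sum>i\<in>B. \<Sum>j\<in>B. v i * A i j * z j) = (\<Sum>i\<in>B. \<Sum>j\<in>B. z i * A i j * v j)" .
      moreover have "q x = q v + t * (\<Sum>i\<in>B. \<Sum>j\<in>B. v i * A i j * z j)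
          + t * (\<Sum>i\<in>B. \<Sum>j\<in>B. z i * A i j * v j) + t\<^sup>2 * q z"
        unfolding q_def x_def sum_distrib_left sum.distrib[symmetric]
        by (intro sum.cong refl) (simp add: algebra_simps power2_eq_square)
      ultimately show ?thesis by (simp add: sum_distrib_left mult.assoc)
    qed
    moreover have "N x = N v + 2 * t * (\<Sum>i\<in>B. z i * v i) + t\<^sup>2 * N z"
      unfolding N_def x_def sum_distrib_left sum.distrib[symmetric]
      by (intro sum.cong refl) (simp add: algebra_simps power2_eq_square)
    moreover have "N z = (\<Sum>i\<in>B. z i * (\<Sum>j\<in>B. A i j * v j)) - s * (\<Sum>i\<in>B. z i * v i)"
      unfolding N_def sum_distrib_left[of s] sum_subtractf[symmetric]
      by (intro sum.cong refl) (simp add: z_def algebra_simps)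
    ultimately have "q v + 2 * t * X + t\<^sup>2 * q z \<le> s * (N v + 2 * t * Y + t\<^sup>2 * N z)" and "N z = X - s * Y"
      by (auto simp: X_def Y_def)
    note this(1)
    moreover have "s * (N v + 2 * t * Y + t\<^sup>2 * N z) = q v + t * (2 * (s * Y)) + t\<^sup>2 * (s * N z)"
      by (simp add: Nv s_def algebra_simps)
    moreover have "t * (2 * N z) = 2 * t * X - t * (2 * (s * Y))"
      unfolding \<open>N z = X - s * Y\<close> by (simp add: algebra_simps)
    ultimately show "t * (2 * N z) \<le> t\<^sup>2 * (s * N z - q z)"
      unfolding right_diff_distrib by linarith
  qed
  then have "z i = 0" if "i \<in> B" for i
    using that fin by (simp add: N_def sum_nonneg_eq_0_iff)
  then have "(\<Sum>j\<in>B. A i j * v j) = s * v i" if "i \<in> B" for i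
    using that by (simp add: z_def)
  then show thesis using that[of v s] Nv vu by (simp add: N_def)
qed

definition orthonormal_eigenbasis ::
  "'i set \<Rightarrow> ('i \<Rightarrow> 'i \<Rightarrow> real) \<Rightarrow> ('i \<Rightarrow> real) \<Rightarrow> ('i \<Rightarrow> 'i \<Rightarrow> real) \<Rightarrow> bool" where
  "orthonormal_eigenbasis B A \<sigma> u \<longleftrightarrow>
    (\<forall>l\<in>B. \<forall>i\<in>B. (\<Sum>j\<in>B. A i j * u l j) = \<sigma> l * u l i) \<and>
    (\<forall>l\<in>B. \<forall>k\<in>B. (\<Sum>i\<in>B. u l i * u k i) = (if l = k then 1 else 0)) \<and>
    (\<forall>i\<in>B. \<forall>j\<in>B. (\<Sum>l\<in>B. u l i * u l j) = (if i = j then 1 else 0))"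

text \<open>As long as fewer than \<open>card B\<close> orthonormal vectors \<open>u l\<close> are available, some coordinate
  vector differs from its projection on their span, because the squared norms of these projections
  add up to the number of vectors.  For a full system the same count forces every projection to have
  norm one, which is the orthonormality of the columns.\<close>

theorem symmetric_matrix_eigenbasis:
  fixes A :: "'i \<Rightarrow> 'i \<Rightarrow> real"
  assumes fin: "finite B"
    and sym: "\<And>i j. i \<in> B \<Longrightarrow> j \<in> B \<Longrightarrow> A i j = A j i"
  obtains \<sigma> u where "orthonormal_eigenbasis B A \<sigma> u"
proof -
  have proj: "(\<Sum>j\<in>B. ((if j = i then 1 else 0) - (\<Sum>l\<in>S. u l i * u l j)) *
          ((if j = i' then 1 else 0) - (\<Sum>l\<in>S. u l i' * u l j)))
        = (if i = i' then 1 else 0) - (\<Sum>l\<in>S. u l i * u l i')"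
    if S: "finite S" and i: "i \<in> B" "i' \<in> B"
      and on: "\<And>l k. l \<in> S \<Longrightarrow> k \<in> S \<Longrightarrow> (\<Sum>i\<in>B. u l i * u k i) = (if l = k then 1 else (0::real))"
    for S :: "'i set" and u and i i'
  proof -
    define p where "p i j = (\<Sum>l\<in>S. u l i * u l j)" for i j
    have pp: "(\<Sum>j\<in>B. p i j * p i' j) = p i i'"
    proof -
      have "(\<Sum>j\<in>B. p i j * p i' j) = (\<Sum>j\<in>B. \<Sum>l\<in>S. \<Sum>k\<in>S. u l i * u k i' * (u l j * u k j))"
        unfolding p_def sum_product by (intro sum.cong refl) (simp add: mult_ac)
      also have "\<dots> = (\<Sum>l\<in>S. \<Sum>k\<in>S. \<Sum>j\<in>B. u l i * u k i' * (u l j * u k j))"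
        by (subst sum.swap, rule sum.cong, rule refl, rule sum.swap)
      also have "\<dots> = (\<Sum>l\<in>S. \<Sum>k\<in>S. u l i * u k i' * (if l = k then 1 else 0))"
        by (intro sum.cong refl) (simp add: on sum_distrib_left[symmetric])
      also have "\<dots> = p i i'" using S by (simp add: p_def if_distrib[of "(*) _"] sum.delta cong: if_cong)
      finally show ?thesis .
    qed
    have sy: "p i i' = p i' i" by (simp add: p_def mult.commute)
    have "(\<Sum>j\<in>B. ((if j = i then 1 else 0) - p i j) * ((if j = i' then 1 else 0) - p i' j))
        = (\<Sum>j\<in>B. (if j = i then (if j = i' then 1 else 0) else 0) - (if j = i then p i' j else 0)
            - (if j = i' then p i j else 0) + p i j * p i' j)"
      by (intro sum.cong refl) (auto simp: algebra_simps)
    also have "\<dots> = (if i = i' then 1 else 0) - p i' i - p i i' + p i i'"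
      using fin i pp by (simp add: sum.distrib sum_subtractf sum.delta)
    finally show ?thesis using sy by (simp add: p_def)
  qed
  have "\<exists>\<sigma> u. (\<forall>l\<in>S. \<forall>i\<in>B. (\<Sum>j\<in>B. A i j * u l j) = \<sigma> l * u l i) \<and>
      (\<forall>l\<in>S. \<forall>k\<in>S. (\<Sum>i\<in>B. u l i * u k i) = (if l = k then 1 else 0))"
    if "S \<subseteq> B" for S
    using finite_subset[OF that fin] that
  proof (induction S rule: finite_induct)
    case empty
    then show ?case by auto
  next
    case (insert l0 S)
    then obtain \<sigma> u where
      IH: "\<forall>l\<in>S. \<forall>i\<in>B. (\<Sum>j\<in>B. A i j * u l j) = \<sigma> l * u l i"
      "\<forall>l\<in>S. \<forall>k\<in>S. (\<Sum>i\<in>B. u l i * u k i) = (if l = k then 1 else 0)"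
      by blast
    then have ev: "\<And>l i. l \<in> S \<Longrightarrow> i \<in> B \<Longrightarrow> (\<Sum>j\<in>B. A i j * u l j) = \<sigma> l * u l i"
      and on: "\<And>l k. l \<in> S \<Longrightarrow> k \<in> S \<Longrightarrow> (\<Sum>i\<in>B. u l i * u k i) = (if l = k then 1 else 0)"
      by auto
    have card: "card S < card B"
      using insert by (intro psubset_card_mono fin) auto
    have "\<exists>i\<in>B. (\<Sum>l\<in>S. u l i * u l i) < 1"
    proof (rule ccontr)
      assume "\<not> ?thesis"
      then have "(\<Sum>i\<in>B. 1) \<le> (\<Sum>i\<in>B. \<Sum>l\<in>S. u l i * u l i)"
        by (intro sum_mono) auto
      then have "real (card B) \<le> (\<Sum>i\<in>B. \<Sum>l\<in>S. u l i * u l i)" by simp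
      also have "\<dots> = (\<Sum>l\<in>S. \<Sum>i\<in>B. u l i * u l i)" by (rule sum.swap)
      also have "\<dots> = real (card S)" by (simp add: on)
      finally show False using card by simp
    qed
    then obtain i where i: "i \<in> B" "(\<Sum>l\<in>S. u l i * u l i) < 1" by auto
    define w where "w j = (if j = i then 1 else 0) - (\<Sum>l\<in>S. u l i * u l j)" for j
    have w1: "(\<Sum>j\<in>B. w j * w j) > 0"
      using proj[OF \<open>finite S\<close> i(1) i(1), of u] on i(2) by (simp add: w_def)
    have w0: "(\<Sum>j\<in>B. w j * u k j) = 0" if k: "k \<in> S" for k
    proof -
      have "(\<Sum>j\<in>B. w j * u k j) = (\<Sum>j\<in>B. (if j = i then u k j else 0) - (\<Sum>l\<in>S. u l i * (u l j * u k j)))"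
        by (intro sum.cong refl) (auto simp: w_def left_diff_distrib sum_distrib_right mult.assoc)
      also have "\<dots> = u k i - (\<Sum>j\<in>B. \<Sum>l\<in>S. u l i * (u l j * u k j))"
        using fin i by (simp add: sum_subtractf sum.delta)
      also have "(\<Sum>j\<in>B. \<Sum>l\<in>S. u l i * (u l j * u k j)) = (\<Sum>l\<in>S. \<Sum>j\<in>B. u l i * (u l j * u k j))"
        by (rule sum.swap)
      also have "\<dots> = (\<Sum>l\<in>S. u l i * (if l = k then 1 else 0))"
        by (intro sum.cong refl) (simp add: on k sum_distrib_left[symmetric])
      also have "\<dots> = u k i" using \<open>finite S\<close> k by (simp add: if_distrib[of "(*) _"] sum.delta cong: if_cong)
      finally show ?thesis by simp
    qed
    obtain v s where v: "(\<Sum>i\<in>B. v i * v i) = 1" "\<And>l. l \<in> S \<Longrightarrow> (\<Sum>i\<in>B. v i * u l i) = 0"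
      "\<And>i. i \<in> B \<Longrightarrow> (\<Sum>j\<in>B. A i j * v j) = s * v i"
      by (rule eigenvector_orthogonal_to_given[OF fin sym ev w0 w1, where S = S]) (blast | assumption)+
    have v2: "(\<Sum>i\<in>B. u l i * v i) = 0" if "l \<in> S" for l
      using v(2)[OF that] by (simp add: mult.commute)
    have ne: "l \<noteq> l0" if "l \<in> S" for l using that insert.hyps by auto
    show ?case
    proof (intro exI[of _ "\<sigma>(l0 := s)"] exI[of _ "u(l0 := v)"] conjI ballI)
      fix l i assume "l \<in> insert l0 S" "i \<in> B"
      then show "(\<Sum>j\<in>B. A i j * (u(l0 := v)) l j) = (\<sigma>(l0 := s)) l * (u(l0 := v)) l i"
        using ev[of l i] v(3)[of i] ne[of l] by (cases "l = l0") auto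
    next
      fix l k assume "l \<in> insert l0 S" "k \<in> insert l0 S"
      then show "(\<Sum>i\<in>B. (u(l0 := v)) l i * (u(l0 := v)) k i) = (if l = k then 1 else 0)"
        using on[of l k] v(1) v(2)[of l] v(2)[of k] v2[of l] ne[of l] ne[of k]
        by (cases "l = l0"; cases "k = l0") auto
    qed
  qed
  from this[OF order_refl] obtain \<sigma> u where
      "\<forall>l\<in>B. \<forall>i\<in>B. (\<Sum>j\<in>B. A i j * u l j) = \<sigma> l * u l i"
      "\<forall>l\<in>B. \<forall>k\<in>B. (\<Sum>i\<in>B. u l i * u k i) = (if l = k then 1 else 0)"
    by blast
  then have
    ev: "\<And>l i. l \<in> B \<Longrightarrow> i \<in> B \<Longrightarrow> (\<Sum>j\<in>B. A i j * u l j) = \<sigma> l * u l i"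
    and on: "\<And>l k. l \<in> B \<Longrightarrow> k \<in> B \<Longrightarrow> (\<Sum>i\<in>B. u l i * u k i) = (if l = k then 1 else 0)"
    by auto
  define r where "r i j = (if j = i then 1 else 0) - (\<Sum>l\<in>B. u l i * u l j)" for i j
  have r2: "(\<Sum>j\<in>B. r i j * r i j) = 1 - (\<Sum>l\<in>B. u l i * u l i)" if "i \<in> B" for i
    using proj[OF fin that that, of u] on by (simp add: r_def)
  have "(\<Sum>i\<in>B. \<Sum>j\<in>B. r i j * r i j) = real (card B) - (\<Sum>i\<in>B. \<Sum>l\<in>B. u l i * u l i)"
    using r2 by (simp add: sum_subtractf)
  also have "(\<Sum>i\<in>B. \<Sum>l\<in>B. u l i * u l i) = (\<Sum>l\<in>B. \<Sum>i\<in>B. u l i * u l i)" by (rule sum.swap)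
  also have "\<dots> = real (card B)" by (simp add: on)
  finally have sum0: "(\<Sum>i\<in>B. \<Sum>j\<in>B. r i j * r i j) = 0" by simp
  have r0: "r i j = 0" if "i \<in> B" "j \<in> B" for i j
  proof -
    have "(\<Sum>j\<in>B. r i j * r i j) = 0"
      using sum0 fin \<open>i \<in> B\<close> by (subst (asm) sum_nonneg_eq_0_iff) (auto intro: sum_nonneg)
    then have "r i j * r i j = 0"
      using fin \<open>j \<in> B\<close> by (subst (asm) sum_nonneg_eq_0_iff) auto
    then show ?thesis by simp
  qed
  have cols: "(\<Sum>l\<in>B. u l i * u l j) = (if i = j then 1 else 0)" if "i \<in> B" "j \<in> B" for i j
  proof -
    have "(\<Sum>l\<in>B. u l i * u l j) = (if j = i then 1 else 0)"
      using r0[OF that] unfolding r_def by linarith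
    also have "\<dots> = (if i = j then 1 else 0)" by (rule if_cong) auto
    finally show ?thesis .
  qed
  have "orthonormal_eigenbasis B A \<sigma> u"
    unfolding orthonormal_eigenbasis_def
    by (intro conjI ballI) (rule ev on cols; assumption)+
  then show thesis by (rule that)
qed

lemma sum_mult_delta:
  fixes f :: "'i \<Rightarrow> real"
  assumes "finite B" "k \<in> B"
  shows "(\<Sum>l\<in>B. f l * (if l = k then 1 else 0)) = f k"
    and "(\<Sum>l\<in>B. f l * (if k = l then 1 else 0)) = f k"
proof -
  have "(\<Sum>l\<in>B. f l * (if l = k then 1 else 0)) = (\<Sum>l\<in>B. if l = k then f l else 0)"
    by (intro sum.cong refl) auto
  then show "(\<Sum>l\<in>B. f l * (if l = k then 1 else 0)) = f k"
    using assms by (simp add: sum.delta)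
  then show "(\<Sum>l\<in>B. f l * (if k = l then 1 else 0)) = f k"
    by (simp add: eq_commute[of k])
qed

context
  fixes B :: "'i set" and A :: "'i \<Rightarrow> 'i \<Rightarrow> real" and \<sigma> :: "'i \<Rightarrow> real" and u :: "'i \<Rightarrow> 'i \<Rightarrow> real"
  assumes fin: "finite B" and eb: "orthonormal_eigenbasis B A \<sigma> u"
begin

lemma eigenbasis_eigen: "l \<in> B \<Longrightarrow> i \<in> B \<Longrightarrow> (\<Sum>j\<in>B. A i j * u l j) = \<sigma> l * u l i"
  using eb unfolding orthonormal_eigenbasis_def by blast

lemma eigenbasis_rows: "l \<in> B \<Longrightarrow> k \<in> B \<Longrightarrow> (\<Sum>i\<in>B. u l i * u k i) = (if l = k then 1 else 0)"
  using eb unfolding orthonormal_eigenbasis_def by blast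

lemma eigenbasis_cols: "i \<in> B \<Longrightarrow> j \<in> B \<Longrightarrow> (\<Sum>l\<in>B. u l i * u l j) = (if i = j then 1 else 0)"
  using eb unfolding orthonormal_eigenbasis_def by blast

lemma eigenbasis_decomposition:
  assumes "i \<in> B" "k \<in> B"
  shows "A i k = (\<Sum>l\<in>B. \<sigma> l * u l i * u l k)"
proof -
  have "(\<Sum>l\<in>B. \<sigma> l * u l i * u l k) = (\<Sum>l\<in>B. (\<Sum>j\<in>B. A i j * u l j) * u l k)"
    using assms by (intro sum.cong refl) (simp only: eigenbasis_eigen)
  also have "\<dots> = (\<Sum>l\<in>B. \<Sum>j\<in>B. A i j * (u l j * u l k))"
    by (simp only: sum_distrib_right mult.assoc)
  also have "\<dots> = (\<Sum>j\<in>B. A i j * (\<Sum>l\<in>B. u l j * u l k))"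
    unfolding sum_distrib_left by (rule sum.swap)
  also have "\<dots> = (\<Sum>j\<in>B. A i j * (if j = k then 1 else 0))"
    using assms by (intro sum.cong refl) (simp only: eigenbasis_cols)
  also have "\<dots> = A i k" by (rule sum_mult_delta(1)[OF fin assms(2)])
  finally show ?thesis ..
qed

lemma eigenbasis_quadratic_form:
  "(\<Sum>i\<in>B. \<Sum>k\<in>B. x i * y k * A i k) = (\<Sum>l\<in>B. \<sigma> l * (\<Sum>i\<in>B. x i * u l i) * (\<Sum>k\<in>B. y k * u l k))"
proof -
  have "(\<Sum>i\<in>B. \<Sum>k\<in>B. x i * y k * A i k)
      = (\<Sum>i\<in>B. \<Sum>k\<in>B. \<Sum>l\<in>B. \<sigma> l * ((x i * u l i) * (y k * u l k)))"
    by (intro sum.cong refl) (simp add: eigenbasis_decomposition sum_distrib_left mult_ac)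
  also have "\<dots> = (\<Sum>i\<in>B. \<Sum>l\<in>B. \<Sum>k\<in>B. \<sigma> l * ((x i * u l i) * (y k * u l k)))"
    by (intro sum.cong refl sum.swap)
  also have "\<dots> = (\<Sum>l\<in>B. \<Sum>i\<in>B. \<Sum>k\<in>B. \<sigma> l * ((x i * u l i) * (y k * u l k)))"
    by (rule sum.swap)
  also have "\<dots> = (\<Sum>l\<in>B. \<sigma> l * ((\<Sum>i\<in>B. x i * u l i) * (\<Sum>k\<in>B. y k * u l k)))"
    unfolding sum_product unfolding sum_distrib_left ..
  finally show ?thesis by (simp only: mult.assoc)
qed

lemma eigenbasis_parseval:
  "(\<Sum>l\<in>B. (\<Sum>i\<in>B. x i * u l i) * (\<Sum>k\<in>B. y k * u l k)) = (\<Sum>i\<in>B. x i * y i)"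
proof -
  have "(\<Sum>l\<in>B. (\<Sum>i\<in>B. x i * u l i) * (\<Sum>k\<in>B. y k * u l k))
      = (\<Sum>l\<in>B. \<Sum>i\<in>B. \<Sum>k\<in>B. x i * y k * (u l i * u l k))"
    unfolding sum_product by (intro sum.cong refl) (simp add: mult_ac)
  also have "\<dots> = (\<Sum>i\<in>B. \<Sum>l\<in>B. \<Sum>k\<in>B. x i * y k * (u l i * u l k))" by (rule sum.swap)
  also have "\<dots> = (\<Sum>i\<in>B. \<Sum>k\<in>B. \<Sum>l\<in>B. x i * y k * (u l i * u l k))"
    by (intro sum.cong refl sum.swap)
  also have "\<dots> = (\<Sum>i\<in>B. \<Sum>k\<in>B. x i * y k * (if i = k then 1 else 0))"
    by (intro sum.cong refl) (simp only: sum_distrib_left[symmetric] eigenbasis_cols)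
  also have "\<dots> = (\<Sum>i\<in>B. x i * y i)"
    by (intro sum.cong refl) (simp only: sum_mult_delta(2)[OF fin])
  finally show ?thesis .
qed

lemma eigenvalue_as_quadratic_form:
  assumes "l \<in> B"
  shows "(\<Sum>i\<in>B. \<Sum>k\<in>B. u l i * u l k * A i k) = \<sigma> l"
proof -
  have "(\<Sum>i\<in>B. \<Sum>k\<in>B. u l i * u l k * A i k) = (\<Sum>i\<in>B. u l i * (\<Sum>k\<in>B. A i k * u l k))"
    by (simp add: sum_distrib_left mult_ac)
  also have "\<dots> = (\<Sum>i\<in>B. \<sigma> l * (u l i * u l i))"
    using assms by (intro sum.cong refl) (simp add: eigenbasis_eigen)
  also have "\<dots> = \<sigma> l" using assms by (simp only: sum_distrib_left[symmetric] eigenbasis_rows) simp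
  finally show ?thesis .
qed

section \<open>Effective dimension of a matrix\<close>

text \<open>The trace of a rational function of \<open>A\<close> is bounded below by comparing \<open>A\<close> with a matrix \<open>G\<close>
  for which only the trace and the Frobenius norm are known: in the eigenbasis of \<open>A\<close> the diagonal
  entries \<open>w\<close> of \<open>G\<close> satisfy \<open>\<lambda> * w \<le> \<sigma>\<close>, hence \<open>\<sigma> / (n * \<lambda> + \<sigma>) \<ge> w / (n + w)\<close>, and the
  Cauchy-Schwarz inequality turns the sum of these fractions into the two invariants of \<open>G\<close>.\<close>

lemma effective_dimension_lower_bound:
  fixes G :: "'i \<Rightarrow> 'i \<Rightarrow> real"
  assumes n: "n > 0" and lam: "lam > 0"
    and G0: "\<And>x. 0 \<le> (\<Sum>i\<in>B. \<Sum>k\<in>B. x i * x k * G i k)"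
    and GA: "\<And>x. lam * (\<Sum>i\<in>B. \<Sum>k\<in>B. x i * x k * G i k) \<le> (\<Sum>i\<in>B. \<Sum>k\<in>B. x i * x k * A i k)"
  shows "(\<Sum>i\<in>B. G i i)\<^sup>2
      \<le> (\<Sum>l\<in>B. \<sigma> l / (n * lam + \<sigma> l)) * (n * (\<Sum>i\<in>B. G i i) + (\<Sum>i\<in>B. \<Sum>k\<in>B. (G i k)\<^sup>2))"
proof -
  define w where "w l = (\<Sum>i\<in>B. \<Sum>k\<in>B. u l i * u l k * G i k)" for l
  have w0: "w l \<ge> 0" for l using G0 by (simp add: w_def)
  have w\<sigma>: "lam * w l \<le> \<sigma> l" if "l \<in> B" for l
    using GA[of "u l"] eigenvalue_as_quadratic_form[OF that] by (simp add: w_def)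
  have sw: "(\<Sum>l\<in>B. w l) = (\<Sum>i\<in>B. G i i)"
  proof -
    have "(\<Sum>l\<in>B. w l) = (\<Sum>i\<in>B. \<Sum>l\<in>B. \<Sum>k\<in>B. u l i * u l k * G i k)"
      unfolding w_def by (rule sum.swap)
    also have "\<dots> = (\<Sum>i\<in>B. \<Sum>k\<in>B. \<Sum>l\<in>B. u l i * u l k * G i k)" by (intro sum.cong refl sum.swap)
    also have "\<dots> = (\<Sum>i\<in>B. \<Sum>k\<in>B. G i k * (if i = k then 1 else 0))"
      unfolding sum_distrib_right[symmetric]
      by (intro sum.cong refl) (simp only: eigenbasis_cols mult.commute[of _ "G _ _"])
    also have "\<dots> = (\<Sum>i\<in>B. G i i)"
      by (intro sum.cong refl) (simp only: sum_mult_delta(2)[OF fin])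
    finally show ?thesis .
  qed
  have sw2: "(\<Sum>l\<in>B. (w l)\<^sup>2) \<le> (\<Sum>i\<in>B. \<Sum>k\<in>B. (G i k)\<^sup>2)"
  proof -
    have "(\<Sum>l\<in>B. (w l)\<^sup>2) \<le> (\<Sum>l\<in>B. \<Sum>i\<in>B. (\<Sum>k\<in>B. G i k * u l k)\<^sup>2)"
    proof (rule sum_mono)
      fix l assume l: "l \<in> B"
      have "w l = (\<Sum>i\<in>B. u l i * (\<Sum>k\<in>B. G i k * u l k))"
        by (simp add: w_def sum_distrib_left mult_ac)
      then have "(w l)\<^sup>2 \<le> (\<Sum>i\<in>B. (u l i)\<^sup>2) * (\<Sum>i\<in>B. (\<Sum>k\<in>B. G i k * u l k)\<^sup>2)"
        by (simp only: Cauchy_Schwarz_ineq_sum)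
      also have "(\<Sum>i\<in>B. (u l i)\<^sup>2) = 1"
        using eigenbasis_rows[OF l l] by (simp add: power2_eq_square)
      finally show "(w l)\<^sup>2 \<le> (\<Sum>i\<in>B. (\<Sum>k\<in>B. G i k * u l k)\<^sup>2)" by simp
    qed
    also have "\<dots> = (\<Sum>i\<in>B. \<Sum>l\<in>B. (\<Sum>k\<in>B. G i k * u l k)\<^sup>2)" by (rule sum.swap)
    also have "\<dots> = (\<Sum>i\<in>B. \<Sum>k\<in>B. (G i k)\<^sup>2)"
      unfolding power2_eq_square by (rule sum.cong[OF refl]) (rule eigenbasis_parseval)
    finally show ?thesis .
  qed
  have frac: "w l / (n + w l) \<le> \<sigma> l / (n * lam + \<sigma> l)" if "l \<in> B" for l
  proof -
    have s: "0 \<le> \<sigma> l" using w\<sigma>[OF that] w0[of l] lam by (meson mult_nonneg_nonneg less_imp_le order_trans)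
    have "w l * (n * lam + \<sigma> l) \<le> \<sigma> l * (n + w l)"
      using mult_left_mono[OF w\<sigma>[OF that], of n] n by (simp add: algebra_simps)
    moreover have "0 < n + w l" "0 < n * lam + \<sigma> l"
      using add_pos_nonneg[OF n w0] add_pos_nonneg[OF mult_pos_pos[OF n lam] s] by blast+
    ultimately show ?thesis by (simp add: divide_le_eq pos_le_divide_eq field_simps)
  qed
  have "(\<Sum>l\<in>B. w l)\<^sup>2 = (\<Sum>l\<in>B. sqrt (w l / (n + w l)) * sqrt (w l * (n + w l)))\<^sup>2"
  proof -
    have "sqrt (w l / (n + w l)) * sqrt (w l * (n + w l)) = w l" for l
    proof -
      have "n + w l > 0" using n w0[of l] by simp
      then have "w l / (n + w l) * (w l * (n + w l)) = w l * w l" by simp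
      then show ?thesis using w0[of l] by (simp only: real_sqrt_mult[symmetric] real_sqrt_abs2 abs_of_nonneg)
    qed
    then show ?thesis by simp
  qed
  also have "\<dots> \<le> (\<Sum>l\<in>B. (sqrt (w l / (n + w l)))\<^sup>2) * (\<Sum>l\<in>B. (sqrt (w l * (n + w l)))\<^sup>2)"
    by (rule Cauchy_Schwarz_ineq_sum)
  also have "\<dots> = (\<Sum>l\<in>B. w l / (n + w l)) * (\<Sum>l\<in>B. w l * (n + w l))"
    using n w0 by (simp add: add_nonneg_nonneg)
  also have "(\<Sum>l\<in>B. w l * (n + w l)) = n * (\<Sum>l\<in>B. w l) + (\<Sum>l\<in>B. (w l)\<^sup>2)"
    by (simp add: distrib_left sum.distrib sum_distrib_left power2_eq_square mult.commute)
  also have "(\<Sum>l\<in>B. w l / (n + w l)) * (n * (\<Sum>l\<in>B. w l) + (\<Sum>l\<in>B. (w l)\<^sup>2))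
      \<le> (\<Sum>l\<in>B. \<sigma> l / (n * lam + \<sigma> l)) * (n * (\<Sum>i\<in>B. G i i) + (\<Sum>i\<in>B. \<Sum>k\<in>B. (G i k)\<^sup>2))"
  proof (rule mult_mono)
    show "(\<Sum>l\<in>B. w l / (n + w l)) \<le> (\<Sum>l\<in>B. \<sigma> l / (n * lam + \<sigma> l))"
      by (rule sum_mono) (rule frac)
    then show "0 \<le> (\<Sum>l\<in>B. \<sigma> l / (n * lam + \<sigma> l))"
      using w0 n by (intro order_trans[OF _ \<open>_ \<le> (\<Sum>l\<in>B. \<sigma> l / _ l)\<close>] sum_nonneg divide_nonneg_pos) (auto simp: add_pos_nonneg)
    show "n * (\<Sum>l\<in>B. w l) + (\<Sum>l\<in>B. (w l)\<^sup>2) \<le> n * (\<Sum>i\<in>B. G i i) + (\<Sum>i\<in>B. \<Sum>k\<in>B. (G i k)\<^sup>2)"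
      using sw sw2 by simp
    show "0 \<le> n * (\<Sum>l\<in>B. w l) + (\<Sum>l\<in>B. (w l)\<^sup>2)"
      using n w0 by (simp add: sum_nonneg)
  qed
  finally show ?thesis by (simp only: sw)
qed

end

text \<open>A principal submatrix has the smaller effective dimension.  With \<open>a\<close> the squared coefficients
  of the normalised eigenvectors of the submatrix in the large eigenbasis, \<open>1 / \<tau> j\<close> is the average of
  the \<open>1 / \<sigma> l\<close> with weights \<open>a j l\<close>, no eigenvalue \<open>\<sigma> l\<close> is used with total weight above one, and
  \<open>\<sigma> / (c + \<sigma>) = 1 / (1 + c * (1 / \<sigma>))\<close> is a convex function of \<open>1 / \<sigma>\<close>; so Jensen's inequality, in the
  form of the tangent at \<open>1 / \<tau> j\<close>, applies.\<close>

theorem effective_dimension_submatrix_le: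
  fixes A :: "'i \<Rightarrow> 'i \<Rightarrow> real"
  assumes fin: "finite C" and sub: "B \<subseteq> C"
    and C: "orthonormal_eigenbasis C A \<sigma> u" and B: "orthonormal_eigenbasis B A \<tau> v"
    and \<sigma>: "\<And>l. l \<in> C \<Longrightarrow> \<sigma> l > 0" and \<tau>: "\<And>j. j \<in> B \<Longrightarrow> \<tau> j > 0" and c: "c > 0"
  shows "(\<Sum>j\<in>B. \<tau> j / (c + \<tau> j)) \<le> (\<Sum>l\<in>C. \<sigma> l / (c + \<sigma> l))"
proof -
  have finB: "finite B" using fin sub by (rule finite_subset[rotated])
  define t where "t j l = (\<Sum>i\<in>B. v j i * u l i)" for j l
  define a where "a j l = (t j l)\<^sup>2 * \<sigma> l / \<tau> j" for j l
  define \<psi> where "\<psi> y = 1 / (1 + c * y)" for y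
  have ext: "(\<Sum>i\<in>C. (if i \<in> B then x i else 0) * y i) = (\<Sum>i\<in>B. x i * y i)" for x y :: "'i \<Rightarrow> real"
    using fin sub by (intro sum.mono_neutral_cong_right) auto
  have ext2: "(\<Sum>i\<in>C. \<Sum>k\<in>C. (if i \<in> B then x i else 0) * (if k \<in> B then y k else 0) * A i k)
      = (\<Sum>i\<in>B. \<Sum>k\<in>B. x i * y k * A i k)" for x y
  proof -
    have "(\<Sum>i\<in>C. \<Sum>k\<in>C. (if i \<in> B then x i else 0) * (if k \<in> B then y k else 0) * A i k)
        = (\<Sum>i\<in>C. (if i \<in> B then x i else 0) * (\<Sum>k\<in>C. (if k \<in> B then y k else 0) * A i k))"
      by (simp only: sum_distrib_left mult.assoc)
    also have "\<dots> = (\<Sum>i\<in>B. x i * (\<Sum>k\<in>B. y k * A i k))" unfolding ext ..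
    finally show ?thesis by (simp only: sum_distrib_left mult.assoc)
  qed
  have a0: "a j l \<ge> 0" if "j \<in> B" "l \<in> C" for j l
    using \<sigma>[OF that(2)] \<tau>[OF that(1)] by (simp add: a_def)
  have row: "(\<Sum>l\<in>C. a j l) = 1" if j: "j \<in> B" for j
  proof -
    have "(\<Sum>l\<in>C. a j l) = (\<Sum>l\<in>C. \<sigma> l * t j l * t j l) / \<tau> j"
      unfolding sum_divide_distrib by (intro sum.cong refl) (simp add: a_def power2_eq_square)
    also have "(\<Sum>l\<in>C. \<sigma> l * t j l * t j l) = (\<Sum>i\<in>B. \<Sum>k\<in>B. v j i * v j k * A i k)"
      using eigenbasis_quadratic_form[OF fin C, of "\<lambda>i. if i \<in> B then v j i else 0" "\<lambda>i. if i \<in> B then v j i else 0"]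
      unfolding ext ext2 t_def by (rule sym)
    also have "\<dots> = \<tau> j" by (rule eigenvalue_as_quadratic_form[OF finB B j])
    finally show ?thesis using \<tau>[OF j] by simp
  qed
  have mean: "(\<Sum>l\<in>C. a j l * (1 / \<sigma> l)) = 1 / \<tau> j" if j: "j \<in> B" for j
  proof -
    have "(\<Sum>l\<in>C. a j l * (1 / \<sigma> l)) = (\<Sum>l\<in>C. t j l * t j l) / \<tau> j"
      unfolding sum_divide_distrib
    proof (intro sum.cong refl)
      fix l assume "l \<in> C"
      then show "a j l * (1 / \<sigma> l) = t j l * t j l / \<tau> j"
        using \<sigma>[of l] by (simp add: a_def power2_eq_square)
    qed
    also have "(\<Sum>l\<in>C. t j l * t j l) = (\<Sum>i\<in>B. v j i * v j i)"
      using eigenbasis_parseval[OF fin C, of "\<lambda>i. if i \<in> B then v j i else 0" "\<lambda>i. if i \<in> B then v j i else 0"]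
      unfolding ext t_def[symmetric]
      by (simp only: ext[of "v j" "\<lambda>i. if i \<in> B then v j i else 0"] cong: sum.cong) simp
    also have "\<dots> = 1" using eigenbasis_rows[OF finB B j j] by simp
    finally show ?thesis .
  qed
  have col: "(\<Sum>j\<in>B. a j l) \<le> 1" if l: "l \<in> C" for l
  proof -
    define w where "w i = (\<Sum>j\<in>B. (t j l / \<tau> j) * v j i)" for i
    define q where "q = (\<Sum>j\<in>B. (t j l)\<^sup>2 / \<tau> j)"
    have inner: "(\<Sum>i\<in>B. w i * y i) = (\<Sum>j\<in>B. (t j l / \<tau> j) * (\<Sum>i\<in>B. v j i * y i))" for y
    proof -
      have "(\<Sum>i\<in>B. w i * y i) = (\<Sum>i\<in>B. \<Sum>j\<in>B. (t j l / \<tau> j) * (v j i * y i))"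
        unfolding w_def sum_distrib_right by (intro sum.cong refl) (simp add: mult_ac)
      also have "\<dots> = (\<Sum>j\<in>B. \<Sum>i\<in>B. (t j l / \<tau> j) * (v j i * y i))" by (rule sum.swap)
      finally show ?thesis by (simp only: sum_distrib_left)
    qed
    have wu: "(\<Sum>i\<in>B. w i * u l i) = q"
      unfolding inner q_def by (simp add: t_def[symmetric] power2_eq_square)
    have wv: "(\<Sum>i\<in>B. w i * v j i) = t j l / \<tau> j" if j: "j \<in> B" for j
    proof -
      have "(\<Sum>i\<in>B. w i * v j i) = (\<Sum>k\<in>B. (t k l / \<tau> k) * (if k = j then 1 else 0))"
        unfolding inner using j by (intro sum.cong refl) (simp only: eigenbasis_rows[OF finB B])
      then show ?thesis by (simp only: sum_mult_delta(1)[OF finB j])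
    qed
    have "(\<Sum>i\<in>B. \<Sum>k\<in>B. w i * w k * A i k) = (\<Sum>j\<in>B. \<tau> j * (t j l / \<tau> j) * (t j l / \<tau> j))"
      unfolding eigenbasis_quadratic_form[OF finB B] by (intro sum.cong refl) (simp only: wv)
    also have "\<dots> = q" unfolding q_def
    proof (intro sum.cong refl)
      fix j assume "j \<in> B"
      then show "\<tau> j * (t j l / \<tau> j) * (t j l / \<tau> j) = (t j l)\<^sup>2 / \<tau> j"
        using \<tau>[of j] by (simp add: power2_eq_square)
    qed
    finally have "q = (\<Sum>k\<in>C. \<sigma> k * (\<Sum>i\<in>B. w i * u k i) * (\<Sum>i\<in>B. w i * u k i))"
      using eigenbasis_quadratic_form[OF fin C, of "\<lambda>i. if i \<in> B then w i else 0" "\<lambda>i. if i \<in> B then w i else 0"]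
      unfolding ext ext2 by simp
    also have "\<dots> \<ge> \<sigma> l * (\<Sum>i\<in>B. w i * u l i) * (\<Sum>i\<in>B. w i * u l i)"
      by (rule member_le_sum[OF l _ fin]) (simp add: \<sigma> less_imp_le mult.assoc)
    finally have "\<sigma> l * q * q \<le> q" unfolding wu .
    moreover have "q \<ge> 0" unfolding q_def using \<tau> by (intro sum_nonneg) (simp add: less_imp_le)
    ultimately have "\<sigma> l * q \<le> 1"
      by (cases "q = 0") auto
    also have "\<sigma> l * q = (\<Sum>j\<in>B. a j l)"
      unfolding q_def a_def sum_distrib_left by (intro sum.cong refl) simp
    finally show ?thesis .
  qed
  have tangent: "\<psi> y \<ge> \<psi> y0 - c * (\<psi> y0)\<^sup>2 * (y - y0)" if "y \<ge> 0" "y0 \<ge> 0" for y y0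
  proof -
    have p: "1 + c * y > 0" "1 + c * y0 > 0" using that c by (auto intro: add_pos_nonneg)
    have "\<psi> y - (\<psi> y0 - c * (\<psi> y0)\<^sup>2 * (y - y0)) = c\<^sup>2 * (y - y0)\<^sup>2 / ((1 + c * y) * (1 + c * y0)\<^sup>2)"
      using p unfolding \<psi>_def by (simp add: divide_simps power2_eq_square) (simp add: algebra_simps)
    also have "\<dots> \<ge> 0" using p by simp
    finally show ?thesis by simp
  qed
  have conv: "x / (c + x) = \<psi> (1 / x)" if "x > 0" for x
    using that c unfolding \<psi>_def by (simp add: field_simps)
  have \<psi>0: "\<psi> (1 / \<sigma> l) \<ge> 0" if "l \<in> C" for l
    using \<sigma>[OF that] c unfolding \<psi>_def by simp
  have "(\<Sum>j\<in>B. \<tau> j / (c + \<tau> j)) \<le> (\<Sum>j\<in>B. \<Sum>l\<in>C. a j l * \<psi> (1 / \<sigma> l))"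
  proof (rule sum_mono)
    fix j assume j: "j \<in> B"
    let ?y = "1 / \<tau> j"
    have "\<tau> j / (c + \<tau> j) = \<psi> ?y * (\<Sum>l\<in>C. a j l) - c * (\<psi> ?y)\<^sup>2 * ((\<Sum>l\<in>C. a j l * (1 / \<sigma> l)) - ?y * (\<Sum>l\<in>C. a j l))"
      using row[OF j] mean[OF j] conv[OF \<tau>[OF j]] by simp
    also have "\<dots> = (\<Sum>l\<in>C. a j l * (\<psi> ?y - c * (\<psi> ?y)\<^sup>2 * (1 / \<sigma> l - ?y)))"
    proof -
      have "a j l * (\<psi> ?y - c * (\<psi> ?y)\<^sup>2 * (1 / \<sigma> l - ?y))
          = \<psi> ?y * a j l - c * (\<psi> ?y)\<^sup>2 * (a j l * (1 / \<sigma> l) - ?y * a j l)" for l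
        by (simp only: right_diff_distrib) (simp only: mult_ac)
      then show ?thesis
        by (simp only: sum_distrib_left[symmetric] sum_subtractf)
    qed
    also have "\<dots> \<le> (\<Sum>l\<in>C. a j l * \<psi> (1 / \<sigma> l))"
      using \<sigma> \<tau>[OF j] by (intro sum_mono mult_left_mono tangent a0 j) (auto simp: less_imp_le)
    finally show "\<tau> j / (c + \<tau> j) \<le> (\<Sum>l\<in>C. a j l * \<psi> (1 / \<sigma> l))" .
  qed
  also have "\<dots> = (\<Sum>l\<in>C. (\<Sum>j\<in>B. a j l) * \<psi> (1 / \<sigma> l))"
    unfolding sum_distrib_right by (rule sum.swap)
  also have "\<dots> \<le> (\<Sum>l\<in>C. 1 * \<psi> (1 / \<sigma> l))"
    by (intro sum_mono mult_right_mono col \<psi>0)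
  also have "\<dots> = (\<Sum>l\<in>C. \<sigma> l / (c + \<sigma> l))"
    using \<sigma> by (intro sum.cong refl) (simp only: conv mult_1)
  finally show ?thesis .
qed

section \<open>Characteristic polynomial and inverse of a matrix\<close>

lemma proots_prod_linear_factors:
  fixes xs :: "real list"
  shows "proots (\<Prod>a\<leftarrow>xs. [:- a, 1:]) = mset xs"
proof (induction xs)
  case (Cons a xs)
  have "(\<Prod>a\<leftarrow>xs. [:- a, 1:]) \<noteq> (0 :: real poly)"
    by (auto simp: prod_list_zero_iff)
  then have "proots ([:- a, 1:] * (\<Prod>a\<leftarrow>xs. [:- a, 1:])) = proots [:- a, 1:] + proots (\<Prod>a\<leftarrow>xs. [:- a, 1:])"
    by (intro proots_mult) auto
  then show ?case
    using Cons by (simp only: list.map prod_list.Cons proots_linear_factor mset.simps) simp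
qed simp

text \<open>The matrix of eigenvectors diagonalises the matrix by a similarity, so that the roots of the
  characteristic polynomial are the eigenvalues of the basis with their multiplicities.\<close>

lemma proots_char_poly_eigenbasis:
  assumes eb: "orthonormal_eigenbasis {..<m} A \<sigma> u"
  shows "proots (char_poly (Matrix.mat m m (\<lambda>(i, j). A i j))) = mset (map \<sigma> [0..<m])"
proof -
  let ?M = "Matrix.mat m m (\<lambda>(i, j). A i j)"
  let ?P = "Matrix.mat m m (\<lambda>(i, l). u l i)"
  let ?Q = "Matrix.mat m m (\<lambda>(l, i). u l i)"
  let ?D = "Matrix.mat m m (\<lambda>(l, k). if l = k then \<sigma> l else 0)"
  have fin: "finite {..<m}" by simp
  have PQ: "?P * ?Q = 1\<^sub>m m"
    using eigenbasis_cols[OF fin eb]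
    by (intro eq_matI) (auto simp: scalar_prod_def atLeast0LessThan)
  have QP: "?Q * ?P = 1\<^sub>m m"
    using eigenbasis_rows[OF fin eb]
    by (intro eq_matI) (auto simp: scalar_prod_def atLeast0LessThan)
  have PD: "?P * ?D = Matrix.mat m m (\<lambda>(i, l). u l i * \<sigma> l)"
  proof (intro eq_matI, goal_cases)
    case (1 i l)
    then have "(?P * ?D) $$ (i, l) = (\<Sum>k<m. u k i * \<sigma> k * (if k = l then 1 else 0))"
      by (auto simp: scalar_prod_def atLeast0LessThan intro!: sum.cong)
    then show ?case using 1 sum_mult_delta(1)[OF fin, of l "\<lambda>k. u k i * \<sigma> k"] by simp
  qed auto
  have "?M = ?P * ?D * ?Q"
    unfolding PD
    by (intro eq_matI) (auto simp: scalar_prod_def atLeast0LessThan eigenbasis_decomposition[OF fin eb] mult_ac intro!: sum.cong)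
  then have "similar_mat ?M ?D"
    unfolding similar_mat_def using PQ QP
    by (intro exI[of _ ?P] exI[of _ ?Q] similar_mat_witI[where n = m]) auto
  then have "char_poly ?M = char_poly ?D" by (rule char_poly_similar)
  also have "\<dots> = (\<Prod>a\<leftarrow>diag_mat ?D. [:- a, 1:])"
    by (rule char_poly_upper_triangular[of _ m]) auto
  also have "diag_mat ?D = map \<sigma> [0..<m]" by (simp add: diag_mat_def)
  finally show ?thesis by (simp only: proots_prod_linear_factors)
qed

lemma sum_proots_char_poly_eigenbasis:
  assumes "orthonormal_eigenbasis {..<m} A \<sigma> u"
  shows "(\<Sum>s\<in>#proots (char_poly (Matrix.mat m m (\<lambda>(i, j). A i j))). f s) = (\<Sum>l<m. f (\<sigma> l))"
proof -
  have "image_mset f (proots (char_poly (Matrix.mat m m (\<lambda>(i, j). A i j)))) = mset (map (\<lambda>l. f (\<sigma> l)) [0..<m])"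
    unfolding proots_char_poly_eigenbasis[OF assms] by (simp only: mset_map[symmetric] map_map comp_def)
  then have "(\<Sum>s\<in>#proots (char_poly (Matrix.mat m m (\<lambda>(i, j). A i j))). f s) = (\<Sum>l\<leftarrow>[0..<m]. f (\<sigma> l))"
    by (simp only: sum_mset_sum_list)
  then show ?thesis
    by (simp only: interv_sum_list_conv_sum_set_nat set_upt atLeast0LessThan)
qed

text \<open>The matrix \<open>W\<close> is the same for all right-hand sides, so that interpolation coefficients converge
  together with the interpolated values.\<close>

lemma mat_inverse_linear:
  fixes A :: "nat \<Rightarrow> nat \<Rightarrow> real"
  assumes nz: "\<And>v. \<exists>i<m. v i \<noteq> 0 \<Longrightarrow> (\<Sum>i<m. \<Sum>j<m. v i * v j * A i j) \<noteq> 0"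
  obtains W where
    "\<And>y j. j < m \<Longrightarrow> vec_index (the (mat_inverse (Matrix.mat m m (\<lambda>(i, j). A i j))) *\<^sub>v Matrix.vec m y) j = (\<Sum>i<m. W j i * y i)"
    "\<And>y i. i < m \<Longrightarrow> (\<Sum>j<m. A i j * (\<Sum>k<m. W j k * y k)) = y i"
proof -
  let ?M = "Matrix.mat m m (\<lambda>(i, j). A i j)"
  have M: "?M \<in> carrier_mat m m" by simp
  have "Determinant.det ?M \<noteq> 0"
  proof
    assume "Determinant.det ?M = 0"
    then obtain v where v: "v \<in> carrier_vec m" "v \<noteq> 0\<^sub>v m" "?M *\<^sub>v v = 0\<^sub>v m"
      using det_0_iff_vec_prod_zero_field[OF M] by auto
    then obtain k where k: "k < m" "vec_index v k \<noteq> 0"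
      by (metis carrier_vecD eq_vecI index_zero_vec(1) index_zero_vec(2))
    have "(\<Sum>j<m. A i j * vec_index v j) = 0" if "i < m" for i
    proof -
      have "vec_index (?M *\<^sub>v v) i = 0" using v(3) that by simp
      then show ?thesis using that v(1) by (simp add: scalar_prod_def atLeast0LessThan)
    qed
    then have "(\<Sum>i<m. vec_index v i * (\<Sum>j<m. A i j * vec_index v j)) = 0" by simp
    then have "(\<Sum>i<m. \<Sum>j<m. vec_index v i * vec_index v j * A i j) = 0"
      by (simp add: sum_distrib_left mult_ac)
    then show False using nz[of "vec_index v"] k by auto
  qed
  then have "?M \<in> Units (ring_mat TYPE(real) m (undefined :: unit))" by (rule det_non_zero_imp_unit[OF M])
  then obtain N where N: "mat_inverse ?M = Some N"
    using mat_inverse(1)[OF M, where b = "undefined :: unit"] by (cases "mat_inverse ?M") auto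
  have N1: "?M * N = 1\<^sub>m m" "N \<in> carrier_mat m m" using mat_inverse(2)[OF M N] by auto
  have idx: "vec_index (the (mat_inverse ?M) *\<^sub>v Matrix.vec m y) j = (\<Sum>i<m. N $$ (j, i) * y i)" if "j < m" for y j
    using that N1(2) by (simp add: N scalar_prod_def atLeast0LessThan)
  have "(\<Sum>j<m. A i j * (\<Sum>k<m. N $$ (j, k) * y k)) = y i" if i: "i < m" for y i
  proof -
    define a where "a = N *\<^sub>v Matrix.vec m y"
    have da: "dim_vec a = m" using N1 by (simp add: a_def)
    have "?M *\<^sub>v a = (?M * N) *\<^sub>v Matrix.vec m y"
      unfolding a_def using assoc_mult_mat_vec[OF M N1(2), of "Matrix.vec m y"] by simp
    then have "?M *\<^sub>v a = Matrix.vec m y" unfolding N1 by simp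
    then have "vec_index (?M *\<^sub>v a) i = y i" using i by simp
    then have "(\<Sum>j<m. A i j * vec_index a j) = y i" using i da by (simp add: scalar_prod_def atLeast0LessThan)
    moreover have "vec_index a j = (\<Sum>k<m. N $$ (j, k) * y k)" if "j < m" for j
      using idx[OF that, of y] by (simp add: a_def N)
    ultimately show ?thesis by simp
  qed
  with idx show thesis by (rule that)
qed

section \<open>Positive semidefinite kernels\<close>

definition psd_kernel :: "'a set \<Rightarrow> ('a \<Rightarrow> 'a \<Rightarrow> real) \<Rightarrow> bool" where
  "psd_kernel X P \<longleftrightarrow> (\<forall>x\<in>X. \<forall>y\<in>X. P x y = P y x) \<and>
    (\<forall>S a. finite S \<longrightarrow> S \<subseteq> X \<longrightarrow> 0 \<le> (\<Sum>x\<in>S. \<Sum>y\<in>S. a x * a y * P x y))"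

lemma psd_kernel_sym: "psd_kernel X P \<Longrightarrow> x \<in> X \<Longrightarrow> y \<in> X \<Longrightarrow> P x y = P y x"
  unfolding psd_kernel_def by blast

lemma psd_kernel_nonneg:
  "psd_kernel X P \<Longrightarrow> finite S \<Longrightarrow> S \<subseteq> X \<Longrightarrow> 0 \<le> (\<Sum>x\<in>S. \<Sum>y\<in>S. a x * a y * P x y)"
  unfolding psd_kernel_def by blast

text \<open>The points \<open>z i\<close> may coincide: the form is that of the distinct points, each with the sum of the
  coefficients attached to it.\<close>

lemma psd_kernel_family:
  assumes P: "psd_kernel X P" and B: "finite B" and z: "\<And>i. i \<in> B \<Longrightarrow> z i \<in> X"
  shows "0 \<le> (\<Sum>i\<in>B. \<Sum>j\<in>B. b i * b j * P (z i) (z j))"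
proof -
  define a where "a x = (\<Sum>i | i \<in> B \<and> z i = x. b i)" for x
  have gen: "(\<Sum>i\<in>B. b i * g (z i)) = (\<Sum>x\<in>z ` B. a x * g x)" for g
  proof -
    have "(\<Sum>i\<in>B. b i * g (z i)) = (\<Sum>x\<in>z ` B. \<Sum>i | i \<in> B \<and> z i = x. b i * g (z i))"
      by (rule sum.image_gen[OF B])
    also have "\<dots> = (\<Sum>x\<in>z ` B. a x * g x)"
      unfolding a_def sum_distrib_right by (intro sum.cong refl) auto
    finally show ?thesis .
  qed
  have "(\<Sum>i\<in>B. \<Sum>j\<in>B. b i * b j * P (z i) (z j)) = (\<Sum>i\<in>B. b i * (\<Sum>j\<in>B. b j * P (z i) (z j)))"
    by (simp only: sum_distrib_left mult.assoc)
  also have "\<dots> = (\<Sum>i\<in>B. b i * (\<Sum>y\<in>z ` B. a y * P (z i) y))"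
    by (simp only: gen)
  also have "\<dots> = (\<Sum>x\<in>z ` B. a x * (\<Sum>y\<in>z ` B. a y * P x y))"
    by (rule gen)
  also have "\<dots> = (\<Sum>x\<in>z ` B. \<Sum>y\<in>z ` B. a x * a y * P x y)"
    by (simp only: sum_distrib_left mult.assoc)
  also have "\<dots> \<ge> 0"
    using P B z unfolding psd_kernel_def by (auto simp: image_subset_iff)
  finally show ?thesis .
qed

lemma psd_kernel_diag: "psd_kernel X P \<Longrightarrow> x \<in> X \<Longrightarrow> 0 \<le> P x x"
  using psd_kernel_family[of X P "{()}" "\<lambda>_. x" "\<lambda>_. 1"] by simp

lemma psd_kernel_abs_le:
  assumes P: "psd_kernel X P" and x: "x \<in> X" "y \<in> X" and C: "\<And>x. x \<in> X \<Longrightarrow> P x x \<le> C"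
  shows "\<bar>P x y\<bar> \<le> C"
proof -
  have *: "0 \<le> P x x + P y y + 2 * s * P x y" if "s * s = 1" for s
  proof -
    have "0 \<le> (\<Sum>i\<in>{False, True}. \<Sum>j\<in>{False, True}. (if i then 1 else s) * (if j then 1 else s)
        * P (if i then x else y) (if j then x else y))"
      by (rule psd_kernel_family[OF P]) (auto simp: x)
    then show ?thesis
      using psd_kernel_sym[OF P x] that
      by (simp add: distrib_left mult.assoc[symmetric])
  qed
  show ?thesis using *[of 1] *[of "-1"] C[OF x(1)] C[OF x(2)] by linarith
qed

lemma psd_kernel_add:
  assumes "psd_kernel X P" "psd_kernel X Q"
  shows "psd_kernel X (\<lambda>x y. P x y + Q x y)"
  using assms unfolding psd_kernel_def by (auto simp: distrib_left sum.distrib intro: add_nonneg_nonneg)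

lemma psd_kernel_scale:
  assumes "psd_kernel X P" "0 \<le> c"
  shows "psd_kernel X (\<lambda>x y. c * P x y)"
proof -
  have "(\<Sum>x\<in>S. \<Sum>y\<in>S. a x * a y * (c * P x y)) = c * (\<Sum>x\<in>S. \<Sum>y\<in>S. a x * a y * P x y)" for S a
    by (simp add: sum_distrib_left mult_ac)
  then show ?thesis using assms unfolding psd_kernel_def by simp
qed

lemma psd_kernel_rank_one: "psd_kernel X (\<lambda>x y. p x * p y :: real)"
proof -
  have "(\<Sum>x\<in>S. \<Sum>y\<in>S. a x * a y * (p x * p y)) = (\<Sum>x\<in>S. a x * p x)\<^sup>2" for S a
    unfolding power2_eq_square sum_product by (intro sum.cong refl) (simp add: mult_ac)
  then show ?thesis unfolding psd_kernel_def by simp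
qed

lemma psd_kernel_sum:
  assumes "finite F" "\<And>k. k \<in> F \<Longrightarrow> psd_kernel X (P k)"
  shows "psd_kernel X (\<lambda>x y. \<Sum>k\<in>F. P k x y)"
  using assms
proof (induction F rule: finite_induct)
  case empty
  then show ?case by (simp add: psd_kernel_def)
next
  case (insert k F)
  then show ?case by (simp add: psd_kernel_add)
qed

text \<open>The Schur product theorem: on a finite set, the spectral decomposition writes one factor as a
  nonnegative combination of kernels of rank one, and multiplication by a kernel of rank one only
  rescales the coefficients of the other quadratic form.\<close>

lemma psd_kernel_mult:
  assumes P: "psd_kernel X P" and Q: "psd_kernel X Q"
  shows "psd_kernel X (\<lambda>x y. P x y * Q x y)"
  unfolding psd_kernel_def
proof (intro conjI ballI allI impI)
  fix x y assume "x \<in> X" "y \<in> X"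
  then show "P x y * Q x y = P y x * Q y x"
    using psd_kernel_sym[OF P] psd_kernel_sym[OF Q] by metis
next
  fix S a assume S: "finite S" "S \<subseteq> X"
  obtain \<sigma> u where eb: "orthonormal_eigenbasis S P \<sigma> u"
    by (rule symmetric_matrix_eigenbasis[OF S(1), of P]) (use psd_kernel_sym[OF P] S(2) in blast)+
  have \<sigma>0: "\<sigma> l \<ge> 0" if "l \<in> S" for l
  proof -
    have "0 \<le> (\<Sum>x\<in>S. \<Sum>y\<in>S. u l x * u l y * P x y)"
      using P S unfolding psd_kernel_def by blast
    then show ?thesis by (simp only: eigenvalue_as_quadratic_form[OF S(1) eb that])
  qed
  have "(\<Sum>x\<in>S. \<Sum>y\<in>S. a x * a y * (P x y * Q x y))
      = (\<Sum>x\<in>S. \<Sum>y\<in>S. \<Sum>l\<in>S. \<sigma> l * ((a x * u l x) * (a y * u l y) * Q x y))"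
    by (intro sum.cong refl)
      (simp add: eigenbasis_decomposition[OF S(1) eb] sum_distrib_left sum_distrib_right mult_ac)
  also have "\<dots> = (\<Sum>x\<in>S. \<Sum>l\<in>S. \<Sum>y\<in>S. \<sigma> l * ((a x * u l x) * (a y * u l y) * Q x y))"
    by (intro sum.cong refl sum.swap)
  also have "\<dots> = (\<Sum>l\<in>S. \<Sum>x\<in>S. \<Sum>y\<in>S. \<sigma> l * ((a x * u l x) * (a y * u l y) * Q x y))"
    by (rule sum.swap)
  also have "\<dots> = (\<Sum>l\<in>S. \<sigma> l * (\<Sum>x\<in>S. \<Sum>y\<in>S. (a x * u l x) * (a y * u l y) * Q x y))"
    by (simp only: sum_distrib_left)
  also have "\<dots> \<ge> 0"
  proof (rule sum_nonneg, rule mult_nonneg_nonneg, erule \<sigma>0)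
    fix l assume "l \<in> S"
    show "0 \<le> (\<Sum>x\<in>S. \<Sum>y\<in>S. (a x * u l x) * (a y * u l y) * Q x y)"
      using psd_kernel_nonneg[OF Q S, of "\<lambda>x. a x * u l x"] .
  qed
  finally show "0 \<le> (\<Sum>x\<in>S. \<Sum>y\<in>S. a x * a y * (P x y * Q x y))" .
qed

section \<open>Square-integrable functions\<close>

lemma discriminant_nonneg:
  fixes a b c :: real
  assumes nonneg: "\<And>t. 0 \<le> a + 2 * t * b + t\<^sup>2 * c" and "c \<ge> 0"
  shows "b\<^sup>2 \<le> a * c"
proof (cases "c = 0")
  case True
  have "- 2 * b = 0"
  proof (rule linear_term_vanishes)
    fix t :: real
    show "t * (- 2 * b) \<le> t\<^sup>2 * a"
    proof (cases "t = 0")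
      case False
      have "0 \<le> t\<^sup>2 * (a + 2 * (1 / t) * b + (1 / t)\<^sup>2 * c)"
        by (intro mult_nonneg_nonneg nonneg) simp
      also have "\<dots> = t\<^sup>2 * a + 2 * t * b"
        using False True by (simp add: power2_eq_square distrib_left)
      finally show ?thesis by simp
    qed simp
  qed
  then show ?thesis using True by simp
next
  case False
  then have c: "c > 0" using \<open>c \<ge> 0\<close> by simp
  have "0 \<le> c * (a + 2 * (- b / c) * b + (- b / c)\<^sup>2 * c)"
    using c by (intro mult_nonneg_nonneg nonneg) simp
  also have "\<dots> = a * c - b\<^sup>2" using c by (simp add: power2_eq_square field_simps)
  finally show ?thesis by simp
qed

lemma L2_spaceD: "f \<in> L2_space M \<Longrightarrow> f \<in> borel_measurable M" "f \<in> L2_space M \<Longrightarrow> integrable M (\<lambda>x. (f x)\<^sup>2)"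
  by (auto simp: L2_space_def)

lemma integrable_L2_mult:
  assumes "f \<in> L2_space M" "g \<in> L2_space M"
  shows "integrable M (\<lambda>x. f x * g x)"
proof (rule Bochner_Integration.integrable_bound)
  show "integrable M (\<lambda>x. (f x)\<^sup>2 + (g x)\<^sup>2)"
    using assms by (auto dest: L2_spaceD)
  show "(\<lambda>x. f x * g x) \<in> borel_measurable M"
    using assms by (intro borel_measurable_times L2_spaceD)
  have "\<bar>f x * g x\<bar> \<le> (f x)\<^sup>2 + (g x)\<^sup>2" for x
  proof -
    have "0 \<le> (\<bar>f x\<bar> - \<bar>g x\<bar>)\<^sup>2" by simp
    then have "2 * \<bar>f x * g x\<bar> \<le> (f x)\<^sup>2 + (g x)\<^sup>2" by (simp add: power2_diff abs_mult)
    then show ?thesis by linarith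
  qed
  then show "AE x in M. norm (f x * g x) \<le> norm ((f x)\<^sup>2 + (g x)\<^sup>2)" by simp
qed

lemma L2_space_add:
  assumes "f \<in> L2_space M" "g \<in> L2_space M"
  shows "(\<lambda>x. f x + g x) \<in> L2_space M"
proof -
  have "integrable M (\<lambda>x. (f x)\<^sup>2 + (g x)\<^sup>2 + 2 * (f x * g x))"
    using assms integrable_L2_mult[OF assms] by (intro Bochner_Integration.integrable_add) (auto dest: L2_spaceD)
  moreover have "(\<lambda>x. (f x + g x)\<^sup>2) = (\<lambda>x. (f x)\<^sup>2 + (g x)\<^sup>2 + 2 * (f x * g x))"
    by (rule ext) (simp add: power2_sum)
  ultimately show ?thesis
    using L2_spaceD(1)[OF assms(1)] L2_spaceD(1)[OF assms(2)] by (simp add: L2_space_def)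
qed

lemma L2_space_scale: "f \<in> L2_space M \<Longrightarrow> (\<lambda>x. c * f x) \<in> L2_space M"
  by (auto simp: L2_space_def power_mult_distrib)

lemma L2_space_diff:
  assumes "f \<in> L2_space M" "g \<in> L2_space M"
  shows "(\<lambda>x. f x - g x) \<in> L2_space M"
  using L2_space_add[OF assms(1) L2_space_scale[OF assms(2), of "-1"]] by simp

lemma L2_space_sum:
  assumes "\<And>k. k \<in> J \<Longrightarrow> f k \<in> L2_space M"
  shows "(\<lambda>x. \<Sum>k\<in>J. f k x) \<in> L2_space M"
  using assms
proof (induction J rule: infinite_finite_induct)
  case (insert k J)
  then show ?case using L2_space_add[of "f k" M "\<lambda>x. \<Sum>k\<in>J. f k x"] by simp
qed (simp_all add: L2_space_def)

lemma (in finite_measure) L2_space_bounded: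
  assumes "f \<in> borel_measurable M" "\<And>x. x \<in> space M \<Longrightarrow> \<bar>f x\<bar> \<le> C"
  shows "f \<in> L2_space M"
proof -
  have "integrable M (\<lambda>x. (f x)\<^sup>2)"
  proof (rule integrable_const_bound)
    show "AE x in M. norm ((f x)\<^sup>2) \<le> C\<^sup>2"
      using assms(2) by (intro AE_I2) (auto simp: abs_le_square_iff[symmetric] intro: order_trans[OF _ abs_ge_self])
  qed (use assms in auto)
  then show ?thesis using assms by (simp add: L2_space_def)
qed

lemma (in finite_measure) integrable_L2:
  assumes "f \<in> L2_space M"
  shows "integrable M f"
  using integrable_L2_mult[OF assms, of "\<lambda>_. 1"] by (simp add: L2_space_def)

lemma L2_norm_nonneg [simp]: "0 \<le> L2_norm M f"
  by (simp add: L2_norm_def)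

lemma L2_norm_power2: "(L2_norm M f)\<^sup>2 = (\<integral>x. (f x)\<^sup>2 \<partial>M)"
  by (simp add: L2_norm_def)

lemma integral_L2_square_add:
  assumes "f \<in> L2_space M" "g \<in> L2_space M"
  shows "(\<integral>x. (f x + t * g x)\<^sup>2 \<partial>M) = (\<integral>x. (f x)\<^sup>2 \<partial>M) + 2 * t * (\<integral>x. f x * g x \<partial>M) + t\<^sup>2 * (\<integral>x. (g x)\<^sup>2 \<partial>M)"
proof -
  have "(\<lambda>x. (f x + t * g x)\<^sup>2) = (\<lambda>x. (f x)\<^sup>2 + (2 * t) * (f x * g x) + t\<^sup>2 * (g x)\<^sup>2)"
    by (rule ext) (simp add: power2_sum power_mult_distrib mult_ac)
  then show ?thesis
    using integrable_L2_mult[OF assms] assms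
    by (simp add: L2_spaceD)
qed

lemma L2_Cauchy_Schwarz:
  assumes "f \<in> L2_space M" "g \<in> L2_space M"
  shows "(\<integral>x. f x * g x \<partial>M)\<^sup>2 \<le> (\<integral>x. (f x)\<^sup>2 \<partial>M) * (\<integral>x. (g x)\<^sup>2 \<partial>M)"
proof (rule discriminant_nonneg)
  fix t
  show "0 \<le> (\<integral>x. (f x)\<^sup>2 \<partial>M) + 2 * t * (\<integral>x. f x * g x \<partial>M) + t\<^sup>2 * (\<integral>x. (g x)\<^sup>2 \<partial>M)"
    unfolding integral_L2_square_add[OF assms, symmetric] by (rule integral_nonneg_AE) simp
qed simp

lemma L2_inner_abs_le:
  assumes "f \<in> L2_space M" "g \<in> L2_space M"
  shows "\<bar>\<integral>x. f x * g x \<partial>M\<bar> \<le> L2_norm M f * L2_norm M g"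
  using real_sqrt_le_mono[OF L2_Cauchy_Schwarz[OF assms]] by (simp add: L2_norm_def real_sqrt_mult)

lemma L2_norm_triangle:
  assumes "f \<in> L2_space M" "g \<in> L2_space M"
  shows "L2_norm M (\<lambda>x. f x + g x) \<le> L2_norm M f + L2_norm M g"
proof (rule power2_le_imp_le)
  have "(L2_norm M (\<lambda>x. f x + g x))\<^sup>2 = (L2_norm M f)\<^sup>2 + 2 * (\<integral>x. f x * g x \<partial>M) + (L2_norm M g)\<^sup>2"
    using integral_L2_square_add[OF assms, of 1] by (simp add: L2_norm_power2)
  also have "\<dots> \<le> (L2_norm M f + L2_norm M g)\<^sup>2"
    using L2_inner_abs_le[OF assms] by (simp add: power2_sum)
  finally show "(L2_norm M (\<lambda>x. f x + g x))\<^sup>2 \<le> (L2_norm M f + L2_norm M g)\<^sup>2" .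
qed simp

lemma L2_norm_triangle_diff:
  assumes "f \<in> L2_space M" "g \<in> L2_space M"
  shows "L2_norm M f \<le> L2_norm M g + L2_norm M (\<lambda>x. f x - g x)"
  using L2_norm_triangle[OF assms(2) L2_space_diff[OF assms]] by simp

lemma L2_norm_uminus_diff: "L2_norm M (\<lambda>x. f x - g x) = L2_norm M (\<lambda>x. g x - f x)"
  by (simp add: L2_norm_def power2_commute)

definition orthonormal_family :: "'a measure \<Rightarrow> nat set \<Rightarrow> (nat \<Rightarrow> 'a \<Rightarrow> real) \<Rightarrow> bool" where
  "orthonormal_family M I e \<longleftrightarrow> (\<forall>k\<in>I. e k \<in> L2_space M) \<and>
    (\<forall>j\<in>I. \<forall>k\<in>I. (\<integral>x. e j x * e k x \<partial>M) = (if j = k then 1 else 0))"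

context
  fixes M :: "'a measure" and I :: "nat set" and e :: "nat \<Rightarrow> 'a \<Rightarrow> real"
  assumes on: "orthonormal_family M I e"
begin

lemma orthonormal_L2: "k \<in> I \<Longrightarrow> e k \<in> L2_space M"
  using on by (simp add: orthonormal_family_def)

lemma orthonormal_inner: "j \<in> I \<Longrightarrow> k \<in> I \<Longrightarrow> (\<integral>x. e j x * e k x \<partial>M) = (if j = k then 1 else 0)"
  using on by (simp add: orthonormal_family_def)

lemma orthonormal_combination_L2: "J \<subseteq> I \<Longrightarrow> (\<lambda>x. \<Sum>k\<in>J. c k * e k x) \<in> L2_space M"
  by (intro L2_space_sum L2_space_scale orthonormal_L2) auto

lemma inner_orthonormal_combination:
  assumes J: "finite J" "J \<subseteq> I" and g: "g \<in> L2_space M"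
  shows "(\<integral>x. g x * (\<Sum>k\<in>J. c k * e k x) \<partial>M) = (\<Sum>k\<in>J. c k * (\<integral>x. g x * e k x \<partial>M))"
proof -
  have int: "integrable M (\<lambda>x. g x * e k x)" if "k \<in> J" for k
    using that J by (intro integrable_L2_mult g orthonormal_L2) auto
  have "(\<integral>x. g x * (\<Sum>k\<in>J. c k * e k x) \<partial>M) = (\<integral>x. (\<Sum>k\<in>J. c k * (g x * e k x)) \<partial>M)"
    by (simp add: sum_distrib_left mult_ac)
  also have "\<dots> = (\<Sum>k\<in>J. c k * (\<integral>x. g x * e k x \<partial>M))"
    using int by (subst Bochner_Integration.integral_sum) auto
  finally show ?thesis .
qed

lemma orthonormal_combination_coefficient:
  assumes J: "finite J" "J \<subseteq> I" and j: "j \<in> I"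
  shows "(\<integral>x. (\<Sum>k\<in>J. c k * e k x) * e j x \<partial>M) = (if j \<in> J then c j else 0)"
proof -
  have "(\<integral>x. (\<Sum>k\<in>J. c k * e k x) * e j x \<partial>M) = (\<Sum>k\<in>J. c k * (\<integral>x. e j x * e k x \<partial>M))"
    unfolding inner_orthonormal_combination[OF J orthonormal_L2[OF j], symmetric] by (simp only: mult.commute)
  also have "\<dots> = (\<Sum>k\<in>J. if k = j then c k else 0)"
    using J j by (intro sum.cong refl) (auto simp: orthonormal_inner)
  also have "\<dots> = (if j \<in> J then c j else 0)" using J by (simp add: sum.delta)
  finally show ?thesis .
qed

lemma orthonormal_combination_norm:
  assumes J: "finite J" "J \<subseteq> I"
  shows "(\<integral>x. (\<Sum>k\<in>J. c k * e k x)\<^sup>2 \<partial>M) = (\<Sum>k\<in>J. (c k)\<^sup>2)"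
proof -
  have "(\<integral>x. (\<Sum>k\<in>J. c k * e k x)\<^sup>2 \<partial>M) = (\<Sum>j\<in>J. c j * (\<integral>x. (\<Sum>k\<in>J. c k * e k x) * e j x \<partial>M))"
    unfolding power2_eq_square
    by (rule inner_orthonormal_combination[OF J orthonormal_combination_L2[OF J(2)]])
  also have "\<dots> = (\<Sum>k\<in>J. (c k)\<^sup>2)"
    using J by (intro sum.cong refl) (auto simp: orthonormal_combination_coefficient[OF J] power2_eq_square)
  finally show ?thesis .
qed

lemma projection_residual_norm:
  assumes J: "finite J" "J \<subseteq> I" and g: "g \<in> L2_space M"
  defines "c \<equiv> \<lambda>k. \<integral>x. g x * e k x \<partial>M"
  shows "(\<integral>x. (g x - (\<Sum>k\<in>J. c k * e k x))\<^sup>2 \<partial>M) = (\<integral>x. (g x)\<^sup>2 \<partial>M) - (\<Sum>k\<in>J. (c k)\<^sup>2)"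
proof -
  have "(\<integral>x. g x * (\<Sum>k\<in>J. c k * e k x) \<partial>M) = (\<Sum>k\<in>J. (c k)\<^sup>2)"
    unfolding inner_orthonormal_combination[OF J g] by (simp add: c_def power2_eq_square)
  then show ?thesis
    using integral_L2_square_add[OF g orthonormal_combination_L2[OF J(2), of c], of "-1"]
      orthonormal_combination_norm[OF J, of c] by simp
qed

lemma Bessel_inequality:
  assumes "finite J" "J \<subseteq> I" "g \<in> L2_space M"
  shows "(\<Sum>k\<in>J. (\<integral>x. g x * e k x \<partial>M)\<^sup>2) \<le> (\<integral>x. (g x)\<^sup>2 \<partial>M)"
proof -
  have "0 \<le> (\<integral>x. (g x - (\<Sum>k\<in>J. (\<integral>x. g x * e k x \<partial>M) * e k x))\<^sup>2 \<partial>M)"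
    by (rule integral_nonneg_AE) simp
  then show ?thesis unfolding projection_residual_norm[OF assms] by simp
qed

end

text \<open>The partial sums of the Fourier series are a Cauchy sequence; a rapidly converging subsequence
  converges almost everywhere, by Fatou's lemma the limit is also the limit in the mean, and it has
  the same Fourier coefficients as the function.\<close>

theorem (in finite_measure) Parseval_le:
  assumes on: "orthonormal_family M I e"
    and complete: "\<And>g. g \<in> L2_space M \<Longrightarrow> (\<And>k. k \<in> I \<Longrightarrow> (\<integral>x. g x * e k x \<partial>M) = 0) \<Longrightarrow> AE x in M. g x = 0"
    and g: "g \<in> L2_space M"
    and C: "\<And>J. finite J \<Longrightarrow> J \<subseteq> I \<Longrightarrow> (\<Sum>k\<in>J. (\<integral>x. g x * e k x \<partial>M)\<^sup>2) \<le> C"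
  shows "(\<integral>x. (g x)\<^sup>2 \<partial>M) \<le> C"
proof -
  define c where "c k = (\<integral>x. g x * e k x \<partial>M)" for k
  define J where "J n = I \<inter> {..<n}" for n :: nat
  define s where "s n x = (\<Sum>k\<in>J n. c k * e k x)" for n x
  define a where "a n = (\<Sum>k\<in>J n. (c k)\<^sup>2)" for n
  have J: "finite (J n)" "J n \<subseteq> I" for n by (auto simp: J_def)
  have sL2: "s n \<in> L2_space M" for n
    unfolding s_def by (rule orthonormal_combination_L2[OF on J(2)])
  have sdiff: "(\<integral>x. (s n x - s k x)\<^sup>2 \<partial>M) = a n - a k" if "k \<le> n" for k n
  proof -
    have sub: "J k \<subseteq> J n" using that by (auto simp: J_def)
    have "(\<lambda>x. s n x - s k x) = (\<lambda>x. \<Sum>i\<in>J n - J k. c i * e i x)"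
      unfolding s_def by (rule ext) (simp add: sum_diff[OF J(1) sub])
    then have "(\<integral>x. (s n x - s k x)\<^sup>2 \<partial>M) = (\<integral>x. (\<Sum>i\<in>J n - J k. c i * e i x)\<^sup>2 \<partial>M)"
      by (metis (no_types, lifting))
    also have "\<dots> = (\<Sum>i\<in>J n - J k. (c i)\<^sup>2)"
      using J by (intro orthonormal_combination_norm[OF on]) auto
    finally show ?thesis unfolding a_def by (simp add: sum_diff[OF J(1) sub])
  qed
  have "incseq a"
    unfolding a_def by (intro incseq_SucI sum_mono2 J) (auto simp: J_def)
  moreover have aC: "a n \<le> C" for n unfolding a_def c_def by (rule C[OF J])
  ultimately obtain A where A: "a \<longlonglongrightarrow> A" "\<And>n. a n \<le> A"
    using incseq_convergent[of a C] by blast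
  have "\<exists>n. \<forall>k\<ge>n. A - a k < (1 / 4) ^ j" for j
  proof -
    have "(0::real) < (1 / 4) ^ j" by simp
    from LIMSEQ_D[OF A(1) this] obtain n where n: "\<And>k. k \<ge> n \<Longrightarrow> norm (a k - A) < (1 / 4) ^ j" by blast
    have "A - a k < (1 / 4) ^ j" if "k \<ge> n" for k
      using n[OF that] A(2)[of k] by (simp add: abs_if split: if_splits)
    then show ?thesis by blast
  qed
  then obtain N where N: "\<And>j k. k \<ge> N j \<Longrightarrow> A - a k < (1 / 4) ^ j" by metis
  define \<phi> where "\<phi> j = (\<Sum>i\<le>j. N i) + j" for j
  have \<phi>N: "\<phi> j \<ge> N j" for j
    unfolding \<phi>_def using member_le_sum[of j "{..j}" N] by simp
  have \<phi>mono: "\<phi> i \<le> \<phi> j" if "i \<le> j" for i j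
    unfolding \<phi>_def using that by (intro add_mono sum_mono2) auto
  have \<phi>ge: "\<phi> j \<ge> j" for j by (simp add: \<phi>_def)
  define S where "S j = s (\<phi> j)" for j
  have SL2: "S j \<in> L2_space M" for j unfolding S_def by (rule sL2)
  have Sm [measurable]: "S j \<in> borel_measurable M" for j using SL2 by (rule L2_spaceD)
  have Sdiff: "(\<integral>x. (S j x - S i x)\<^sup>2 \<partial>M) \<le> (1 / 4) ^ i" if "i \<le> j" for i j
    unfolding S_def sdiff[OF \<phi>mono[OF that]] using N[OF \<phi>N, of i] A(2)[of "\<phi> j"] by simp
  have Sdn: "L2_norm M (\<lambda>x. S j x - S i x) \<le> (1 / 2) ^ i" if "i \<le> j" for i j
  proof -
    have "((1 / 4 :: real) ^ i) = ((1 / 2) ^ i)\<^sup>2"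
      by (simp add: power2_eq_square power_mult_distrib[symmetric])
    then show ?thesis
      unfolding L2_norm_def using Sdiff[OF that] by (simp add: real_le_lsqrt)
  qed
  have "(\<integral>\<^sup>+x. (\<Sum>j. ennreal \<bar>S (Suc j) x - S j x\<bar>) \<partial>M) = (\<Sum>j. \<integral>\<^sup>+x. ennreal \<bar>S (Suc j) x - S j x\<bar> \<partial>M)"
    by (rule nn_integral_suminf) measurable
  also have "\<dots> \<le> (\<Sum>j. ennreal (sqrt (measure M (space M)) * (1 / 2) ^ j))"
  proof (rule suminf_le)
    fix j
    have d: "(\<lambda>x. S (Suc j) x - S j x) \<in> L2_space M" by (rule L2_space_diff[OF SL2 SL2])
    then have d': "(\<lambda>x. \<bar>S (Suc j) x - S j x\<bar>) \<in> L2_space M" by (auto simp: L2_space_def)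
    have one: "(\<lambda>_. 1) \<in> L2_space M" by (simp add: L2_space_def)
    have "(\<integral>\<^sup>+x. ennreal \<bar>S (Suc j) x - S j x\<bar> \<partial>M) = ennreal (\<integral>x. \<bar>S (Suc j) x - S j x\<bar> \<partial>M)"
      by (rule nn_integral_eq_integral[OF integrable_L2[OF d']]) simp
    also have "(\<integral>x. \<bar>S (Suc j) x - S j x\<bar> \<partial>M) \<le> L2_norm M (\<lambda>_. 1) * L2_norm M (\<lambda>x. S (Suc j) x - S j x)"
      using L2_inner_abs_le[OF one d'] by (simp add: L2_norm_def)
    also have "\<dots> \<le> L2_norm M (\<lambda>_. 1) * (1 / 2) ^ j"
      using Sdn[of j "Suc j"] by (intro mult_left_mono) auto
    also have "L2_norm M (\<lambda>_. 1) = sqrt (measure M (space M))" by (simp add: L2_norm_def)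
    finally show "(\<integral>\<^sup>+x. ennreal \<bar>S (Suc j) x - S j x\<bar> \<partial>M) \<le> ennreal (sqrt (measure M (space M)) * (1 / 2) ^ j)"
      by (simp add: ennreal_leI)
  qed auto
  also have "\<dots> < \<infinity>"
    by (subst suminf_ennreal2) (auto intro!: summable_mult summable_geometric)
  finally have "(\<integral>\<^sup>+x. (\<Sum>j. ennreal \<bar>S (Suc j) x - S j x\<bar>) \<partial>M) \<noteq> \<infinity>" by simp
  then have "AE x in M. (\<Sum>j. ennreal \<bar>S (Suc j) x - S j x\<bar>) \<noteq> \<infinity>"
    by (intro nn_integral_PInf_AE) auto
  then have conv: "AE x in M. (\<lambda>j. S j x) \<longlonglongrightarrow> lim (\<lambda>j. S j x)"
  proof eventually_elim
    case (elim x)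
    then have "summable (\<lambda>j. \<bar>S (Suc j) x - S j x\<bar>)"
      by (intro summable_suminf_not_top) auto
    then have "summable (\<lambda>j. S (Suc j) x - S j x)" by (rule summable_rabs_cancel)
    then have "convergent (\<lambda>n. \<Sum>j<n. S (Suc j) x - S j x)" by (simp add: summable_iff_convergent)
    then have "convergent (\<lambda>n. S n x - S 0 x)" by (simp only: sum_lessThan_telescope[of "\<lambda>j. S j x"])
    then have "convergent (\<lambda>n. (S n x - S 0 x) + S 0 x)" by (intro convergent_add convergent_const)
    then have "convergent (\<lambda>n. S n x)" by simp
    then show ?case by (simp add: convergent_LIMSEQ_iff)
  qed
  define h where "h x = lim (\<lambda>j. S j x)" for x
  have hm [measurable]: "h \<in> borel_measurable M" unfolding h_def by measurable
  have fatou: "(\<integral>\<^sup>+x. ennreal ((h x - S i x)\<^sup>2) \<partial>M) \<le> ennreal ((1 / 4) ^ i)" for i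
  proof -
    have "(\<integral>\<^sup>+x. ennreal ((h x - S i x)\<^sup>2) \<partial>M) = (\<integral>\<^sup>+x. liminf (\<lambda>j. ennreal ((S j x - S i x)\<^sup>2)) \<partial>M)"
    proof (rule nn_integral_cong_AE, use conv in eventually_elim)
      fix x assume "(\<lambda>j. S j x) \<longlonglongrightarrow> lim (\<lambda>j. S j x)"
      then have "(\<lambda>j. ennreal ((S j x - S i x)\<^sup>2)) \<longlonglongrightarrow> ennreal ((h x - S i x)\<^sup>2)"
        unfolding h_def by (intro tendsto_intros)
      then show "ennreal ((h x - S i x)\<^sup>2) = liminf (\<lambda>j. ennreal ((S j x - S i x)\<^sup>2))"
        by (intro lim_imp_Liminf[symmetric]) simp_all
    qed
    also have "\<dots> \<le> liminf (\<lambda>j. \<integral>\<^sup>+x. ennreal ((S j x - S i x)\<^sup>2) \<partial>M)"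
      by (rule nn_integral_liminf) measurable
    also have "\<dots> \<le> ennreal ((1 / 4) ^ i)"
    proof (rule Liminf_le)
      show "\<forall>\<^sub>F j in sequentially. (\<integral>\<^sup>+x. ennreal ((S j x - S i x)\<^sup>2) \<partial>M) \<le> ennreal ((1 / 4) ^ i)"
      proof (rule eventually_sequentiallyI)
        fix j assume "i \<le> j"
        have "(\<integral>\<^sup>+x. ennreal ((S j x - S i x)\<^sup>2) \<partial>M) = ennreal (\<integral>x. (S j x - S i x)\<^sup>2 \<partial>M)"
          using L2_space_diff[OF SL2 SL2] by (intro nn_integral_eq_integral L2_spaceD) auto
        then show "(\<integral>\<^sup>+x. ennreal ((S j x - S i x)\<^sup>2) \<partial>M) \<le> ennreal ((1 / 4) ^ i)"
          using Sdiff[OF \<open>i \<le> j\<close>] by (simp add: ennreal_leI)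
      qed
    qed simp
    finally show ?thesis .
  qed
  have hS: "(\<lambda>x. h x - S i x) \<in> L2_space M" for i
  proof -
    have "(\<integral>\<^sup>+x. ennreal ((h x - S i x)\<^sup>2) \<partial>M) < \<infinity>"
      using fatou[of i] by (rule order_le_less_trans) simp
    then show ?thesis by (auto simp: L2_space_def integrable_iff_bounded)
  qed
  have hSn: "L2_norm M (\<lambda>x. h x - S i x) \<le> (1 / 2) ^ i" for i
  proof -
    have "ennreal (\<integral>x. (h x - S i x)\<^sup>2 \<partial>M) = (\<integral>\<^sup>+x. ennreal ((h x - S i x)\<^sup>2) \<partial>M)"
      by (rule nn_integral_eq_integral[symmetric]) (use hS[of i] in \<open>auto dest: L2_spaceD\<close>)
    then have "(\<integral>x. (h x - S i x)\<^sup>2 \<partial>M) \<le> (1 / 4) ^ i" using fatou[of i]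
      by (metis ennreal_le_iff zero_le_divide_1_iff zero_le_numeral zero_le_power)
    moreover have "((1 / 4 :: real) ^ i) = ((1 / 2) ^ i)\<^sup>2"
      by (simp add: power2_eq_square power_mult_distrib[symmetric])
    ultimately show ?thesis unfolding L2_norm_def by (simp add: real_le_lsqrt)
  qed
  have half: "(\<lambda>i. (1 / 2 :: real) ^ i) \<longlonglongrightarrow> 0" by (rule LIMSEQ_power_zero) simp
  have hL2: "h \<in> L2_space M" using L2_space_add[OF hS[of 0] SL2[of 0]] by simp
  have coeff: "(\<integral>x. h x * e k x \<partial>M) = c k" if k: "k \<in> I" for k
  proof -
    have ek: "e k \<in> L2_space M" by (rule orthonormal_L2[OF on k])
    have ekn: "L2_norm M (e k) = 1"
      using orthonormal_inner[OF on k k] by (simp add: L2_norm_def power2_eq_square)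
    have b: "\<bar>(\<integral>x. h x * e k x \<partial>M) - c k\<bar> \<le> (1 / 2) ^ i" if "i > k" for i
    proof -
      have "k \<in> J (\<phi> i)" using that \<phi>ge[of i] k by (simp add: J_def)
      then have "(\<integral>x. S i x * e k x \<partial>M) = c k"
        unfolding S_def s_def using orthonormal_combination_coefficient[OF on J k] by simp
      then have "(\<integral>x. h x * e k x \<partial>M) - c k = (\<integral>x. (h x - S i x) * e k x \<partial>M)"
        using integrable_L2_mult[OF hL2 ek] integrable_L2_mult[OF SL2 ek, of i]
        by (simp add: left_diff_distrib)
      then show ?thesis using L2_inner_abs_le[OF hS ek, of i] hSn[of i] ekn by simp
    qed
    have "\<bar>(\<integral>x. h x * e k x \<partial>M) - c k\<bar> \<le> 0"
      by (rule tendsto_lowerbound[OF half]) (auto intro!: eventually_sequentiallyI[of "Suc k"] b)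
    then show ?thesis by simp
  qed
  have "AE x in M. g x - h x = 0"
  proof (rule complete[OF L2_space_diff[OF g hL2]])
    fix k assume k: "k \<in> I"
    have ek: "e k \<in> L2_space M" by (rule orthonormal_L2[OF on k])
    show "(\<integral>x. (g x - h x) * e k x \<partial>M) = 0"
      using coeff[OF k] integrable_L2_mult[OF hL2 ek] integrable_L2_mult[OF g ek]
      by (simp add: left_diff_distrib c_def)
  qed
  then have gh: "(\<integral>x. (g x)\<^sup>2 \<partial>M) = (\<integral>x. (h x)\<^sup>2 \<partial>M)"
    by (intro integral_cong_AE) (use g hL2 in \<open>auto dest: L2_spaceD\<close>)
  have "L2_norm M h \<le> sqrt C + (1 / 2) ^ i" for i
  proof -
    have "L2_norm M h \<le> L2_norm M (S i) + L2_norm M (\<lambda>x. h x - S i x)"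
      by (rule L2_norm_triangle_diff[OF hL2 SL2])
    moreover have "L2_norm M (S i) \<le> sqrt C"
      unfolding L2_norm_def S_def s_def orthonormal_combination_norm[OF on J] a_def[symmetric]
      using aC by simp
    ultimately show ?thesis using hSn[of i] by linarith
  qed
  moreover have "(\<lambda>i. sqrt C + (1 / 2) ^ i) \<longlonglongrightarrow> sqrt C + 0"
    by (intro tendsto_add tendsto_const half)
  ultimately have "L2_norm M h \<le> sqrt C"
    using tendsto_lowerbound[of "\<lambda>i. sqrt C + (1 / 2) ^ i" "sqrt C + 0" sequentially "L2_norm M h"] by simp
  then show ?thesis unfolding gh by (simp add: L2_norm_def)
qed

section \<open>Moments of independent samples\<close>

context prob_space
begin

interpretation pair: pair_prob_space M M ..

lemma L2_space_const: "(\<lambda>_. c) \<in> L2_space M"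
  by (simp add: L2_space_def)

lemma sample_component:
  fixes w :: "'a \<Rightarrow> real"
  assumes "i \<in> U" "integrable M w"
  shows "integrable (PiM U (\<lambda>_. M)) (\<lambda>x. w (x i))"
    and "(\<integral>x. w (x i) \<partial>PiM U (\<lambda>_. M)) = (\<integral>x. w x \<partial>M)"
proof -
  have d: "distr (PiM U (\<lambda>_. M)) M (\<lambda>x. x i) = M"
    using assms(1) prob_space_axioms by (intro distr_PiM_component)
  have m: "(\<lambda>x. x i) \<in> PiM U (\<lambda>_. M) \<rightarrow>\<^sub>M M" using assms(1) by measurable
  show "integrable (PiM U (\<lambda>_. M)) (\<lambda>x. w (x i))"
    using assms(2) d by (subst integrable_distr_eq[OF m, symmetric]) auto
  show "(\<integral>x. w (x i) \<partial>PiM U (\<lambda>_. M)) = (\<integral>x. w x \<partial>M)"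
    using integral_distr[OF m borel_measurable_integrable[OF assms(2)]] d by simp
qed

lemma prob_space_sample: "prob_space (PiM U (\<lambda>_. M))"
  by (rule prob_space_PiM) (rule prob_space_axioms)

lemma indep_coordinates:
  assumes "U \<noteq> {}"
  shows "prob_space.indep_vars (PiM U (\<lambda>_. M)) (\<lambda>_. M) (\<lambda>i x. x i) U"
proof -
  interpret P: prob_space "PiM U (\<lambda>_. M)" by (rule prob_space_sample)
  have "distr (PiM U (\<lambda>_. M)) (PiM U (\<lambda>_. M)) (\<lambda>x. \<lambda>i\<in>U. x i) = distr (PiM U (\<lambda>_. M)) (PiM U (\<lambda>_. M)) (\<lambda>x. x)"
    by (intro distr_cong refl) (auto simp: space_PiM)
  also have "\<dots> = PiM U (\<lambda>_. M)" by simp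
  also have "\<dots> = PiM U (\<lambda>i. distr (PiM U (\<lambda>_. M)) M (\<lambda>x. x i))"
    by (intro PiM_cong refl distr_PiM_component[symmetric] prob_space_axioms)
  finally show ?thesis
    using assms by (subst P.indep_vars_iff_distr_eq_PiM') auto
qed

lemma sample_pair:
  fixes w :: "'a \<times> 'a \<Rightarrow> real"
  assumes ij: "i \<in> U" "j \<in> U" "i \<noteq> j" and w: "integrable (M \<Otimes>\<^sub>M M) w"
  shows "integrable (PiM U (\<lambda>_. M)) (\<lambda>x. w (x i, x j))"
    and "(\<integral>x. w (x i, x j) \<partial>PiM U (\<lambda>_. M)) = (\<integral>p. w p \<partial>(M \<Otimes>\<^sub>M M))"
proof -
  interpret P: prob_space "PiM U (\<lambda>_. M)" by (rule prob_space_sample)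
  have "U \<noteq> {}" using ij by auto
  have "P.indep_var (PiM {i} (\<lambda>_. M)) (\<lambda>x. restrict (\<lambda>k. x k) {i}) (PiM {j} (\<lambda>_. M)) (\<lambda>x. restrict (\<lambda>k. x k) {j})"
    by (rule P.indep_var_restrict[OF indep_coordinates[OF \<open>U \<noteq> {}\<close>]]) (use ij in auto)
  then have "P.indep_var M ((\<lambda>f. f i) \<circ> (\<lambda>x. restrict (\<lambda>k. x k) {i})) M ((\<lambda>f. f j) \<circ> (\<lambda>x. restrict (\<lambda>k. x k) {j}))"
    by (rule P.indep_var_compose) measurable
  then have "P.indep_var M (\<lambda>x. x i) M (\<lambda>x. x j)" by (simp add: comp_def)
  then have "distr (PiM U (\<lambda>_. M)) M (\<lambda>x. x i) \<Otimes>\<^sub>M distr (PiM U (\<lambda>_. M)) M (\<lambda>x. x j)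
      = distr (PiM U (\<lambda>_. M)) (M \<Otimes>\<^sub>M M) (\<lambda>x. (x i, x j))"
    by (rule P.indep_var_distribution_eq[THEN iffD1, THEN conjunct2, THEN conjunct2])
  then have d: "distr (PiM U (\<lambda>_. M)) (M \<Otimes>\<^sub>M M) (\<lambda>x. (x i, x j)) = M \<Otimes>\<^sub>M M"
    using distr_PiM_component[of U "\<lambda>_. M", OF prob_space_axioms] ij by simp
  have m: "(\<lambda>x. (x i, x j)) \<in> PiM U (\<lambda>_. M) \<rightarrow>\<^sub>M M \<Otimes>\<^sub>M M" using ij by measurable
  show "integrable (PiM U (\<lambda>_. M)) (\<lambda>x. w (x i, x j))"
    using w d by (subst integrable_distr_eq[OF m, symmetric]) auto
  show "(\<integral>x. w (x i, x j) \<partial>PiM U (\<lambda>_. M)) = (\<integral>p. w p \<partial>(M \<Otimes>\<^sub>M M))"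
    using integral_distr[OF m borel_measurable_integrable[OF w]] d by simp
qed

lemma sample_double_sum:
  fixes w :: "'a \<Rightarrow> 'a \<Rightarrow> real"
  assumes B: "finite B" "B \<subseteq> U" and w: "integrable (M \<Otimes>\<^sub>M M) (\<lambda>(x, y). w x y)" and wd: "integrable M (\<lambda>x. w x x)"
  shows "integrable (PiM U (\<lambda>_. M)) (\<lambda>x. \<Sum>i\<in>B. \<Sum>j\<in>B. w (x i) (x j))"
    and "(\<integral>x. (\<Sum>i\<in>B. \<Sum>j\<in>B. w (x i) (x j)) \<partial>PiM U (\<lambda>_. M))
      = real (card B) * (real (card B) - 1) * (\<integral>p. (\<lambda>(x, y). w x y) p \<partial>(M \<Otimes>\<^sub>M M)) + real (card B) * (\<integral>x. w x x \<partial>M)"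
proof -
  let ?P = "PiM U (\<lambda>_. M)"
  let ?off = "\<integral>p. (\<lambda>(x, y). w x y) p \<partial>(M \<Otimes>\<^sub>M M)"
  have int: "integrable ?P (\<lambda>x. w (x i) (x j))" if "i \<in> B" "j \<in> B" for i j
    using sample_component(1)[OF _ wd, of i U] sample_pair(1)[OF _ _ _ w, of i U j] that B
    by (cases "i = j") auto
  have val: "(\<integral>x. w (x i) (x j) \<partial>?P) = (if i = j then (\<integral>x. w x x \<partial>M) else ?off)" if "i \<in> B" "j \<in> B" for i j
    using sample_component(2)[OF _ wd, of i U] sample_pair(2)[OF _ _ _ w, of i U j] that B
    by (cases "i = j") auto
  show "integrable ?P (\<lambda>x. \<Sum>i\<in>B. \<Sum>j\<in>B. w (x i) (x j))"
    by (intro Bochner_Integration.integrable_sum int)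
  have "(\<integral>x. (\<Sum>i\<in>B. \<Sum>j\<in>B. w (x i) (x j)) \<partial>?P) = (\<Sum>i\<in>B. \<Sum>j\<in>B. \<integral>x. w (x i) (x j) \<partial>?P)"
    using int by (simp add: Bochner_Integration.integral_sum Bochner_Integration.integrable_sum)
  also have "\<dots> = (\<Sum>i\<in>B. \<Sum>j\<in>B. ?off + (if i = j then (\<integral>x. w x x \<partial>M) - ?off else 0))"
    by (intro sum.cong refl) (simp add: val)
  also have "\<dots> = (\<Sum>i\<in>B. real (card B) * ?off + ((\<integral>x. w x x \<partial>M) - ?off))"
    using B by (intro sum.cong refl) (simp add: sum.distrib sum.delta)
  also have "\<dots> = real (card B) * (real (card B) - 1) * ?off + real (card B) * (\<integral>x. w x x \<partial>M)"
    by (simp add: algebra_simps)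
  finally show "(\<integral>x. (\<Sum>i\<in>B. \<Sum>j\<in>B. w (x i) (x j)) \<partial>?P)
      = real (card B) * (real (card B) - 1) * ?off + real (card B) * (\<integral>x. w x x \<partial>M)" .
qed

lemma sample_sum:
  fixes w :: "'a \<Rightarrow> real"
  assumes B: "finite B" "B \<subseteq> U" and w: "integrable M w"
  shows "integrable (PiM U (\<lambda>_. M)) (\<lambda>x. \<Sum>i\<in>B. w (x i))"
    and "(\<integral>x. (\<Sum>i\<in>B. w (x i)) \<partial>PiM U (\<lambda>_. M)) = real (card B) * (\<integral>x. w x \<partial>M)"
proof -
  have int: "integrable (PiM U (\<lambda>_. M)) (\<lambda>x. w (x i))"
    "(\<integral>x. w (x i) \<partial>PiM U (\<lambda>_. M)) = (\<integral>x. w x \<partial>M)" if "i \<in> B" for i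
    using sample_component[OF _ w, of i U] that B by auto
  then show "integrable (PiM U (\<lambda>_. M)) (\<lambda>x. \<Sum>i\<in>B. w (x i))"
    by (intro Bochner_Integration.integrable_sum)
  show "(\<integral>x. (\<Sum>i\<in>B. w (x i)) \<partial>PiM U (\<lambda>_. M)) = real (card B) * (\<integral>x. w x \<partial>M)"
    using int by (simp add: Bochner_Integration.integral_sum)
qed

text \<open>Markov's inequality bounds the probability that the statistic of one block exceeds twice its
  mean by one half; the blocks are independent, so that all of them do so with probability at most
  \<open>2 ^ - J\<close>.\<close>

theorem independent_blocks_Markov:
  fixes Y :: "nat \<Rightarrow> ('i \<Rightarrow> 'a) \<Rightarrow> real"
  assumes ne: "U \<noteq> {}" and U: "\<And>j. j < J \<Longrightarrow> B j \<subseteq> U" and disj: "disjoint_family_on B {..<J}"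
    and m: "\<And>j. j < J \<Longrightarrow> Y j \<in> borel_measurable (PiM (B j) (\<lambda>_. M))"
    and local: "\<And>j x. j < J \<Longrightarrow> Y j (restrict x (B j)) = Y j x"
    and nonneg: "\<And>j x. j < J \<Longrightarrow> x \<in> space (PiM U (\<lambda>_. M)) \<Longrightarrow> 0 \<le> Y j x"
    and int: "\<And>j. j < J \<Longrightarrow> integrable (PiM U (\<lambda>_. M)) (Y j)"
    and mean: "\<And>j. j < J \<Longrightarrow> (\<integral>x. Y j x \<partial>PiM U (\<lambda>_. M)) \<le> C" and C: "0 < C"
  shows "{x \<in> space (PiM U (\<lambda>_. M)). \<exists>j<J. Y j x \<le> 2 * C} \<in> sets (PiM U (\<lambda>_. M))" (is "?E \<in> _")
    and "measure (PiM U (\<lambda>_. M)) {x \<in> space (PiM U (\<lambda>_. M)). \<exists>j<J. Y j x \<le> 2 * C} \<ge> 1 - (1 / 2) ^ J"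
proof -
  let ?P = "PiM U (\<lambda>_. M)"
  interpret P: prob_space ?P by (rule prob_space_sample)
  have meas [measurable]: "Y j \<in> borel_measurable ?P" if "j < J" for j
    using int[OF that] by (rule borel_measurable_integrable)
  define F where "F j = {x \<in> space ?P. 2 * C < Y j x}" for j
  have Fs: "F j \<in> sets ?P" if "j < J" for j
    unfolding F_def using meas[OF that] by measurable
  have E: "?E = space ?P - (\<Inter>j<J. F j)" if "J > 0"
  proof (rule Set.set_eqI)
    fix x
    have "x \<in> F j \<longleftrightarrow> x \<in> space ?P \<and> \<not> Y j x \<le> 2 * C" for j
      by (simp add: F_def not_le)
    then show "x \<in> ?E \<longleftrightarrow> x \<in> space ?P - (\<Inter>j<J. F j)"
      by (simp only: mem_Collect_eq Diff_iff INT_iff lessThan_iff) blast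
  qed
  have Is: "(\<Inter>j<J. F j) \<in> sets ?P" if "J > 0"
    using that Fs by (intro sets.finite_INT) auto
  show *: "?E \<in> sets ?P"
  proof (cases "J = 0")
    case False
    then show ?thesis using E Is by auto
  qed simp
  have half: "P.prob (F j) \<le> 1 / 2" if j: "j < J" for j
  proof -
    have "P.prob (F j) \<le> P.prob {x \<in> space ?P. 2 * C \<le> Y j x}"
      unfolding F_def using meas[OF j] by (intro P.finite_measure_mono) auto
    also have "\<dots> \<le> (\<integral>x. Y j x \<partial>?P) / (2 * C)"
      using C by (intro integral_Markov_inequality_measure[OF int[OF j], of "{}"]) (auto intro!: AE_I2 nonneg j)
    also have "\<dots> \<le> 1 / 2" using mean[OF j] C by (simp add: field_simps)
    finally show ?thesis .
  qed
  have "P.indep_vars (\<lambda>j. PiM (B j) (\<lambda>_. M)) (\<lambda>j x. restrict (\<lambda>i. x i) (B j)) {..<J}"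
    by (rule P.indep_vars_restrict[OF indep_coordinates[OF ne]]) (use U disj in auto)
  then have "P.indep_vars (\<lambda>_. borel) (\<lambda>j. Y j \<circ> (\<lambda>x. restrict x (B j))) {..<J}"
    using m by (intro P.indep_vars_compose[where M' = "\<lambda>j. PiM (B j) (\<lambda>_. M)"]) auto
  then have ind: "P.indep_vars (\<lambda>_. borel) Y {..<J}"
    by (rule P.indep_vars_cong[THEN iffD1, rotated 3]) (auto simp: fun_eq_iff local)
  have "P.prob (\<Inter>j<J. F j) \<le> (1 / 2) ^ J" if J: "J > 0"
  proof -
    have "P.prob (\<Inter>j\<in>{..<J}. Y j -` {2 * C<..} \<inter> space ?P) = (\<Prod>j\<in>{..<J}. P.prob (Y j -` {2 * C<..} \<inter> space ?P))"
      using J by (intro P.indep_varsD[OF ind]) auto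
    also have "(\<lambda>j. Y j -` {2 * C<..} \<inter> space ?P) = F" by (auto simp: F_def fun_eq_iff)
    also have "(\<Prod>j\<in>{..<J}. P.prob (F j)) \<le> (\<Prod>j\<in>{..<J}. 1 / 2)"
      using half by (intro prod_mono) (auto simp del: le_divide_eq_numeral1)
    finally show ?thesis by simp
  qed
  note bound = this
  show "P.prob ?E \<ge> 1 - (1 / 2) ^ J"
  proof (cases "J = 0")
    case False
    then have J: "J > 0" by simp
    have "P.prob ?E = 1 - P.prob (\<Inter>j<J. F j)"
      unfolding E[OF J] by (rule P.prob_compl[OF Is[OF J]])
    then show ?thesis using bound[OF J] by linarith
  qed simp
qed

end

section \<open>The energy of a signed measure under a kernel\<close>

definition bounded_psd_kernel :: "'a measure \<Rightarrow> ('a \<Rightarrow> 'a \<Rightarrow> real) \<Rightarrow> real \<Rightarrow> bool" where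
  "bounded_psd_kernel M P C \<longleftrightarrow> psd_kernel (space M) P \<and>
    (\<lambda>(x, y). P x y) \<in> borel_measurable (M \<Otimes>\<^sub>M M) \<and> (\<forall>x\<in>space M. P x x \<le> C)"

text \<open>The functions of the reproducing kernel Hilbert space that occur below are the potentials of
  signed measures with density \<open>g\<close> and point masses \<open>b i\<close> at the points \<open>z i\<close>; the inner product of
  that space is the mutual energy of the measures.\<close>

definition potential ::
  "'a measure \<Rightarrow> ('a \<Rightarrow> 'a \<Rightarrow> real) \<Rightarrow> ('a \<Rightarrow> real) \<Rightarrow> 'i set \<Rightarrow> ('i \<Rightarrow> real) \<Rightarrow> ('i \<Rightarrow> 'a) \<Rightarrow> 'a \<Rightarrow> real" where
  "potential M P g B b z x = (\<integral>y. g y * P y x \<partial>M) + (\<Sum>i\<in>B. b i * P (z i) x)"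

definition mutual_energy ::
  "'a measure \<Rightarrow> ('a \<Rightarrow> 'a \<Rightarrow> real) \<Rightarrow> 'i set \<Rightarrow> ('i \<Rightarrow> 'a) \<Rightarrow> ('a \<Rightarrow> real) \<Rightarrow> ('i \<Rightarrow> real) \<Rightarrow>
    ('a \<Rightarrow> real) \<Rightarrow> ('i \<Rightarrow> real) \<Rightarrow> real" where
  "mutual_energy M P B z g b g' b' =
    (\<integral>x. g' x * potential M P g B b z x \<partial>M) + (\<Sum>i\<in>B. b' i * potential M P g B b z (z i))"

abbreviation energy where
  "energy M P B z g b \<equiv> mutual_energy M P B z g b g b"

context prob_space
begin

interpretation pair: pair_prob_space M M ..

context
  fixes P :: "'a \<Rightarrow> 'a \<Rightarrow> real" and C :: real
  assumes bk: "bounded_psd_kernel M P C"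
begin

lemma kernel_psd: "psd_kernel (space M) P"
  using bk by (simp add: bounded_psd_kernel_def)

lemma kernel_sym: "x \<in> space M \<Longrightarrow> y \<in> space M \<Longrightarrow> P x y = P y x"
  by (rule psd_kernel_sym[OF kernel_psd])

lemma kernel_diag_le: "x \<in> space M \<Longrightarrow> P x x \<le> C"
  using bk by (simp add: bounded_psd_kernel_def)

lemma kernel_abs_le: "x \<in> space M \<Longrightarrow> y \<in> space M \<Longrightarrow> \<bar>P x y\<bar> \<le> C"
  using psd_kernel_abs_le[OF kernel_psd] kernel_diag_le by blast

lemma kernel_bound_nonneg: "0 \<le> C"
proof -
  obtain x where "x \<in> space M" using not_empty by auto
  then show ?thesis using kernel_abs_le[of x x] by simp
qed

lemma kernel_measurable_pair: "(\<lambda>(x, y). P x y) \<in> borel_measurable (M \<Otimes>\<^sub>M M)"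
  using bk by (simp add: bounded_psd_kernel_def)

lemma kernel_measurable:
  assumes [measurable]: "f \<in> N \<rightarrow>\<^sub>M M" "g \<in> N \<rightarrow>\<^sub>M M"
  shows "(\<lambda>x. P (f x) (g x)) \<in> borel_measurable N"
proof -
  have "(\<lambda>(x, y). P x y) \<circ> (\<lambda>x. (f x, g x)) \<in> borel_measurable N"
    by (rule measurable_comp[OF _ kernel_measurable_pair]) measurable
  then show ?thesis by (simp add: comp_def)
qed

lemma kernel_L2_left: "y \<in> space M \<Longrightarrow> (\<lambda>x. P x y) \<in> L2_space M"
  by (rule L2_space_bounded[where C = C]) (auto intro: kernel_abs_le kernel_measurable)

lemma kernel_L2_right: "x \<in> space M \<Longrightarrow> (\<lambda>y. P x y) \<in> L2_space M"
  by (rule L2_space_bounded[where C = C]) (auto intro: kernel_abs_le kernel_measurable)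

lemma integrable_kernel_pair:
  assumes g: "g \<in> L2_space M" and g': "g' \<in> L2_space M"
  shows "integrable (M \<Otimes>\<^sub>M M) (\<lambda>(x, y). g x * g' y * P x y)"
proof -
  note [measurable (raw)] = kernel_measurable
  have [measurable]: "g \<in> borel_measurable M" "g' \<in> borel_measurable M"
    using g g' by (auto dest: L2_spaceD)
  have i1: "integrable (M \<Otimes>\<^sub>M M) (\<lambda>p. (g (fst p))\<^sup>2)"
    using integrable_distr_eq[of fst "M \<Otimes>\<^sub>M M" M "\<lambda>x. (g x)\<^sup>2"] L2_spaceD(2)[OF g]
    by (simp add: distr_pair_fst emeasure_space_1)
  have i2: "integrable (M \<Otimes>\<^sub>M M) (\<lambda>p. (g' (snd p))\<^sup>2)"
  proof -
    have "integrable (M \<Otimes>\<^sub>M M) (\<lambda>p. (g' (fst p))\<^sup>2)"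
      using integrable_distr_eq[of fst "M \<Otimes>\<^sub>M M" M "\<lambda>x. (g' x)\<^sup>2"] L2_spaceD(2)[OF g']
      by (simp add: distr_pair_fst emeasure_space_1)
    then show ?thesis
      using pair.integrable_product_swap[of "\<lambda>p. (g' (fst p))\<^sup>2"] by (simp add: split_beta')
  qed
  show ?thesis
  proof (rule Bochner_Integration.integrable_bound)
    show "integrable (M \<Otimes>\<^sub>M M) (\<lambda>p. C * ((g (fst p))\<^sup>2 + (g' (snd p))\<^sup>2))"
      using i1 i2 by simp
    show "(\<lambda>(x, y). g x * g' y * P x y) \<in> borel_measurable (M \<Otimes>\<^sub>M M)" by measurable
    show "AE p in M \<Otimes>\<^sub>M M. norm (case p of (x, y) \<Rightarrow> g x * g' y * P x y) \<le> norm (C * ((g (fst p))\<^sup>2 + (g' (snd p))\<^sup>2))"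
    proof (rule AE_I2, clarsimp simp: space_pair_measure)
      fix x y assume xy: "x \<in> space M" "y \<in> space M"
      have "0 \<le> (\<bar>g x\<bar> - \<bar>g' y\<bar>)\<^sup>2" by simp
      then have "2 * (\<bar>g x\<bar> * \<bar>g' y\<bar>) \<le> (g x)\<^sup>2 + (g' y)\<^sup>2" by (simp add: power2_diff)
      moreover have "0 \<le> \<bar>g x\<bar> * \<bar>g' y\<bar>" by simp
      ultimately have "\<bar>g x\<bar> * \<bar>g' y\<bar> \<le> (g x)\<^sup>2 + (g' y)\<^sup>2" by linarith
      then have "\<bar>g x\<bar> * \<bar>g' y\<bar> * \<bar>P x y\<bar> \<le> ((g x)\<^sup>2 + (g' y)\<^sup>2) * C"
        using kernel_abs_le[OF xy] by (intro mult_mono) auto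
      moreover have "0 \<le> C * ((g x)\<^sup>2 + (g' y)\<^sup>2)" using kernel_bound_nonneg by simp
      ultimately show "\<bar>g x * g' y * P x y\<bar> \<le> \<bar>C * ((g x)\<^sup>2 + (g' y)\<^sup>2)\<bar>"
        by (subst abs_of_nonneg[of "C * _"]) (simp_all only: abs_mult mult.commute[of C])
    qed
  qed
qed

lemma integrable_kernel_diag:
  assumes g: "g \<in> L2_space M"
  shows "integrable M (\<lambda>x. g x * g x * P x x)"
proof (rule Bochner_Integration.integrable_bound)
  note [measurable (raw)] = kernel_measurable
  have [measurable]: "g \<in> borel_measurable M"
    using g by (auto dest: L2_spaceD)
  show "integrable M (\<lambda>x. C * (g x)\<^sup>2)" using L2_spaceD(2)[OF g] by simp
  show "(\<lambda>x. g x * g x * P x x) \<in> borel_measurable M" by measurable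
  show "AE x in M. norm (g x * g x * P x x) \<le> norm (C * (g x)\<^sup>2)"
    using kernel_abs_le kernel_bound_nonneg
    by (intro AE_I2) (auto simp: abs_mult power2_eq_square mult.commute intro!: mult_right_mono)
qed

lemma integral_kernel_diag_le:
  assumes g: "g \<in> L2_space M"
  shows "(\<integral>x. g x * g x * P x x \<partial>M) \<le> C * (\<integral>x. (g x)\<^sup>2 \<partial>M)"
proof -
  have "(\<integral>x. g x * g x * P x x \<partial>M) \<le> (\<integral>x. C * (g x)\<^sup>2 \<partial>M)"
    using L2_spaceD(2)[OF g] kernel_diag_le
    by (intro integral_mono integrable_kernel_diag g)
      (auto simp: power2_eq_square mult.commute intro!: mult_right_mono)
  then show ?thesis by simp
qed

lemma integral_kernel_pair:
  assumes g: "g \<in> L2_space M" and g': "g' \<in> L2_space M"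
  shows "(\<integral>p. (\<lambda>(x, y). g x * g' y * P x y) p \<partial>(M \<Otimes>\<^sub>M M)) = (\<integral>y. g' y * (\<integral>x. g x * P x y \<partial>M) \<partial>M)"
proof -
  have "(\<integral>p. (\<lambda>(x, y). g x * g' y * P x y) p \<partial>(M \<Otimes>\<^sub>M M)) = (\<integral>y. (\<integral>x. g x * g' y * P x y \<partial>M) \<partial>M)"
    using pair.integral_snd[OF integrable_kernel_pair[OF g g']] by simp
  also have "\<dots> = (\<integral>y. g' y * (\<integral>x. g x * P x y \<partial>M) \<partial>M)"
    by (intro Bochner_Integration.integral_cong refl) (simp add: mult_ac flip: integral_mult_right_zero)
  finally show ?thesis .
qed

lemma density_potential_measurable:
  assumes g: "g \<in> L2_space M"
  shows "(\<lambda>y. \<integral>x. g x * P x y \<partial>M) \<in> borel_measurable M"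
proof -
  note [measurable (raw)] = kernel_measurable
  have [measurable]: "g \<in> borel_measurable M" using g by (rule L2_spaceD)
  show ?thesis by measurable
qed

lemma density_potential_abs_le:
  assumes g: "g \<in> L2_space M" and y: "y \<in> space M"
  shows "\<bar>\<integral>x. g x * P x y \<partial>M\<bar> \<le> C * L2_norm M g"
proof -
  have "(\<integral>x. (P x y)\<^sup>2 \<partial>M) \<le> (\<integral>x. C\<^sup>2 \<partial>M)"
    using L2_spaceD(2)[OF kernel_L2_left[OF y]] kernel_abs_le[OF _ y]
    by (intro integral_mono) (auto simp: abs_le_square_iff[symmetric] intro: order_trans[OF _ abs_ge_self])
  then have "L2_norm M (\<lambda>x. P x y) \<le> C"
    unfolding L2_norm_def using kernel_bound_nonneg by (simp add: prob_space real_le_lsqrt)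
  then have "L2_norm M g * L2_norm M (\<lambda>x. P x y) \<le> L2_norm M g * C" by (intro mult_left_mono) auto
  then show ?thesis
    using L2_inner_abs_le[OF g kernel_L2_left[OF y]] by (simp add: mult.commute)
qed

lemma density_potential_L2:
  assumes g: "g \<in> L2_space M"
  shows "(\<lambda>y. \<integral>x. g x * P x y \<partial>M) \<in> L2_space M"
  by (rule L2_space_bounded[OF density_potential_measurable[OF g] density_potential_abs_le[OF g]])

lemma potential_L2:
  assumes g: "g \<in> L2_space M" and z: "\<And>i. i \<in> B \<Longrightarrow> z i \<in> space M"
  shows "potential M P g B b z \<in> L2_space M"
  unfolding potential_def[abs_def]
  by (intro L2_space_add density_potential_L2 g L2_space_sum L2_space_scale kernel_L2_right z)

lemma density_energy_commute:
  assumes g: "g \<in> L2_space M" and g': "g' \<in> L2_space M"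
  shows "(\<integral>y. g' y * (\<integral>x. g x * P x y \<partial>M) \<partial>M) = (\<integral>y. g y * (\<integral>x. g' x * P x y \<partial>M) \<partial>M)"
proof -
  have "(\<integral>y. g' y * (\<integral>x. g x * P x y \<partial>M) \<partial>M) = (\<integral>p. (\<lambda>(x, y). g x * g' y * P x y) p \<partial>(M \<Otimes>\<^sub>M M))"
    by (rule integral_kernel_pair[OF g g', symmetric])
  also have "\<dots> = (\<integral>x. (\<integral>y. g x * g' y * P x y \<partial>M) \<partial>M)"
    using pair.integral_fst[OF integrable_kernel_pair[OF g g']] by simp
  also have "\<dots> = (\<integral>x. g x * (\<integral>y. g' y * P y x \<partial>M) \<partial>M)"
  proof (intro Bochner_Integration.integral_cong refl)
    fix x assume x: "x \<in> space M"
    have "(\<integral>y. g x * g' y * P x y \<partial>M) = (\<integral>y. g x * (g' y * P y x) \<partial>M)"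
      using kernel_sym[OF x] by (intro Bochner_Integration.integral_cong refl) (simp add: mult_ac)
    then show "(\<integral>y. g x * g' y * P x y \<partial>M) = g x * (\<integral>y. g' y * P y x \<partial>M)" by simp
  qed
  finally show ?thesis .
qed

context
  fixes B :: "'i set" and z :: "'i \<Rightarrow> 'a"
  assumes fin: "finite B" and z: "\<And>i. i \<in> B \<Longrightarrow> z i \<in> space M"
begin

lemma mutual_energy_expand:
  assumes g: "g \<in> L2_space M" and g': "g' \<in> L2_space M"
  shows "mutual_energy M P B z g b g' b' =
    (\<integral>y. g' y * (\<integral>x. g x * P x y \<partial>M) \<partial>M) + (\<Sum>i\<in>B. b i * (\<integral>x. g' x * P x (z i) \<partial>M))
    + (\<Sum>i\<in>B. b' i * (\<integral>x. g x * P x (z i) \<partial>M)) + (\<Sum>i\<in>B. \<Sum>j\<in>B. b i * b' j * P (z i) (z j))"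
proof -
  have 1: "(\<integral>x. g' x * potential M P g B b z x \<partial>M)
      = (\<integral>y. g' y * (\<integral>x. g x * P x y \<partial>M) \<partial>M) + (\<Sum>i\<in>B. b i * (\<integral>x. g' x * P x (z i) \<partial>M))"
  proof -
    have i1: "integrable M (\<lambda>y. g' y * (\<integral>x. g x * P x y \<partial>M))"
      by (intro integrable_L2_mult g' density_potential_L2 g)
    have i2: "integrable M (\<lambda>x. b i * (g' x * P (z i) x))" if "i \<in> B" for i
      using integrable_L2_mult[OF g' kernel_L2_right[OF z[OF that]]] by simp
    have sw: "(\<integral>x. g' x * P (z i) x \<partial>M) = (\<integral>x. g' x * P x (z i) \<partial>M)" if "i \<in> B" for i
      using kernel_sym[OF z[OF that]] by (intro Bochner_Integration.integral_cong refl) simp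
    have "(\<integral>x. g' x * potential M P g B b z x \<partial>M)
        = (\<integral>y. g' y * (\<integral>x. g x * P x y \<partial>M) + (\<Sum>i\<in>B. b i * (g' y * P (z i) y)) \<partial>M)"
      unfolding potential_def
      by (intro Bochner_Integration.integral_cong refl) (simp add: distrib_left sum_distrib_left mult_ac)
    also have "\<dots> = (\<integral>y. g' y * (\<integral>x. g x * P x y \<partial>M) \<partial>M) + (\<Sum>i\<in>B. \<integral>y. b i * (g' y * P (z i) y) \<partial>M)"
      using i1 i2 by (simp add: Bochner_Integration.integral_sum Bochner_Integration.integrable_sum)
    also have "(\<Sum>i\<in>B. \<integral>y. b i * (g' y * P (z i) y) \<partial>M) = (\<Sum>i\<in>B. b i * (\<integral>x. g' x * P x (z i) \<partial>M))"
      by (intro sum.cong refl) (simp add: sw)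
    finally show ?thesis .
  qed
  have "(\<Sum>i\<in>B. b' i * potential M P g B b z (z i))
      = (\<Sum>i\<in>B. b' i * (\<integral>x. g x * P x (z i) \<partial>M)) + (\<Sum>j\<in>B. \<Sum>i\<in>B. b i * b' j * P (z i) (z j))"
    by (simp add: potential_def distrib_left sum.distrib sum_distrib_left mult_ac)
  also have "(\<Sum>j\<in>B. \<Sum>i\<in>B. b i * b' j * P (z i) (z j)) = (\<Sum>i\<in>B. \<Sum>j\<in>B. b i * b' j * P (z i) (z j))"
    by (rule sum.swap)
  finally show ?thesis unfolding mutual_energy_def 1 by simp
qed

lemma mutual_energy_commute:
  assumes g: "g \<in> L2_space M" and g': "g' \<in> L2_space M"
  shows "mutual_energy M P B z g b g' b' = mutual_energy M P B z g' b' g b"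
proof -
  have "(\<Sum>i\<in>B. \<Sum>j\<in>B. b' i * b j * P (z i) (z j)) = (\<Sum>j\<in>B. \<Sum>i\<in>B. b' i * b j * P (z i) (z j))"
    by (rule sum.swap)
  also have "\<dots> = (\<Sum>i\<in>B. \<Sum>j\<in>B. b i * b' j * P (z i) (z j))"
    using kernel_sym z by (intro sum.cong refl) (simp add: mult_ac)
  finally show ?thesis
    unfolding mutual_energy_expand[OF g g'] mutual_energy_expand[OF g' g]
    using density_energy_commute[OF g g'] by simp
qed

lemma mutual_energy_add_right:
  assumes g: "g \<in> L2_space M" and g1: "g1 \<in> L2_space M" and g2: "g2 \<in> L2_space M"
  shows "mutual_energy M P B z g b (\<lambda>x. g1 x + t * g2 x) (\<lambda>i. b1 i + t * b2 i)
    = mutual_energy M P B z g b g1 b1 + t * mutual_energy M P B z g b g2 b2"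
proof -
  have i: "integrable M (\<lambda>x. g' x * potential M P g B b z x)" if "g' \<in> L2_space M" for g'
    by (rule integrable_L2_mult[OF that potential_L2[OF g z]])
  have "(\<integral>x. (g1 x + t * g2 x) * potential M P g B b z x \<partial>M)
      = (\<integral>x. g1 x * potential M P g B b z x + t * (g2 x * potential M P g B b z x) \<partial>M)"
    by (intro Bochner_Integration.integral_cong refl) (simp add: algebra_simps)
  also have "\<dots> = (\<integral>x. g1 x * potential M P g B b z x \<partial>M) + t * (\<integral>x. g2 x * potential M P g B b z x \<partial>M)"
    using i[OF g1] i[OF g2] by simp
  finally show ?thesis
    unfolding mutual_energy_def
    by (simp add: distrib_left distrib_right sum.distrib sum_distrib_left mult.assoc)
qed

lemma energy_add:
  assumes g: "g \<in> L2_space M" and g': "g' \<in> L2_space M"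
  shows "energy M P B z (\<lambda>x. g x + t * g' x) (\<lambda>i. b i + t * b' i)
    = energy M P B z g b + 2 * t * mutual_energy M P B z g b g' b' + t\<^sup>2 * energy M P B z g' b'"
proof -
  let ?g = "\<lambda>x. g x + t * g' x" and ?b = "\<lambda>i. b i + t * b' i"
  have s: "?g \<in> L2_space M" by (intro L2_space_add L2_space_scale g g')
  have "energy M P B z ?g ?b = mutual_energy M P B z ?g ?b g b + t * mutual_energy M P B z ?g ?b g' b'"
    by (rule mutual_energy_add_right[OF s g g'])
  also have "mutual_energy M P B z ?g ?b g b = mutual_energy M P B z g b ?g ?b"
    by (rule mutual_energy_commute[OF s g])
  also have "mutual_energy M P B z ?g ?b g' b' = mutual_energy M P B z g' b' ?g ?b"
    by (rule mutual_energy_commute[OF s g'])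
  also have "mutual_energy M P B z g b ?g ?b = energy M P B z g b + t * mutual_energy M P B z g b g' b'"
    by (rule mutual_energy_add_right[OF g g g'])
  also have "mutual_energy M P B z g' b' ?g ?b = mutual_energy M P B z g' b' g b + t * energy M P B z g' b'"
    by (rule mutual_energy_add_right[OF g' g g'])
  also have "mutual_energy M P B z g' b' g b = mutual_energy M P B z g b g' b'"
    by (rule mutual_energy_commute[OF g' g])
  finally show ?thesis by (simp add: algebra_simps power2_eq_square)
qed

text \<open>The energy is the limit of the quadratic forms of the kernel at the points \<open>z i\<close> and at \<open>N\<close>
  points sampled from the measure with weights \<open>g x / N\<close>: averaging over the sample leaves an error
  of order \<open>1 / N\<close> from the diagonal terms.\<close>

theorem energy_nonneg:
  assumes g: "g \<in> L2_space M"
  shows "0 \<le> energy M P B z g b"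
proof -
  let ?I2 = "\<integral>p. (\<lambda>(x, y). g x * g y * P x y) p \<partial>(M \<Otimes>\<^sub>M M)"
  let ?I1 = "\<integral>x. g x * g x * P x x \<partial>M"
  let ?q = "\<lambda>x. \<Sum>k\<in>B. b k * (g x * P x (z k))"
  let ?c = "\<Sum>i\<in>B. \<Sum>j\<in>B. b i * b j * P (z i) (z j)"
  have int: "integrable M (\<lambda>x. g x * P x (z k))" if "k \<in> B" for k
    by (intro integrable_L2_mult g kernel_L2_left z that)
  have iq: "integrable M ?q" using int by (intro Bochner_Integration.integrable_sum) simp
  have Iq: "(\<integral>x. ?q x \<partial>M) = (\<Sum>i\<in>B. b i * (\<integral>x. g x * P x (z i) \<partial>M))"
    using int by (subst Bochner_Integration.integral_sum) auto
  have e: "energy M P B z g b = ?I2 + 2 * (\<integral>x. ?q x \<partial>M) + ?c"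
    unfolding mutual_energy_expand[OF g g] integral_kernel_pair[OF g g] Iq by simp
  have pos: "0 \<le> ?I2 + 2 * (\<integral>x. ?q x \<partial>M) + ?c + (?I1 - ?I2) * (1 / real N)" if N: "N > 0" for N
  proof -
    let ?S = "PiM {..<N} (\<lambda>_. M)"
    interpret S: prob_space ?S by (rule prob_space_sample)
    define w where "w x y = g x * g y * P x y" for x y
    have wi: "integrable (M \<Otimes>\<^sub>M M) (\<lambda>(x, y). w x y)" "integrable M (\<lambda>x. w x x)"
      unfolding w_def by (rule integrable_kernel_pair[OF g g], rule integrable_kernel_diag[OF g])
    note dbl = sample_double_sum[OF finite_lessThan order_refl wi, of N]
    note sgl = sample_sum[OF finite_lessThan order_refl iq, of N]
    have "0 \<le> (\<integral>x. (\<Sum>i<N. \<Sum>j<N. w (x i) (x j)) * (1 / (real N)\<^sup>2) + (\<Sum>i<N. ?q (x i)) * (2 / real N) + ?c \<partial>?S)"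
    proof (rule integral_nonneg_AE, rule AE_I2)
      fix x assume x: "x \<in> space ?S"
      define y where "y = case_sum x z"
      define a where "a = case_sum (\<lambda>i. g (x i) / real N) b"
      have "0 \<le> (\<Sum>i\<in>{..<N} <+> B. \<Sum>j\<in>{..<N} <+> B. a i * a j * P (y i) (y j))"
        by (rule psd_kernel_family[OF kernel_psd])
          (use x fin z in \<open>auto simp: y_def space_PiM PiE_def\<close>)
      also have "\<dots> = (\<Sum>i<N. \<Sum>j<N. (g (x i) / real N) * (g (x j) / real N) * P (x i) (x j))
          + (\<Sum>i<N. \<Sum>j\<in>B. (g (x i) / real N) * b j * P (x i) (z j))
          + ((\<Sum>i\<in>B. \<Sum>j<N. b i * (g (x j) / real N) * P (z i) (x j)) + ?c)"
        using fin by (simp add: sum.Plus sum.distrib comp_def y_def a_def)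
      also have "(\<Sum>i\<in>B. \<Sum>j<N. b i * (g (x j) / real N) * P (z i) (x j))
          = (\<Sum>j<N. \<Sum>i\<in>B. b i * (g (x j) / real N) * P (z i) (x j))" by (rule sum.swap)
      also have "\<dots> = (\<Sum>i<N. ?q (x i)) * (1 / real N)"
        unfolding sum_distrib_right
      proof (intro sum.cong refl)
        fix j i assume "j \<in> {..<N}" "i \<in> B"
        then have "P (z i) (x j) = P (x j) (z i)" using x z by (intro kernel_sym) (auto simp: space_PiM PiE_def)
        then show "b i * (g (x j) / real N) * P (z i) (x j) = b i * (g (x j) * P (x j) (z i)) * (1 / real N)" by simp
      qed
      also have "(\<Sum>i<N. \<Sum>j\<in>B. (g (x i) / real N) * b j * P (x i) (z j)) = (\<Sum>i<N. ?q (x i)) * (1 / real N)"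
        unfolding sum_distrib_right by (intro sum.cong refl) (simp add: mult_ac)
      also have "(\<Sum>i<N. \<Sum>j<N. (g (x i) / real N) * (g (x j) / real N) * P (x i) (x j))
          = (\<Sum>i<N. \<Sum>j<N. w (x i) (x j)) * (1 / (real N)\<^sup>2)"
        unfolding sum_distrib_right w_def by (intro sum.cong refl) (simp add: power2_eq_square)
      finally show "0 \<le> (\<Sum>i<N. \<Sum>j<N. w (x i) (x j)) * (1 / (real N)\<^sup>2) + (\<Sum>i<N. ?q (x i)) * (2 / real N) + ?c"
        by (simp add: mult_ac)
    qed
    also have "\<dots> = (\<integral>x. (\<Sum>i<N. \<Sum>j<N. w (x i) (x j)) \<partial>?S) * (1 / (real N)\<^sup>2) + (\<integral>x. (\<Sum>i<N. ?q (x i)) \<partial>?S) * (2 / real N) + ?c"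
      using dbl(1) sgl(1) by (simp add: S.prob_space)
    also have "\<dots> = ?I2 + 2 * (\<integral>x. ?q x \<partial>M) + ?c + (?I1 - ?I2) * (1 / real N)"
      unfolding dbl(2) sgl(2) card_lessThan unfolding w_def using N by (simp add: field_simps power2_eq_square)
    finally show ?thesis .
  qed
  have "(\<lambda>N. ?I2 + 2 * (\<integral>x. ?q x \<partial>M) + ?c + (?I1 - ?I2) * (1 / real N)) \<longlonglongrightarrow> ?I2 + 2 * (\<integral>x. ?q x \<partial>M) + ?c + (?I1 - ?I2) * 0"
    by (intro tendsto_add tendsto_mult tendsto_const lim_1_over_n)
  then have "0 \<le> ?I2 + 2 * (\<integral>x. ?q x \<partial>M) + ?c + (?I1 - ?I2) * 0"
    by (rule tendsto_lowerbound[OF _ eventually_sequentiallyI[of 1]]) (simp_all only: pos trivial_limit_sequentially not_False_eq_True One_nat_def Suc_le_eq)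
  then show ?thesis unfolding e by simp
qed

lemma mutual_energy_Cauchy_Schwarz:
  assumes g: "g \<in> L2_space M" and g': "g' \<in> L2_space M"
  shows "(mutual_energy M P B z g b g' b')\<^sup>2 \<le> energy M P B z g b * energy M P B z g' b'"
proof (rule discriminant_nonneg)
  fix t
  show "0 \<le> energy M P B z g b + 2 * t * mutual_energy M P B z g b g' b' + t\<^sup>2 * energy M P B z g' b'"
    unfolding energy_add[OF g g', symmetric]
    by (intro energy_nonneg L2_space_add L2_space_scale g g')
qed (rule energy_nonneg[OF g'])

end

lemma density_energy_nonneg:
  assumes "g \<in> L2_space M"
  shows "0 \<le> (\<integral>y. g y * (\<integral>x. g x * P x y \<partial>M) \<partial>M)"
  using energy_nonneg[of "{}" undefined g undefined] assms
  by (simp add: mutual_energy_def potential_def)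

text \<open>Replacing the density by the weighted empirical measure of \<open>n\<close> sample points costs, on average, an
  energy of order \<open>1 / n\<close>.\<close>

theorem expected_sampling_energy:
  fixes B :: "'i set"
  assumes g: "g \<in> L2_space M" and B: "finite B" "B \<noteq> {}" "B \<subseteq> U"
  defines "n \<equiv> real (card B)"
  defines "Y \<equiv> \<lambda>x. energy M P B x g (\<lambda>i. - g (x i) / n)"
  shows "integrable (PiM U (\<lambda>_. M)) Y"
    and "(\<integral>x. Y x \<partial>PiM U (\<lambda>_. M)) \<le> (\<integral>x. g x * g x * P x x \<partial>M) / n"
proof -
  let ?S = "PiM U (\<lambda>_. M)"
  interpret S: prob_space ?S by (rule prob_space_sample)
  let ?I2 = "\<integral>p. (\<lambda>(x, y). g x * g y * P x y) p \<partial>(M \<Otimes>\<^sub>M M)"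
  define p where "p y = g y * (\<integral>x. g x * P x y \<partial>M)" for y
  define w where "w x y = g x * g y * P x y" for x y
  have n: "n > 0" using B by (simp add: n_def card_gt_0_iff)
  have wi: "integrable (M \<Otimes>\<^sub>M M) (\<lambda>(x, y). w x y)" "integrable M (\<lambda>x. w x x)"
    unfolding w_def by (rule integrable_kernel_pair[OF g g], rule integrable_kernel_diag[OF g])
  have pint: "integrable M p" unfolding p_def by (intro integrable_L2_mult g density_potential_L2)
  have Ip: "(\<integral>y. p y \<partial>M) = ?I2" unfolding p_def integral_kernel_pair[OF g g] ..
  note dbl = sample_double_sum[OF B(1) B(3) wi]
  note sgl = sample_sum[OF B(1) B(3) pint]
  have Yeq: "Y x = ?I2 - (\<Sum>i\<in>B. p (x i)) * (2 / n) + (\<Sum>i\<in>B. \<Sum>j\<in>B. w (x i) (x j)) * (1 / n\<^sup>2)"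
    if x: "x \<in> space ?S" for x
  proof -
    have xB: "x i \<in> space M" if "i \<in> B" for i using x that B by (auto simp: space_PiM PiE_def)
    have "Y x = ?I2 + 2 * (\<Sum>i\<in>B. (- g (x i) / n) * (\<integral>y. g y * P y (x i) \<partial>M))
        + (\<Sum>i\<in>B. \<Sum>j\<in>B. (- g (x i) / n) * (- g (x j) / n) * P (x i) (x j))"
      unfolding Y_def by (subst mutual_energy_expand[OF B(1) xB g g]) (simp_all add: integral_kernel_pair[OF g g])
    also have "(\<Sum>i\<in>B. (- g (x i) / n) * (\<integral>y. g y * P y (x i) \<partial>M)) = - (\<Sum>i\<in>B. p (x i)) * (1 / n)"
      unfolding p_def sum_negf[symmetric] sum_distrib_right by (intro sum.cong refl) simp
    also have "(\<Sum>i\<in>B. \<Sum>j\<in>B. (- g (x i) / n) * (- g (x j) / n) * P (x i) (x j)) = (\<Sum>i\<in>B. \<Sum>j\<in>B. w (x i) (x j)) * (1 / n\<^sup>2)"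
      unfolding sum_distrib_right w_def by (intro sum.cong refl) (simp add: power2_eq_square)
    finally show ?thesis by simp
  qed
  have "integrable ?S (\<lambda>x. ?I2 - (\<Sum>i\<in>B. p (x i)) * (2 / n) + (\<Sum>i\<in>B. \<Sum>j\<in>B. w (x i) (x j)) * (1 / n\<^sup>2))"
    using dbl(1) sgl(1) by simp
  then show "integrable ?S Y"
    by (subst Bochner_Integration.integrable_cong[OF refl Yeq])
  have "(\<integral>x. Y x \<partial>?S) = (\<integral>x. ?I2 - (\<Sum>i\<in>B. p (x i)) * (2 / n) + (\<Sum>i\<in>B. \<Sum>j\<in>B. w (x i) (x j)) * (1 / n\<^sup>2) \<partial>?S)"
    by (rule Bochner_Integration.integral_cong[OF refl Yeq])
  also have "\<dots> = ?I2 - (\<integral>x. (\<Sum>i\<in>B. p (x i)) \<partial>?S) * (2 / n) + (\<integral>x. (\<Sum>i\<in>B. \<Sum>j\<in>B. w (x i) (x j)) \<partial>?S) * (1 / n\<^sup>2)"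
    using dbl(1) sgl(1) by (simp add: S.prob_space)
  also have "\<dots> = (\<integral>x. w x x \<partial>M) / n - ?I2 / n"
    unfolding dbl(2) sgl(2) Ip n_def[symmetric] unfolding w_def using n by (simp add: field_simps power2_eq_square)
  also have "\<dots> \<le> (\<integral>x. w x x \<partial>M) / n"
    using density_energy_nonneg[OF g] n unfolding integral_kernel_pair[OF g g] by simp
  finally show "(\<integral>x. Y x \<partial>?S) \<le> (\<integral>x. g x * g x * P x x \<partial>M) / n" by (simp add: w_def)
qed

end

end

section \<open>Eigenfunctions of the integral operator\<close>

locale kernel_eigensystem = prob_space M for M :: "'a measure" +
  fixes K :: "'a \<Rightarrow> 'a \<Rightarrow> real" and C :: real and I :: "nat set" and \<mu> :: "nat \<Rightarrow> real" and e :: "nat \<Rightarrow> 'a \<Rightarrow> real"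
  assumes bk: "bounded_psd_kernel M K C"
    and on: "orthonormal_family M I e"
    and complete: "\<And>g. g \<in> L2_space M \<Longrightarrow> (\<And>k. k \<in> I \<Longrightarrow> (\<integral>x. g x * e k x \<partial>M) = 0) \<Longrightarrow> AE x in M. g x = 0"
    and eigen: "\<And>k. k \<in> I \<Longrightarrow> AE x in M. (\<integral>y. e k y * K y x \<partial>M) = \<mu> k * e k x"
begin

lemma e_L2: "k \<in> I \<Longrightarrow> e k \<in> L2_space M"
  by (rule orthonormal_L2[OF on])

text \<open>The function \<open>e k\<close> is only determined almost everywhere, whereas point masses see single points;
  dividing its image under the integral operator by the eigenvalue gives a representative with a
  meaningful value at every point.\<close>

definition eigfun :: "nat \<Rightarrow> 'a \<Rightarrow> real" where
  "eigfun k x = (\<integral>y. e k y * K y x \<partial>M) / \<mu> k"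

lemma operator_eigfun: "\<mu> k > 0 \<Longrightarrow> (\<integral>y. e k y * K y x \<partial>M) = \<mu> k * eigfun k x"
  by (simp add: eigfun_def)

lemma eigfun_AE: "k \<in> I \<Longrightarrow> \<mu> k > 0 \<Longrightarrow> AE x in M. eigfun k x = e k x"
  using eigen[of k] by (auto simp: eigfun_def elim!: eventually_mono)

lemma eigfun_measurable: "k \<in> I \<Longrightarrow> eigfun k \<in> borel_measurable M"
  unfolding eigfun_def[abs_def] using density_potential_measurable[OF bk e_L2] by simp

lemma eigfun_bounded: "k \<in> I \<Longrightarrow> x \<in> space M \<Longrightarrow> \<bar>eigfun k x\<bar> \<le> C * L2_norm M (e k) / \<bar>\<mu> k\<bar>"
  unfolding eigfun_def abs_divide
  by (intro divide_right_mono density_potential_abs_le[OF bk] e_L2) auto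

lemma eigfun_L2: "k \<in> I \<Longrightarrow> eigfun k \<in> L2_space M"
  by (rule L2_space_bounded[OF eigfun_measurable eigfun_bounded])

lemma inner_eigfun:
  assumes "k \<in> I" "\<mu> k > 0" "g \<in> L2_space M"
  shows "(\<integral>x. g x * eigfun k x \<partial>M) = (\<integral>x. g x * e k x \<partial>M)"
  using eigfun_AE[OF assms(1,2)] L2_spaceD(1)[OF assms(3)] L2_spaceD(1)[OF e_L2[OF assms(1)]]
    eigfun_measurable[OF assms(1)]
  by (intro integral_cong_AE) (auto elim!: eventually_mono)

lemma eigfun_normalized:
  assumes "k \<in> I" "\<mu> k > 0"
  shows "(\<integral>x. eigfun k x * eigfun k x \<partial>M) = 1"
proof -
  have "(\<integral>x. eigfun k x * eigfun k x \<partial>M) = (\<integral>x. eigfun k x * e k x \<partial>M)"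
    by (rule inner_eigfun[OF assms eigfun_L2[OF assms(1)]])
  also have "\<dots> = (\<integral>x. e k x * eigfun k x \<partial>M)" by (simp add: mult.commute)
  also have "\<dots> = (\<integral>x. e k x * e k x \<partial>M)" by (rule inner_eigfun[OF assms e_L2[OF assms(1)]])
  also have "\<dots> = 1" using orthonormal_inner[OF on assms(1) assms(1)] by simp
  finally show ?thesis .
qed

lemma operator_self_adjoint_eigen:
  assumes k: "k \<in> I" and g: "g \<in> L2_space M"
  shows "(\<integral>x. e k x * (\<integral>y. g y * K y x \<partial>M) \<partial>M) = \<mu> k * (\<integral>x. g x * e k x \<partial>M)"
proof -
  have "(\<integral>x. e k x * (\<integral>y. g y * K y x \<partial>M) \<partial>M) = (\<integral>x. g x * (\<integral>y. e k y * K y x \<partial>M) \<partial>M)"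
    by (rule density_energy_commute[OF bk g e_L2[OF k]])
  also have "\<dots> = (\<integral>x. g x * (\<mu> k * e k x) \<partial>M)"
    using eigen[OF k] L2_spaceD(1)[OF g] L2_spaceD(1)[OF e_L2[OF k]]
      density_potential_measurable[OF bk e_L2[OF k]]
    by (intro integral_cong_AE) (auto elim!: eventually_mono)
  also have "\<dots> = \<mu> k * (\<integral>x. g x * e k x \<partial>M)"
    by (simp add: mult.left_commute)
  finally show ?thesis .
qed

lemma eigenvalue_nonneg:
  assumes k: "k \<in> I"
  shows "0 \<le> \<mu> k"
proof -
  have "0 \<le> (\<integral>x. e k x * (\<integral>y. e k y * K y x \<partial>M) \<partial>M)"
    by (rule density_energy_nonneg[OF bk e_L2[OF k]])
  also have "\<dots> = \<mu> k"
    unfolding operator_self_adjoint_eigen[OF k e_L2[OF k]] orthonormal_inner[OF on k k] by simp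
  finally show ?thesis .
qed

text \<open>At every point, and not only almost everywhere: the energy of \<open>e k\<close> is zero, and the energy dominates
  the evaluation at \<open>x\<close> by the Cauchy-Schwarz inequality.\<close>

lemma operator_zero_eigenvalue:
  assumes k: "k \<in> I" "\<mu> k = 0" and x: "x \<in> space M"
  shows "(\<integral>y. e k y * K y x \<partial>M) = 0"
proof -
  let ?z = "\<lambda>_::unit. x"
  have z: "\<And>i. i \<in> {()} \<Longrightarrow> ?z i \<in> space M" using x by simp
  have "(mutual_energy M K {()} ?z (e k) (\<lambda>_. 0) (\<lambda>_. 0) (\<lambda>_. 1))\<^sup>2
      \<le> energy M K {()} ?z (e k) (\<lambda>_. 0) * energy M K {()} ?z (\<lambda>_. 0) (\<lambda>_. 1)"
    by (rule mutual_energy_Cauchy_Schwarz[OF bk _ z e_L2[OF k(1)] L2_space_const]) simp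
  also have "energy M K {()} ?z (e k) (\<lambda>_. 0) = 0"
    using operator_self_adjoint_eigen[OF k(1) e_L2[OF k(1)]] k(2)
    by (simp add: mutual_energy_def potential_def)
  finally show ?thesis by (simp add: mutual_energy_def potential_def)
qed

lemma operator_combination:
  assumes F: "finite F" "F \<subseteq> I" and x: "x \<in> space M"
  shows "(\<integral>y. (\<Sum>k\<in>F. c k * e k y) * K y x \<partial>M) = (\<Sum>k\<in>F. c k * (\<integral>y. e k y * K y x \<partial>M))"
  using inner_orthonormal_combination[OF on F kernel_L2_left[OF bk x], of c] by (simp only: mult.commute)

text \<open>Removing finitely many eigencomponents leaves a positive semidefinite kernel: the energy of the
  point masses together with the density that cancels their components along the eigenfunctions is
  nonnegative.\<close>

theorem kernel_minus_eigencomponents_psd: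
  assumes F: "finite F" "F \<subseteq> I" and pos: "\<And>k. k \<in> F \<Longrightarrow> \<mu> k > 0"
  shows "psd_kernel (space M) (\<lambda>x y. K x y - (\<Sum>k\<in>F. \<mu> k * eigfun k x * eigfun k y))"
  unfolding psd_kernel_def
proof (intro conjI ballI allI impI)
  fix x y assume "x \<in> space M" "y \<in> space M"
  then show "K x y - (\<Sum>k\<in>F. \<mu> k * eigfun k x * eigfun k y) = K y x - (\<Sum>k\<in>F. \<mu> k * eigfun k y * eigfun k x)"
    using kernel_sym[OF bk, of x y] by (simp add: mult_ac)
next
  fix S a assume S: "finite S" "S \<subseteq> space M"
  define c where "c k = (\<Sum>x\<in>S. a x * eigfun k x)" for k
  define g where "g x = (\<Sum>k\<in>F. (- c k) * e k x)" for x
  have g: "g \<in> L2_space M" unfolding g_def by (rule orthonormal_combination_L2[OF on F(2)])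
  have z: "\<And>x. x \<in> S \<Longrightarrow> (\<lambda>x. x) x \<in> space M" using S by auto
  have Tg: "(\<integral>y. g y * K y x \<partial>M) = - (\<Sum>k\<in>F. \<mu> k * c k * eigfun k x)" if "x \<in> space M" for x
  proof -
    have "(\<integral>y. g y * K y x \<partial>M) = (\<Sum>k\<in>F. (- c k) * (\<mu> k * eigfun k x))"
      unfolding g_def operator_combination[OF F that]
      by (intro sum.cong refl) (simp only: operator_eigfun[OF pos])
    also have "\<dots> = - (\<Sum>k\<in>F. \<mu> k * c k * eigfun k x)"
      unfolding sum_negf[symmetric] by (intro sum.cong refl) simp
    finally show ?thesis .
  qed
  have gT: "(\<integral>x. g x * (\<integral>y. g y * K y x \<partial>M) \<partial>M) = (\<Sum>k\<in>F. \<mu> k * (c k)\<^sup>2)"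
  proof -
    have "(\<integral>x. g x * (\<integral>y. g y * K y x \<partial>M) \<partial>M) = (\<integral>x. (\<integral>y. g y * K y x \<partial>M) * (\<Sum>k\<in>F. (- c k) * e k x) \<partial>M)"
      by (simp only: g_def mult.commute)
    also have "\<dots> = (\<Sum>k\<in>F. (- c k) * (\<integral>x. (\<integral>y. g y * K y x \<partial>M) * e k x \<partial>M))"
      by (rule inner_orthonormal_combination[OF on F density_potential_L2[OF bk g]])
    also have "\<dots> = (\<Sum>k\<in>F. (- c k) * (\<mu> k * (- c k)))"
    proof (intro sum.cong refl)
      fix k assume k: "k \<in> F"
      then have kI: "k \<in> I" using F by auto
      have "(\<integral>x. (\<integral>y. g y * K y x \<partial>M) * e k x \<partial>M) = \<mu> k * (\<integral>x. g x * e k x \<partial>M)"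
        using operator_self_adjoint_eigen[OF kI g] by (simp only: mult.commute)
      also have "(\<integral>x. g x * e k x \<partial>M) = - c k"
        unfolding g_def using orthonormal_combination_coefficient[OF on F kI, of "\<lambda>k. - c k"] k by simp
      finally show "(- c k) * (\<integral>x. (\<integral>y. g y * K y x \<partial>M) * e k x \<partial>M) = (- c k) * (\<mu> k * (- c k))" by simp
    qed
    finally show ?thesis by (simp add: power2_eq_square mult_ac)
  qed
  have "0 \<le> energy M K S (\<lambda>x. x) g a" by (rule energy_nonneg[where z = "\<lambda>x. x", OF bk S(1) z g])
  also have "\<dots> = (\<Sum>k\<in>F. \<mu> k * (c k)\<^sup>2) + 2 * (\<Sum>x\<in>S. a x * (\<integral>y. g y * K y x \<partial>M)) + (\<Sum>x\<in>S. \<Sum>y\<in>S. a x * a y * K x y)"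
    using mutual_energy_expand[where z = "\<lambda>x. x" and b = a and b' = a, OF bk S(1) z g g] gT by simp
  also have "(\<Sum>x\<in>S. a x * (\<integral>y. g y * K y x \<partial>M)) = (\<Sum>x\<in>S. \<Sum>k\<in>F. - (\<mu> k * c k * (a x * eigfun k x)))"
    using S by (intro sum.cong refl) (simp add: Tg subset_iff sum_distrib_left sum_negf mult_ac)
  also have "\<dots> = (\<Sum>k\<in>F. \<Sum>x\<in>S. - (\<mu> k * c k * (a x * eigfun k x)))" by (rule sum.swap)
  also have "\<dots> = - (\<Sum>k\<in>F. \<mu> k * (c k)\<^sup>2)"
    unfolding sum_negf sum_distrib_left[symmetric] c_def[symmetric] by (simp add: power2_eq_square mult_ac)
  also have "(\<Sum>k\<in>F. \<mu> k * (c k)\<^sup>2) = (\<Sum>x\<in>S. \<Sum>y\<in>S. a x * a y * (\<Sum>k\<in>F. \<mu> k * eigfun k x * eigfun k y))"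
  proof -
    have "(\<Sum>x\<in>S. \<Sum>y\<in>S. a x * a y * (\<Sum>k\<in>F. \<mu> k * eigfun k x * eigfun k y))
        = (\<Sum>x\<in>S. \<Sum>y\<in>S. \<Sum>k\<in>F. \<mu> k * ((a x * eigfun k x) * (a y * eigfun k y)))"
      unfolding sum_distrib_left by (intro sum.cong refl) (simp add: mult_ac)
    also have "\<dots> = (\<Sum>x\<in>S. \<Sum>k\<in>F. \<Sum>y\<in>S. \<mu> k * ((a x * eigfun k x) * (a y * eigfun k y)))"
      by (intro sum.cong refl sum.swap)
    also have "\<dots> = (\<Sum>k\<in>F. \<Sum>x\<in>S. \<Sum>y\<in>S. \<mu> k * ((a x * eigfun k x) * (a y * eigfun k y)))"
      by (rule sum.swap)
    also have "\<dots> = (\<Sum>k\<in>F. \<mu> k * (c k)\<^sup>2)"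
      unfolding c_def power2_eq_square sum_product unfolding sum_distrib_left ..
    finally show ?thesis ..
  qed
  finally show "0 \<le> (\<Sum>x\<in>S. \<Sum>y\<in>S. a x * a y * (K x y - (\<Sum>k\<in>F. \<mu> k * eigfun k x * eigfun k y)))"
    by (simp add: right_diff_distrib sum_subtractf)
qed

lemma eigencomponents_le_diag:
  assumes "finite F" "F \<subseteq> I" "\<And>k. k \<in> F \<Longrightarrow> \<mu> k > 0" "x \<in> space M"
  shows "(\<Sum>k\<in>F. \<mu> k * eigfun k x * eigfun k x) \<le> K x x"
  using psd_kernel_diag[OF kernel_minus_eigencomponents_psd[OF assms(1-3)] assms(4)] by simp

lemma sum_eigenvalues_le:
  assumes F: "finite F" "F \<subseteq> I" and pos: "\<And>k. k \<in> F \<Longrightarrow> \<mu> k > 0"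
  shows "(\<Sum>k\<in>F. \<mu> k) \<le> C"
proof -
  have i: "integrable M (\<lambda>x. \<mu> k * eigfun k x * eigfun k x)" if "k \<in> F" for k
    using integrable_L2_mult[OF eigfun_L2 eigfun_L2, of k k] that F by (auto simp: mult.assoc)
  have "(\<Sum>k\<in>F. \<mu> k) = (\<Sum>k\<in>F. \<integral>x. \<mu> k * eigfun k x * eigfun k x \<partial>M)"
  proof (intro sum.cong refl)
    fix k assume "k \<in> F"
    then show "\<mu> k = (\<integral>x. \<mu> k * eigfun k x * eigfun k x \<partial>M)"
      using eigfun_normalized[of k] pos[of k] F by (auto simp: mult.assoc)
  qed
  also have "\<dots> = (\<integral>x. (\<Sum>k\<in>F. \<mu> k * eigfun k x * eigfun k x) \<partial>M)"
    using i by (simp add: Bochner_Integration.integral_sum)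
  also have "\<dots> \<le> (\<integral>x. C \<partial>M)"
  proof (rule integral_mono)
    fix x assume "x \<in> space M"
    then show "(\<Sum>k\<in>F. \<mu> k * eigfun k x * eigfun k x) \<le> C"
      using eigencomponents_le_diag[OF F pos] kernel_diag_le[OF bk] by (meson order_trans)
  qed (use i in auto)
  finally show ?thesis by (simp add: prob_space)
qed

lemma eigenvalue_le: "k \<in> I \<Longrightarrow> \<mu> k \<le> C"
  using sum_eigenvalues_le[of "{k}"] eigenvalue_nonneg[of k] kernel_bound_nonneg[OF bk]
  by (cases "\<mu> k = 0") auto

definition large :: "real \<Rightarrow> nat set" where
  "large lam = {k \<in> I. \<mu> k > lam}"

context
  fixes lam :: real
  assumes lam: "lam > 0"
begin

lemma large_finite: "finite (large lam)"
proof (rule ccontr)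
  assume "\<not> finite (large lam)"
  define n where "n = nat \<lceil>C / lam\<rceil> + 1"
  obtain F where F: "F \<subseteq> large lam" "finite F" "card F = n"
    using infinite_arbitrarily_large[OF \<open>\<not> finite (large lam)\<close>] by blast
  have "real n * lam = (\<Sum>k\<in>F. lam)" using F by simp
  also have "\<dots> \<le> (\<Sum>k\<in>F. \<mu> k)" using F by (intro sum_mono) (auto simp: large_def)
  also have "\<dots> \<le> C" using F lam by (intro sum_eigenvalues_le) (auto simp: large_def)
  finally have "real n \<le> C / lam" using lam by (simp add: pos_le_divide_eq)
  then show False unfolding n_def by linarith
qed

lemma large_subset: "large lam \<subseteq> I"
  by (auto simp: large_def)

lemma large_pos: "k \<in> large lam \<Longrightarrow> \<mu> k > 0"
  using lam by (auto simp: large_def)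

text \<open>The kernel of the operator \<open>L * (max L lam)\<^sup>-\<^sup>1\<close>, where \<open>L\<close> is the integral operator of \<open>K\<close>: the
  eigenvalues above \<open>lam\<close> are replaced by one and the others are divided by \<open>lam\<close>.\<close>

definition capped :: "'a \<Rightarrow> 'a \<Rightarrow> real" where
  "capped x y = (K x y - (\<Sum>k\<in>large lam. (\<mu> k - lam) * eigfun k x * eigfun k y)) / lam"

lemma kernel_minus_capped_psd: "psd_kernel (space M) (\<lambda>x y. K x y - lam * capped x y)"
proof -
  have "psd_kernel (space M) (\<lambda>x y. \<Sum>k\<in>large lam. (\<mu> k - lam) * (eigfun k x * eigfun k y))"
    by (intro psd_kernel_sum large_finite psd_kernel_scale psd_kernel_rank_one) (auto simp: large_def)
  then show ?thesis using lam by (simp add: capped_def mult.assoc)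
qed

lemma capped_psd: "psd_kernel (space M) capped"
proof -
  have "psd_kernel (space M) (\<lambda>x y. (1 / lam) * (K x y - (\<Sum>k\<in>large lam. \<mu> k * eigfun k x * eigfun k y))
      + (\<Sum>k\<in>large lam. eigfun k x * eigfun k y))"
    using lam by (intro psd_kernel_add psd_kernel_scale psd_kernel_sum psd_kernel_rank_one
      kernel_minus_eigencomponents_psd large_finite large_subset large_pos) auto
  moreover have "(1 / lam) * (K x y - (\<Sum>k\<in>large lam. \<mu> k * eigfun k x * eigfun k y))
      + (\<Sum>k\<in>large lam. eigfun k x * eigfun k y) = capped x y" for x y
    using lam unfolding capped_def
    by (simp add: left_diff_distrib sum_subtractf diff_divide_distrib mult.assoc sum_distrib_left[symmetric])
  ultimately show ?thesis by simp
qed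

lemma capped_diag_le: "x \<in> space M \<Longrightarrow> capped x x \<le> K x x / lam"
  using psd_kernel_diag[OF kernel_minus_capped_psd, of x] lam by (simp add: field_simps)

lemma capped_bounded: "bounded_psd_kernel M capped (C / lam)"
  unfolding bounded_psd_kernel_def
proof (intro conjI ballI capped_psd)
  have [measurable]: "eigfun k \<in> borel_measurable M" if "k \<in> large lam" for k
    using that large_subset by (intro eigfun_measurable) auto
  note [measurable (raw)] = kernel_measurable[OF bk]
  have "(\<lambda>p. K (fst p) (snd p)) \<in> borel_measurable (M \<Otimes>\<^sub>M M)" by measurable
  moreover have "(\<lambda>p. \<Sum>k\<in>large lam. (\<mu> k - lam) * eigfun k (fst p) * eigfun k (snd p)) \<in> borel_measurable (M \<Otimes>\<^sub>M M)"
    by (rule borel_measurable_sum) measurable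
  ultimately show "(\<lambda>(x, y). capped x y) \<in> borel_measurable (M \<Otimes>\<^sub>M M)"
    unfolding capped_def split_beta' by (intro borel_measurable_divide borel_measurable_diff) auto
next
  fix x assume "x \<in> space M"
  then show "capped x x \<le> C / lam"
    using capped_diag_le[of x] kernel_diag_le[OF bk, of x] lam
    by (meson divide_right_mono less_imp_le order_trans)
qed

text \<open>For a continuous kernel on a compact space this is the trace of \<open>L * (max L lam)\<^sup>-\<^sup>1\<close>; up to a factor of two it agrees with
  the trace of \<open>L * (L + lam)\<^sup>-\<^sup>1\<close>, of which the effective dimension of the kernel matrix is the empirical
  version.\<close>

definition dimension :: real where
  "dimension = (\<integral>x. capped x x \<partial>M)"

lemma capped_diag_integrable: "integrable M (\<lambda>x. capped x x)"
  using integrable_kernel_diag[OF capped_bounded L2_space_const[of 1]] by simp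

lemma dimension_le: "dimension \<le> C / lam"
proof -
  have "dimension \<le> (\<integral>x. C / lam \<partial>M)"
    unfolding dimension_def using capped_diag_integrable kernel_diag_le[OF capped_bounded]
    by (intro integral_mono) auto
  then show ?thesis by (simp add: prob_space)
qed

lemma capped_eigen_inner:
  assumes k: "k \<in> I" and x: "x \<in> space M"
  shows "(\<integral>y. capped x y * e k y \<partial>M) = (if k \<in> large lam then eigfun k x else (\<integral>y. e k y * K y x \<partial>M) / lam)"
proof -
  have kl: "\<And>j. j \<in> large lam \<Longrightarrow> j \<in> I" using large_subset by auto
  have iK: "integrable M (\<lambda>y. K x y * e k y)"
    by (intro integrable_L2_mult kernel_L2_right[OF bk x] e_L2 k)
  have iE: "integrable M (\<lambda>y. eigfun j y * e k y)" if "j \<in> large lam" for j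
    by (intro integrable_L2_mult eigfun_L2 e_L2 k kl that)
  have E: "(\<integral>y. eigfun j y * e k y \<partial>M) = (if j = k then 1 else 0)" if j: "j \<in> large lam" for j
    using inner_eigfun[OF kl[OF j] large_pos[OF j] e_L2[OF k]] orthonormal_inner[OF on k kl[OF j]]
    by (simp add: mult.commute eq_commute)
  have "(\<integral>y. capped x y * e k y \<partial>M)
      = (\<integral>y. (K x y * e k y - (\<Sum>j\<in>large lam. (\<mu> j - lam) * eigfun j x * (eigfun j y * e k y))) / lam \<partial>M)"
    unfolding capped_def
    by (intro Bochner_Integration.integral_cong refl)
      (simp only: times_divide_eq_left left_diff_distrib[of "K x _" "sum _ _"] sum_distrib_right mult.assoc)
  also have "\<dots> = ((\<integral>y. K x y * e k y \<partial>M) - (\<Sum>j\<in>large lam. (\<mu> j - lam) * eigfun j x * (\<integral>y. eigfun j y * e k y \<partial>M))) / lam"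
    using iK iE by (simp add: Bochner_Integration.integral_sum Bochner_Integration.integrable_sum)
  also have "(\<Sum>j\<in>large lam. (\<mu> j - lam) * eigfun j x * (\<integral>y. eigfun j y * e k y \<partial>M))
      = (\<Sum>j\<in>large lam. (if j = k then (\<mu> j - lam) * eigfun j x else 0))"
    by (intro sum.cong refl) (simp add: E)
  also have "\<dots> = (if k \<in> large lam then (\<mu> k - lam) * eigfun k x else 0)"
    using large_finite by (simp add: sum.delta)
  also have "(\<integral>y. K x y * e k y \<partial>M) = (\<integral>y. e k y * K y x \<partial>M)"
    using kernel_sym[OF bk x] by (intro Bochner_Integration.integral_cong refl) (simp add: mult.commute)
  finally show ?thesis
    using operator_eigfun[OF large_pos, of k] lam by (auto simp: algebra_simps)
qed

text \<open>The operator of the capped kernel is a contraction, so that by Parseval's identity the square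
  integral of a row is at most the diagonal entry.\<close>

theorem capped_row_square_le:
  assumes x: "x \<in> space M"
  shows "(\<integral>y. (capped x y)\<^sup>2 \<partial>M) \<le> capped x x"
proof (rule Parseval_le[OF on complete kernel_L2_right[OF capped_bounded x]])
  fix J assume J: "finite J" "J \<subseteq> I"
  define F where "F = large lam \<union> {k \<in> J. \<mu> k > 0}"
  define r where "r k = \<mu> k * eigfun k x * eigfun k x" for k
  have F: "finite F" "F \<subseteq> I" "\<And>k. k \<in> F \<Longrightarrow> \<mu> k > 0"
    using J large_finite large_subset large_pos by (auto simp: F_def)
  have r0: "r k \<ge> 0" if "k \<in> I" for k
    using eigenvalue_nonneg[OF that] by (simp add: r_def mult.assoc)
  have one: "(\<integral>y. capped x y * e k y \<partial>M)\<^sup>2 \<le> (if k \<in> F then (if k \<in> large lam then (eigfun k x)\<^sup>2 else r k / lam) else 0)"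
    if k: "k \<in> J" for k
  proof (cases "k \<in> large lam")
    case True
    then show ?thesis using capped_eigen_inner[OF _ x, of k] k J by (auto simp: F_def)
  next
    case False
    then have le: "\<mu> k \<le> lam" using k J by (auto simp: large_def)
    show ?thesis
    proof (cases "\<mu> k > 0")
      case True
      have "(\<integral>y. capped x y * e k y \<partial>M)\<^sup>2 = (\<mu> k / lam) * (r k / lam)"
        using capped_eigen_inner[OF _ x, of k] k J False operator_eigfun[OF True]
        by (auto simp: r_def power2_eq_square)
      also have "\<dots> \<le> 1 * (r k / lam)"
        using le lam r0[of k] k J by (intro mult_right_mono) auto
      finally show ?thesis using False True k by (simp add: F_def)
    next
      case zero: False
      then have "\<mu> k = 0" using eigenvalue_nonneg[of k] k J by auto
      then show ?thesis
        using capped_eigen_inner[OF _ x, of k] operator_zero_eigenvalue[OF _ _ x, of k] k J False zero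
        by (auto simp: F_def)
    qed
  qed
  have "(\<Sum>k\<in>J. (\<integral>y. capped x y * e k y \<partial>M)\<^sup>2)
      \<le> (\<Sum>k\<in>J. if k \<in> F then (if k \<in> large lam then (eigfun k x)\<^sup>2 else r k / lam) else 0)"
    by (intro sum_mono one)
  also have "\<dots> = (\<Sum>k\<in>J \<inter> F. if k \<in> large lam then (eigfun k x)\<^sup>2 else r k / lam)"
    using J by (simp add: sum.inter_restrict)
  also have "\<dots> \<le> (\<Sum>k\<in>F. if k \<in> large lam then (eigfun k x)\<^sup>2 else r k / lam)"
    using F r0 lam by (intro sum_mono2) (auto intro!: divide_nonneg_pos)
  also have "\<dots> = (\<Sum>k\<in>F. (r k - (if k \<in> large lam then (\<mu> k - lam) * eigfun k x * eigfun k x else 0)) / lam)"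
    using lam by (intro sum.cong refl) (auto simp: r_def power2_eq_square field_simps)
  also have "\<dots> = ((\<Sum>k\<in>F. r k) - (\<Sum>k\<in>large lam. (\<mu> k - lam) * eigfun k x * eigfun k x)) / lam"
  proof -
    have "(\<Sum>k\<in>F. if k \<in> large lam then (\<mu> k - lam) * eigfun k x * eigfun k x else 0)
        = (\<Sum>k\<in>F \<inter> large lam. (\<mu> k - lam) * eigfun k x * eigfun k x)"
      using F by (simp add: sum.inter_restrict)
    also have "F \<inter> large lam = large lam" by (auto simp: F_def)
    finally show ?thesis by (simp add: sum_divide_distrib[symmetric] sum_subtractf)
  qed
  also have "\<dots> \<le> capped x x"
    unfolding capped_def using eigencomponents_le_diag[OF F x] lam
    by (intro divide_right_mono diff_right_mono) (auto simp: r_def)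
  finally show "(\<Sum>k\<in>J. (\<integral>y. capped x y * e k y \<partial>M)\<^sup>2) \<le> capped x x" .
qed

lemma capped_pair_square_le:
  "integrable (M \<Otimes>\<^sub>M M) (\<lambda>(x, y). (capped x y)\<^sup>2)"
  "(\<integral>p. (\<lambda>(x, y). (capped x y)\<^sup>2) p \<partial>(M \<Otimes>\<^sub>M M)) \<le> dimension"
proof -
  interpret pair: pair_prob_space M M ..
  show i: "integrable (M \<Otimes>\<^sub>M M) (\<lambda>(x, y). (capped x y)\<^sup>2)"
  proof (rule pair.integrable_const_bound)
    show "AE p in M \<Otimes>\<^sub>M M. norm (case p of (x, y) \<Rightarrow> (capped x y)\<^sup>2) \<le> (C / lam)\<^sup>2"
    proof (rule AE_I2)
      fix p assume "p \<in> space (M \<Otimes>\<^sub>M M)"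
      then have "\<bar>capped (fst p) (snd p)\<bar> \<le> C / lam"
        by (intro kernel_abs_le[OF capped_bounded]) (auto simp: space_pair_measure)
      from power_mono[OF this abs_ge_zero, of 2]
      show "norm (case p of (x, y) \<Rightarrow> (capped x y)\<^sup>2) \<le> (C / lam)\<^sup>2"
        by (simp add: split_beta')
    qed
    show "(\<lambda>(x, y). (capped x y)\<^sup>2) \<in> borel_measurable (M \<Otimes>\<^sub>M M)"
      unfolding split_beta'
      by (intro borel_measurable_power kernel_measurable[OF capped_bounded] measurable_fst measurable_snd)
  qed
  have "(\<integral>p. (\<lambda>(x, y). (capped x y)\<^sup>2) p \<partial>(M \<Otimes>\<^sub>M M)) = (\<integral>x. (\<integral>y. (capped x y)\<^sup>2 \<partial>M) \<partial>M)"
    using pair.integral_fst[OF i] by (simp only: case_prod_conv)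
  also have "\<dots> \<le> dimension"
    unfolding dimension_def
  proof (rule integral_mono[OF _ capped_diag_integrable capped_row_square_le])
    show "integrable M (\<lambda>x. \<integral>y. (capped x y)\<^sup>2 \<partial>M)"
      using pair.integrable_fst[OF i] by (simp only: case_prod_conv)
  qed
  finally show "(\<integral>p. (\<lambda>(x, y). (capped x y)\<^sup>2) p \<partial>(M \<Otimes>\<^sub>M M)) \<le> dimension" .
qed

end

end

section \<open>Functions vanishing at the sample points\<close>

context prob_space
begin

lemma mutual_energy_density:
  "mutual_energy M P B z g b g' (\<lambda>_. 0) = (\<integral>x. g' x * potential M P g B b z x \<partial>M)"
  by (simp add: mutual_energy_def)

lemma energy_density:
  "energy M P B z g (\<lambda>_. 0) = (\<integral>x. g x * (\<integral>y. g y * P y x \<partial>M) \<partial>M)"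
  by (simp add: mutual_energy_def potential_def)

text \<open>The sum of \<open>a x * v x\<close> is the mutual energy of the measure of \<open>v\<close> and of the point masses \<open>a x\<close>, so the
  claim is the Cauchy-Schwarz inequality for energies.\<close>

lemma potential_dominated_psd:
  fixes B :: "'i set" and b :: "'i \<Rightarrow> real"
  assumes bk: "bounded_psd_kernel M P C" and fin: "finite B" and z: "\<And>i. i \<in> B \<Longrightarrow> z i \<in> space M"
    and g: "g \<in> L2_space M"
  defines "v \<equiv> potential M P g B b z"
  shows "psd_kernel (space M) (\<lambda>x y. energy M P B z g b * P x y - v x * v y)"
  unfolding psd_kernel_def
proof (intro conjI ballI allI impI)
  fix x y assume "x \<in> space M" "y \<in> space M"
  then show "energy M P B z g b * P x y - v x * v y = energy M P B z g b * P y x - v y * v x"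
    using kernel_sym[OF bk, of x y] by simp
next
  fix S a assume S: "finite S" "S \<subseteq> space M"
  define z' where "z' = case_sum z (\<lambda>x. x)"
  have fin': "finite (B <+> S)" using fin S by simp
  have z': "\<And>i. i \<in> B <+> S \<Longrightarrow> z' i \<in> space M" using z S by (auto simp: z'_def)
  have pot: "potential M P g (B <+> S) (case_sum b (\<lambda>_. 0)) z' = v"
    using fin S by (simp add: fun_eq_iff potential_def v_def z'_def sum.Plus comp_def)
  have "(mutual_energy M P (B <+> S) z' g (case_sum b (\<lambda>_. 0)) (\<lambda>_. 0) (case_sum (\<lambda>_. 0) a))\<^sup>2
      \<le> energy M P (B <+> S) z' g (case_sum b (\<lambda>_. 0)) * energy M P (B <+> S) z' (\<lambda>_. 0) (case_sum (\<lambda>_. 0) a)"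
    by (rule mutual_energy_Cauchy_Schwarz[OF bk fin' z' g L2_space_const])
  also have "energy M P (B <+> S) z' g (case_sum b (\<lambda>_. 0)) = energy M P B z g b"
    using fin S unfolding mutual_energy_def pot by (simp add: sum.Plus comp_def z'_def v_def)
  also have "energy M P (B <+> S) z' (\<lambda>_. 0) (case_sum (\<lambda>_. 0) a) = (\<Sum>x\<in>S. \<Sum>y\<in>S. a x * a y * P x y)"
  proof -
    have "energy M P (B <+> S) z' (\<lambda>_. 0) (case_sum (\<lambda>_. 0) a) = (\<Sum>y\<in>S. \<Sum>x\<in>S. a x * a y * P x y)"
      using fin S unfolding mutual_energy_def potential_def
      by (simp add: sum.Plus comp_def z'_def sum_distrib_left mult_ac)
    also have "\<dots> = (\<Sum>x\<in>S. \<Sum>y\<in>S. a x * a y * P x y)" by (rule sum.swap)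
    finally show ?thesis .
  qed
  also have "mutual_energy M P (B <+> S) z' g (case_sum b (\<lambda>_. 0)) (\<lambda>_. 0) (case_sum (\<lambda>_. 0) a) = (\<Sum>x\<in>S. a x * v x)"
    using fin S unfolding mutual_energy_def pot by (simp add: sum.Plus comp_def z'_def)
  finally have "(\<Sum>x\<in>S. a x * v x)\<^sup>2 \<le> energy M P B z g b * (\<Sum>x\<in>S. \<Sum>y\<in>S. a x * a y * P x y)" .
  moreover have "(\<Sum>x\<in>S. \<Sum>y\<in>S. a x * a y * (v x * v y)) = (\<Sum>x\<in>S. a x * v x)\<^sup>2"
    unfolding power2_eq_square sum_product by (intro sum.cong refl) (simp add: mult_ac)
  moreover have "(\<Sum>x\<in>S. \<Sum>y\<in>S. a x * a y * (energy M P B z g b * P x y - v x * v y))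
      = energy M P B z g b * (\<Sum>x\<in>S. \<Sum>y\<in>S. a x * a y * P x y) - (\<Sum>x\<in>S. \<Sum>y\<in>S. a x * a y * (v x * v y))"
    by (simp add: right_diff_distrib sum_subtractf sum_distrib_left mult_ac)
  ultimately show "0 \<le> (\<Sum>x\<in>S. \<Sum>y\<in>S. a x * a y * (energy M P B z g b * P x y - v x * v y))"
    by linarith
qed

lemma potential_square_integral_le:
  fixes B :: "'i set" and b :: "'i \<Rightarrow> real"
  assumes bk: "bounded_psd_kernel M P C" and fin: "finite B" and z: "\<And>i. i \<in> B \<Longrightarrow> z i \<in> space M"
    and g: "g \<in> L2_space M"
  shows "(\<integral>x. (potential M P g B b z x)\<^sup>2 \<partial>M) \<le> C * energy M P B z g b"
proof -
  let ?v = "potential M P g B b z"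
  have "(\<integral>x. (?v x)\<^sup>2 \<partial>M) \<le> (\<integral>x. C * energy M P B z g b \<partial>M)"
  proof (rule integral_mono)
    show "integrable M (\<lambda>x. (?v x)\<^sup>2)" by (rule L2_spaceD(2)[OF potential_L2[OF bk g z]])
    fix x assume x: "x \<in> space M"
    have "(?v x)\<^sup>2 \<le> energy M P B z g b * P x x"
      using psd_kernel_diag[OF potential_dominated_psd[where z = z and b = b, OF bk fin z g] x] by (simp add: power2_eq_square)
    also have "\<dots> \<le> energy M P B z g b * C"
      by (rule mult_left_mono[OF kernel_diag_le[OF bk x] energy_nonneg[OF bk fin z g]])
    finally show "(?v x)\<^sup>2 \<le> C * energy M P B z g b" by (simp add: mult.commute)
  qed simp
  then show ?thesis by (simp add: prob_space)
qed

text \<open>With \<open>N\<close> the energy of \<open>v\<close>, the Schur product of \<open>Q\<close> with \<open>N * P - v \<otimes> v\<close> is positive semidefinite, and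
  its energy for the density one and point masses \<open>c\<close> is nonnegative.  As \<open>v\<close> vanishes at those points,
  the part with \<open>v \<otimes> v\<close> reduces to the form of \<open>v\<close> under \<open>Q\<close>.  For \<open>c = - 1 / n\<close> the bound is the energy of the
  deviation between the measure and the empirical measure, which is small for a typical sample.\<close>

lemma vanishing_potential_form_le:
  fixes B :: "'i set" and b :: "'i \<Rightarrow> real"
  assumes bk: "bounded_psd_kernel M P C" and bQ: "bounded_psd_kernel M Q C'"
    and fin: "finite B" and z: "\<And>i. i \<in> B \<Longrightarrow> z i \<in> space M"
    and g: "g \<in> L2_space M"
    and sub: "B' \<subseteq> B" and vanish: "\<And>i. i \<in> B' \<Longrightarrow> potential M P g B b z (z i) = 0"
  defines "v \<equiv> potential M P g B b z"
  shows "(\<integral>y. v y * (\<integral>x. v x * Q x y \<partial>M) \<partial>M)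
    \<le> energy M (\<lambda>x y. Q x y * P x y) B' z (\<lambda>_. 1) (\<lambda>_. c) * energy M P B z g b"
proof -
  define N where "N = energy M P B z g b"
  define R where "R x y = Q x y * (N * P x y - v x * v y)" for x y
  have finB': "finite B'" using sub fin by (rule finite_subset)
  have zB': "\<And>i. i \<in> B' \<Longrightarrow> z i \<in> space M" using z sub by auto
  have N0: "N \<ge> 0" unfolding N_def by (rule energy_nonneg[OF bk fin z g])
  have vL2: "v \<in> L2_space M" unfolding v_def by (rule potential_L2[OF bk g z])
  have vm: "v \<in> borel_measurable M" using vL2 by (rule L2_spaceD)
  have one: "(\<lambda>_. 1) \<in> L2_space M" by (rule L2_space_const)
  have psdR: "psd_kernel (space M) R"
    unfolding R_def N_def v_def
    by (rule psd_kernel_mult[OF kernel_psd[OF bQ] potential_dominated_psd[OF bk fin z g]])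
  have C0: "0 \<le> C" "0 \<le> C'" using kernel_bound_nonneg[OF bk] kernel_bound_nonneg[OF bQ] .
  have mP: "(\<lambda>p. P (fst p) (snd p)) \<in> borel_measurable (M \<Otimes>\<^sub>M M)"
    by (intro kernel_measurable[OF bk] measurable_fst measurable_snd)
  have mQ: "(\<lambda>p. Q (fst p) (snd p)) \<in> borel_measurable (M \<Otimes>\<^sub>M M)"
    by (intro kernel_measurable[OF bQ] measurable_fst measurable_snd)
  have mv: "(\<lambda>p. v (fst p)) \<in> borel_measurable (M \<Otimes>\<^sub>M M)" "(\<lambda>p. v (snd p)) \<in> borel_measurable (M \<Otimes>\<^sub>M M)"
    using vm by (auto intro!: measurable_compose[OF measurable_fst] measurable_compose[OF measurable_snd])
  have bR: "bounded_psd_kernel M R (C' * (N * C))"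
    unfolding bounded_psd_kernel_def
  proof (intro conjI ballI psdR)
    show "(\<lambda>(x, y). R x y) \<in> borel_measurable (M \<Otimes>\<^sub>M M)"
      unfolding R_def split_beta'
      by (intro borel_measurable_times borel_measurable_diff borel_measurable_const mP mQ mv)
    fix x assume x: "x \<in> space M"
    have "N * P x x - v x * v x \<le> N * C"
      using mult_left_mono[OF kernel_diag_le[OF bk x] N0] zero_le_square[of "v x"] by linarith
    moreover have "0 \<le> N * P x x - v x * v x"
      using psd_kernel_diag[OF potential_dominated_psd[where z = z and b = b, OF bk fin z g] x] by (simp add: N_def v_def)
    ultimately show "R x x \<le> C' * (N * C)"
      unfolding R_def using kernel_diag_le[OF bQ x] C0 by (intro mult_mono) auto
  qed
  have bS: "bounded_psd_kernel M (\<lambda>x y. Q x y * P x y) (C' * C)"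
    unfolding bounded_psd_kernel_def
  proof (intro conjI ballI psd_kernel_mult kernel_psd[OF bk] kernel_psd[OF bQ])
    show "(\<lambda>(x, y). Q x y * P x y) \<in> borel_measurable (M \<Otimes>\<^sub>M M)"
      unfolding split_beta' by (intro borel_measurable_times mP mQ)
    fix x assume x: "x \<in> space M"
    show "Q x x * P x x \<le> C' * C"
      using kernel_diag_le[OF bQ x] kernel_diag_le[OF bk x] C0
        psd_kernel_diag[OF kernel_psd[OF bk] x] by (intro mult_mono) auto
  qed
  have at_z: "R x (z i) = N * (Q x (z i) * P x (z i))" if "i \<in> B'" for x i
    using vanish[OF that] by (simp add: R_def v_def)
  have iS: "integrable M (\<lambda>x. Q x y * P x y)" if "y \<in> space M" for y
    using integrable_L2[OF kernel_L2_left[OF bS that]] .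
  have iv: "integrable M (\<lambda>x. v x * Q x y)" if "y \<in> space M" for y
    by (rule integrable_L2_mult[OF vL2 kernel_L2_left[OF bQ that]])
  have "(\<integral>y. (\<integral>x. R x y \<partial>M) \<partial>M) = (\<integral>y. N * (\<integral>x. Q x y * P x y \<partial>M) - v y * (\<integral>x. v x * Q x y \<partial>M) \<partial>M)"
  proof (intro Bochner_Integration.integral_cong refl)
    fix y assume y: "y \<in> space M"
    have "(\<integral>x. R x y \<partial>M) = (\<integral>x. N * (Q x y * P x y) - v y * (v x * Q x y) \<partial>M)"
      unfolding R_def by (intro Bochner_Integration.integral_cong refl) (simp add: algebra_simps)
    then show "(\<integral>x. R x y \<partial>M) = N * (\<integral>x. Q x y * P x y \<partial>M) - v y * (\<integral>x. v x * Q x y \<partial>M)"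
      using iS[OF y] iv[OF y] by simp
  qed
  also have "\<dots> = N * (\<integral>y. (\<integral>x. Q x y * P x y \<partial>M) \<partial>M) - (\<integral>y. v y * (\<integral>x. v x * Q x y \<partial>M) \<partial>M)"
    using integrable_L2[OF density_potential_L2[OF bS one]] integrable_L2_mult[OF vL2 density_potential_L2[OF bQ vL2]]
    by simp
  finally have I: "(\<integral>y. (\<integral>x. R x y \<partial>M) \<partial>M) = N * (\<integral>y. (\<integral>x. Q x y * P x y \<partial>M) \<partial>M) - (\<integral>y. v y * (\<integral>x. v x * Q x y \<partial>M) \<partial>M)" .
  have "0 \<le> energy M R B' z (\<lambda>_. 1) (\<lambda>_. c)" by (rule energy_nonneg[OF bR finB' zB' one])
  also have "\<dots> = (\<integral>y. (\<integral>x. R x y \<partial>M) \<partial>M) + 2 * (\<Sum>i\<in>B'. c * (\<integral>x. R x (z i) \<partial>M)) + (\<Sum>i\<in>B'. \<Sum>j\<in>B'. c * c * R (z i) (z j))"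
    using mutual_energy_expand[where z = z and b = "\<lambda>_. c" and b' = "\<lambda>_. c", OF bR finB' zB' one one] by simp
  also have "\<dots> = N * energy M (\<lambda>x y. Q x y * P x y) B' z (\<lambda>_. 1) (\<lambda>_. c) - (\<integral>y. v y * (\<integral>x. v x * Q x y \<partial>M) \<partial>M)"
  proof -
    have S: "energy M (\<lambda>x y. Q x y * P x y) B' z (\<lambda>_. 1) (\<lambda>_. c)
        = (\<integral>y. (\<integral>x. Q x y * P x y \<partial>M) \<partial>M) + 2 * (\<Sum>i\<in>B'. c * (\<integral>x. Q x (z i) * P x (z i) \<partial>M))
          + (\<Sum>i\<in>B'. \<Sum>j\<in>B'. c * c * (Q (z i) (z j) * P (z i) (z j)))"
      using mutual_energy_expand[where z = z and b = "\<lambda>_. c" and b' = "\<lambda>_. c", OF bS finB' zB' one one] by simp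
    show ?thesis
      unfolding S I by (simp add: at_z distrib_left sum_distrib_left mult_ac)
  qed
  finally show ?thesis by (simp add: N_def mult.commute)
qed

end

context kernel_eigensystem
begin

lemma combination_operator_inner:
  assumes F: "finite F" "F \<subseteq> I" and g: "g \<in> L2_space M"
  shows "(\<integral>x. (\<Sum>k\<in>F. c k * e k x) * (\<integral>y. g y * K y x \<partial>M) \<partial>M) = (\<Sum>k\<in>F. c k * (\<mu> k * (\<integral>x. g x * e k x \<partial>M)))"
proof -
  have "(\<integral>x. (\<Sum>k\<in>F. c k * e k x) * (\<integral>y. g y * K y x \<partial>M) \<partial>M)
      = (\<Sum>k\<in>F. c k * (\<integral>x. (\<integral>y. g y * K y x \<partial>M) * e k x \<partial>M))"
    using inner_orthonormal_combination[OF on F density_potential_L2[OF bk g], of c] by (simp only: mult.commute)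
  also have "\<dots> = (\<Sum>k\<in>F. c k * (\<mu> k * (\<integral>x. g x * e k x \<partial>M)))"
  proof (intro sum.cong refl)
    fix k assume "k \<in> F"
    then have "k \<in> I" using F by auto
    then show "c k * (\<integral>x. (\<integral>y. g y * K y x \<partial>M) * e k x \<partial>M) = c k * (\<mu> k * (\<integral>x. g x * e k x \<partial>M))"
      using operator_self_adjoint_eigen[OF _ g] by (simp only: mult.commute)
  qed
  finally show ?thesis .
qed

lemma combination_operator_form:
  assumes F: "finite F" "F \<subseteq> I"
  shows "(\<integral>x. (\<Sum>k\<in>F. c k * e k x) * (\<integral>y. (\<Sum>k\<in>F. c k * e k y) * K y x \<partial>M) \<partial>M) = (\<Sum>k\<in>F. \<mu> k * (c k)\<^sup>2)"
  unfolding combination_operator_inner[OF F orthonormal_combination_L2[OF on F(2)]]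
  using F by (intro sum.cong refl) (auto simp: orthonormal_combination_coefficient[OF on F] power2_eq_square)

context
  fixes B :: "'i set" and z :: "'i \<Rightarrow> 'a" and b :: "'i \<Rightarrow> real" and g :: "'a \<Rightarrow> real"
  assumes fin: "finite B" and z: "\<And>i. i \<in> B \<Longrightarrow> z i \<in> space M" and g: "g \<in> L2_space M"
begin

text \<open>The component of \<open>v\<close> along the large eigenvalues is bounded by the capped form itself, the rest by
  interpolation between the capped form and the energy: its squared norm is its mutual energy with
  \<open>v\<close>, and as a density it has energy at most \<open>lam * q\<close>.\<close>

lemma potential_norm_interpolation:
  assumes lam: "lam > 0"
  defines "v \<equiv> potential M K g B b z"
  defines "q \<equiv> (\<integral>y. v y * (\<integral>x. v x * capped lam x y \<partial>M) \<partial>M)"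
  shows "(\<integral>x. (v x)\<^sup>2 \<partial>M) \<le> q + sqrt (energy M K B z g b * (lam * q))"
proof -
  define N where "N = energy M K B z g b"
  define F where "F = large lam"
  define c where "c k = (\<integral>x. v x * e k x \<partial>M)" for k
  define p where "p x = (\<Sum>k\<in>F. c k * e k x)" for x
  define w where "w x = v x - p x" for x
  have F: "finite F" "F \<subseteq> I" using large_finite[OF lam] large_subset[OF lam] by (auto simp: F_def)
  have vL2: "v \<in> L2_space M" unfolding v_def by (rule potential_L2[OF bk g z])
  have pL2: "p \<in> L2_space M" unfolding p_def by (rule orthonormal_combination_L2[OF on F(2)])
  have wL2: "w \<in> L2_space M" unfolding w_def by (rule L2_space_diff[OF vL2 pL2])
  have N0: "N \<ge> 0" unfolding N_def by (rule energy_nonneg[OF bk fin z g])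
  have w_orth: "(\<integral>x. w x * e k x \<partial>M) = 0" if k: "k \<in> F" for k
  proof -
    have kI: "k \<in> I" using k F by auto
    have "(\<integral>x. w x * e k x \<partial>M) = c k - (\<integral>x. p x * e k x \<partial>M)"
      unfolding w_def c_def left_diff_distrib
      by (rule Bochner_Integration.integral_diff) (intro integrable_L2_mult vL2 pL2 e_L2 kI)+
    then show ?thesis using orthonormal_combination_coefficient[OF on F kI, of c] k by (simp add: p_def)
  qed
  have norm: "(\<integral>x. (w x)\<^sup>2 \<partial>M) = (\<integral>x. (v x)\<^sup>2 \<partial>M) - (\<Sum>k\<in>F. (c k)\<^sup>2)"
    unfolding w_def p_def c_def by (rule projection_residual_norm[OF on F vL2])
  define ww where "ww = (\<integral>x. w x * (\<integral>y. w y * K y x \<partial>M) \<partial>M)"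
  have ww0: "ww \<ge> 0" unfolding ww_def by (rule density_energy_nonneg[OF bk wL2])
  have vv: "(\<integral>x. v x * (\<integral>y. v y * K y x \<partial>M) \<partial>M) = ww + (\<Sum>k\<in>F. \<mu> k * (c k)\<^sup>2)"
  proof -
    let ?u = "undefined :: unit \<Rightarrow> 'a" and ?o = "\<lambda>_::unit. 0::real"
    have sum: "(\<lambda>x. w x + 1 * p x) = v" by (simp add: w_def)
    have "energy M K {} ?u (\<lambda>x. w x + 1 * p x) (\<lambda>i. ?o i + 1 * ?o i)
        = energy M K {} ?u w ?o + 2 * 1 * mutual_energy M K {} ?u w ?o p ?o + 1\<^sup>2 * energy M K {} ?u p ?o"
      by (rule energy_add[OF bk _ _ wL2 pL2]) auto
    then have "energy M K {} ?u v ?o = energy M K {} ?u w ?o + 2 * mutual_energy M K {} ?u w ?o p ?o + energy M K {} ?u p ?o"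
      unfolding sum by simp
    moreover have "mutual_energy M K {} ?u w ?o p ?o = 0"
    proof -
      have "mutual_energy M K {} ?u w ?o p ?o = (\<integral>x. p x * (\<integral>y. w y * K y x \<partial>M) \<partial>M)"
        by (simp add: mutual_energy_def potential_def)
      also have "\<dots> = (\<Sum>k\<in>F. c k * (\<mu> k * (\<integral>x. w x * e k x \<partial>M)))"
        unfolding p_def by (rule combination_operator_inner[OF F wL2])
      also have "\<dots> = 0" by (intro sum.neutral) (simp add: w_orth)
      finally show ?thesis .
    qed
    moreover have "energy M K {} ?u p ?o = (\<Sum>k\<in>F. \<mu> k * (c k)\<^sup>2)"
      unfolding energy_density p_def by (rule combination_operator_form[OF F])
    ultimately show ?thesis unfolding energy_density ww_def by linarith
  qed
  have q: "lam * q = ww + lam * (\<Sum>k\<in>F. (c k)\<^sup>2)"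
  proof -
    have inner: "(\<integral>x. v x * capped lam x y \<partial>M)
        = ((\<integral>x. v x * K x y \<partial>M) - (\<Sum>k\<in>F. (\<mu> k - lam) * c k * eigfun k y)) / lam" if y: "y \<in> space M" for y
    proof -
      have iE: "integrable M (\<lambda>x. v x * eigfun k x)" if "k \<in> F" for k
        using that F by (intro integrable_L2_mult vL2 eigfun_L2) auto
      have E: "(\<integral>x. v x * eigfun k x \<partial>M) = c k" if "k \<in> F" for k
        unfolding c_def using that F large_pos[OF lam, of k] by (intro inner_eigfun vL2) (auto simp: F_def)
      have "(\<integral>x. v x * capped lam x y \<partial>M)
          = (\<integral>x. (v x * K x y - (\<Sum>k\<in>F. ((\<mu> k - lam) * eigfun k y) * (v x * eigfun k x))) / lam \<partial>M)"
        unfolding capped_def[OF lam] F_def[symmetric]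
        by (intro Bochner_Integration.integral_cong refl)
          (simp only: times_divide_eq_right right_diff_distrib[of "v _" "K _ _"] sum_distrib_left mult_ac)
      also have "\<dots> = ((\<integral>x. v x * K x y \<partial>M) - (\<Sum>k\<in>F. ((\<mu> k - lam) * eigfun k y) * (\<integral>x. v x * eigfun k x \<partial>M))) / lam"
        using iE integrable_L2_mult[OF vL2 kernel_L2_left[OF bk y]]
        by (simp add: Bochner_Integration.integral_sum Bochner_Integration.integrable_sum)
      also have "(\<Sum>k\<in>F. ((\<mu> k - lam) * eigfun k y) * (\<integral>x. v x * eigfun k x \<partial>M)) = (\<Sum>k\<in>F. (\<mu> k - lam) * c k * eigfun k y)"
        by (intro sum.cong refl) (simp add: E mult_ac)
      finally show ?thesis .
    qed
    have iE: "integrable M (\<lambda>y. v y * eigfun k y)" if "k \<in> F" for k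
      using that F by (intro integrable_L2_mult vL2 eigfun_L2) auto
    have E: "(\<integral>y. v y * eigfun k y \<partial>M) = c k" if "k \<in> F" for k
      unfolding c_def using that F large_pos[OF lam, of k] by (intro inner_eigfun vL2) (auto simp: F_def)
    have "q = (\<integral>y. (v y * (\<integral>x. v x * K x y \<partial>M) - (\<Sum>k\<in>F. ((\<mu> k - lam) * c k) * (v y * eigfun k y))) / lam \<partial>M)"
      unfolding q_def
    proof (intro Bochner_Integration.integral_cong refl)
      fix y assume "y \<in> space M"
      from inner[OF this]
      show "v y * (\<integral>x. v x * capped lam x y \<partial>M) = (v y * (\<integral>x. v x * K x y \<partial>M) - (\<Sum>k\<in>F. ((\<mu> k - lam) * c k) * (v y * eigfun k y))) / lam"
        by (simp only: times_divide_eq_right right_diff_distrib[of "v _" "\<integral>x. _ x \<partial>M"] sum_distrib_left mult_ac)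
    qed
    also have "\<dots> = ((\<integral>y. v y * (\<integral>x. v x * K x y \<partial>M) \<partial>M) - (\<Sum>k\<in>F. ((\<mu> k - lam) * c k) * (\<integral>y. v y * eigfun k y \<partial>M))) / lam"
      using iE integrable_L2_mult[OF vL2 density_potential_L2[OF bk vL2]]
      by (simp add: Bochner_Integration.integral_sum Bochner_Integration.integrable_sum)
    also have "(\<Sum>k\<in>F. ((\<mu> k - lam) * c k) * (\<integral>y. v y * eigfun k y \<partial>M)) = (\<Sum>k\<in>F. \<mu> k * (c k)\<^sup>2) - lam * (\<Sum>k\<in>F. (c k)\<^sup>2)"
      unfolding sum_distrib_left sum_subtractf[symmetric]
      by (intro sum.cong refl) (simp add: E left_diff_distrib power2_eq_square mult.assoc)
    finally show ?thesis unfolding vv using lam by simp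
  qed
  have q0: "q \<ge> 0" unfolding q_def by (rule density_energy_nonneg[OF capped_bounded[OF lam] vL2])
  have "(\<integral>x. w x * v x \<partial>M) = (\<integral>x. (w x)\<^sup>2 \<partial>M)"
  proof -
    have "(\<integral>x. w x * v x \<partial>M) = (\<integral>x. (w x)\<^sup>2 + w x * p x \<partial>M)"
      by (intro Bochner_Integration.integral_cong refl) (simp add: w_def power2_eq_square algebra_simps)
    also have "\<dots> = (\<integral>x. (w x)\<^sup>2 \<partial>M) + (\<integral>x. w x * p x \<partial>M)"
      by (intro Bochner_Integration.integral_add integrable_L2_mult wL2 pL2 L2_spaceD(2))
    also have "(\<integral>x. w x * p x \<partial>M) = 0"
      unfolding p_def inner_orthonormal_combination[OF on F wL2] by (intro sum.neutral) (simp add: w_orth)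
    finally show ?thesis by simp
  qed
  moreover have "(mutual_energy M K B z g b w (\<lambda>_. 0))\<^sup>2 \<le> N * energy M K B z w (\<lambda>_. 0)"
    unfolding N_def by (rule mutual_energy_Cauchy_Schwarz[OF bk fin z g wL2])
  ultimately have "(\<integral>x. (w x)\<^sup>2 \<partial>M)\<^sup>2 \<le> N * ww"
    unfolding energy_density unfolding mutual_energy_density ww_def v_def by simp
  also have "\<dots> \<le> N * (lam * q)"
  proof (rule mult_left_mono[OF _ N0])
    have "0 \<le> lam * (\<Sum>k\<in>F. (c k)\<^sup>2)" using lam by (simp add: sum_nonneg)
    then show "ww \<le> lam * q" unfolding q by linarith
  qed
  finally have "(\<integral>x. (w x)\<^sup>2 \<partial>M) \<le> sqrt (N * (lam * q))"
    by (simp add: real_le_rsqrt)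
  moreover have "(\<Sum>k\<in>F. (c k)\<^sup>2) \<le> q"
  proof -
    have "lam * (\<Sum>k\<in>F. (c k)\<^sup>2) \<le> lam * q" unfolding q using ww0 by simp
    then show ?thesis using lam by simp
  qed
  ultimately show ?thesis using norm by (simp add: N_def)
qed

text \<open>The capped form of \<open>v\<close> is at most \<open>2 * lam\<close> times its energy, and the interpolation inequality turns
  this into the same order for the norm.\<close>

theorem vanishing_potential_norm_le:
  assumes lam: "lam > 0" and sub: "B' \<subseteq> B"
    and vanish: "\<And>i. i \<in> B' \<Longrightarrow> potential M K g B b z (z i) = 0"
    and dev: "energy M (\<lambda>x y. capped lam x y * K x y) B' z (\<lambda>_. 1) (\<lambda>_. c) \<le> 2 * lam"
  shows "(\<integral>x. (potential M K g B b z x)\<^sup>2 \<partial>M) \<le> 4 * lam * energy M K B z g b"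
proof -
  let ?v = "potential M K g B b z"
  define N where "N = energy M K B z g b"
  define q where "q = (\<integral>y. ?v y * (\<integral>x. ?v x * capped lam x y \<partial>M) \<partial>M)"
  have N0: "N \<ge> 0" unfolding N_def by (rule energy_nonneg[OF bk fin z g])
  have "q \<le> energy M (\<lambda>x y. capped lam x y * K x y) B' z (\<lambda>_. 1) (\<lambda>_. c) * N"
    unfolding q_def N_def
    by (rule vanishing_potential_form_le[OF bk capped_bounded[OF lam] fin z g sub vanish])
  also have "\<dots> \<le> 2 * lam * N" by (rule mult_right_mono[OF dev N0])
  finally have q: "q \<le> 2 * lam * N" .
  have "sqrt (N * (lam * q)) \<le> 2 * lam * N"
  proof (rule real_le_lsqrt)
    have "N * (lam * q) \<le> N * (lam * (2 * lam * N))"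
      using lam N0 q by (intro mult_left_mono) auto
    also have "\<dots> = 2 * (lam * N)\<^sup>2" by (simp add: power2_eq_square)
    also have "\<dots> \<le> 4 * (lam * N)\<^sup>2" by simp
    also have "\<dots> = (2 * lam * N)\<^sup>2" by (simp add: power2_eq_square)
    finally show "N * (lam * q) \<le> (2 * lam * N)\<^sup>2" .
  qed (use lam N0 in auto)
  then show ?thesis
    using potential_norm_interpolation[OF lam, folded q_def] q by (simp add: N_def)
qed

end

end

lemma energy_cong:
  assumes "\<And>i. i \<in> B \<Longrightarrow> z i = z' i" "\<And>i. i \<in> B \<Longrightarrow> b i = b' i"
  shows "energy M P B z g b = energy M P B z' g b'"
proof -
  have "potential M P g B b z = potential M P g B b' z'"
    unfolding potential_def[abs_def] using assms by (auto intro!: ext sum.cong)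
  then show ?thesis
    unfolding mutual_energy_def using assms by (simp cong: sum.cong)
qed

section \<open>Error bounds under a source condition\<close>

context kernel_eigensystem
begin

context
  fixes B :: "'i set" and z :: "'i \<Rightarrow> 'a" and b :: "'i \<Rightarrow> real" and g :: "'a \<Rightarrow> real"
  assumes fin: "finite B" and z: "\<And>i. i \<in> B \<Longrightarrow> z i \<in> space M" and g: "g \<in> L2_space M"
    and vanish: "\<And>i. i \<in> B \<Longrightarrow> potential M K g B b z (z i) = 0"
begin

lemma energy_of_vanishing: "energy M K B z g b = (\<integral>x. g x * potential M K g B b z x \<partial>M)"
  unfolding mutual_energy_def by (simp add: vanish)

text \<open>The residual of the interpolation is orthogonal to all combinations of the kernel sections, so no
  other choice of the coefficients has a smaller energy.\<close>

lemma vanishing_energy_minimal: "energy M K B z g b \<le> energy M K B z g b'"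
proof -
  have "energy M K B z (\<lambda>x. g x + 1 * 0) (\<lambda>i. b i + 1 * (b' i - b i))
      = energy M K B z g b + 2 * 1 * mutual_energy M K B z g b (\<lambda>_. 0) (\<lambda>i. b' i - b i)
        + 1\<^sup>2 * energy M K B z (\<lambda>_. 0) (\<lambda>i. b' i - b i)"
    by (rule energy_add[OF bk fin z g L2_space_const])
  moreover have "mutual_energy M K B z g b (\<lambda>_. 0) (\<lambda>i. b' i - b i) = 0"
    unfolding mutual_energy_def by (simp add: vanish)
  moreover have "0 \<le> energy M K B z (\<lambda>_. 0) (\<lambda>i. b' i - b i)"
    by (rule energy_nonneg[OF bk fin z L2_space_const])
  ultimately show ?thesis by simp
qed

end

text \<open>The Cauchy-Schwarz inequality for the mutual energy of \<open>v\<close> with the combination of eigenfunctions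
  whose coefficients are those of \<open>v\<close> divided by the eigenvalues.\<close>

lemma sum_coefficients_over_eigenvalues_le:
  fixes B :: "'i set" and b :: "'i \<Rightarrow> real"
  assumes fin: "finite B" and z: "\<And>i. i \<in> B \<Longrightarrow> z i \<in> space M" and g: "g \<in> L2_space M"
    and F: "finite F" "F \<subseteq> I" and pos: "\<And>k. k \<in> F \<Longrightarrow> \<mu> k > 0"
  defines "v \<equiv> potential M K g B b z"
  shows "(\<Sum>k\<in>F. (\<integral>x. v x * e k x \<partial>M)\<^sup>2 / \<mu> k) \<le> energy M K B z g b"
proof -
  define c where "c k = (\<integral>x. v x * e k x \<partial>M) / \<mu> k" for k
  define p where "p x = (\<Sum>k\<in>F. c k * e k x)" for x
  define s where "s = (\<Sum>k\<in>F. (\<integral>x. v x * e k x \<partial>M)\<^sup>2 / \<mu> k)"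
  have vL2: "v \<in> L2_space M" unfolding v_def by (rule potential_L2[OF bk g z])
  have pL2: "p \<in> L2_space M" unfolding p_def by (rule orthonormal_combination_L2[OF on F(2)])
  have "(mutual_energy M K B z g b p (\<lambda>_. 0))\<^sup>2 \<le> energy M K B z g b * energy M K B z p (\<lambda>_. 0)"
    by (rule mutual_energy_Cauchy_Schwarz[OF bk fin z g pL2])
  also have "energy M K B z p (\<lambda>_. 0) = s"
    unfolding energy_density p_def combination_operator_form[OF F] s_def
  proof (intro sum.cong refl)
    fix k assume "k \<in> F"
    then show "\<mu> k * (c k)\<^sup>2 = (\<integral>x. v x * e k x \<partial>M)\<^sup>2 / \<mu> k"
      using pos[of k] by (simp add: c_def power2_eq_square)
  qed
  also have "mutual_energy M K B z g b p (\<lambda>_. 0) = (\<integral>x. v x * p x \<partial>M)"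
    unfolding mutual_energy_density v_def by (simp only: mult.commute)
  also have "\<dots> = s"
    unfolding p_def inner_orthonormal_combination[OF on F vL2] s_def c_def
    by (intro sum.cong refl) (simp add: power2_eq_square)
  finally have s2: "s * s \<le> energy M K B z g b * s" by (simp add: power2_eq_square)
  have "0 \<le> s" unfolding s_def using pos by (intro sum_nonneg) (simp add: less_imp_le)
  then have "s \<le> energy M K B z g b"
    using s2 energy_nonneg[where b = b, OF bk fin z g] by (cases "s = 0") auto
  then show ?thesis by (simp add: s_def)
qed

text \<open>If the squared \<open>L\<^sup>2\<close> norm of the residual is at most \<open>L\<close> times its energy, then the source condition
  improves the order to \<open>L powr (2 * r)\<close>: the energy equals the pairing of the residual with the
  source, whose weights \<open>\<mu> k powr (r - 1)\<close> are split by
  \<open>\<mu> powr - \<theta> \<le> L powr - \<theta> * (1 + L / \<mu>)\<close> between the norm and the energy.\<close>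

theorem source_condition_low:
  fixes B :: "'i set" and b :: "'i \<Rightarrow> real" and h :: "nat \<Rightarrow> real"
  assumes fin: "finite B" and z: "\<And>i. i \<in> B \<Longrightarrow> z i \<in> space M"
    and F: "finite F" "F \<subseteq> I" and pos: "\<And>k. k \<in> F \<Longrightarrow> \<mu> k > 0"
    and r: "1 / 2 \<le> r" "r \<le> 1" and L: "L > 0"
  defines "g \<equiv> \<lambda>x. \<Sum>k\<in>F. (\<mu> k powr (r - 1) * h k) * e k x"
  assumes vanish: "\<And>i. i \<in> B \<Longrightarrow> potential M K g B b z (z i) = 0"
    and V: "(\<integral>x. (potential M K g B b z x)\<^sup>2 \<partial>M) \<le> L * energy M K B z g b"
  shows "(\<integral>x. (potential M K g B b z x)\<^sup>2 \<partial>M) \<le> 2 * (\<Sum>k\<in>F. (h k)\<^sup>2) * L powr (2 * r)"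
proof -
  define v where "v = potential M K g B b z"
  define N where "N = energy M K B z g b"
  define c where "c k = (\<integral>x. v x * e k x \<partial>M)" for k
  define \<theta> where "\<theta> = 2 - 2 * r"
  define H where "H = (\<Sum>k\<in>F. (h k)\<^sup>2)"
  have gL2: "g \<in> L2_space M" unfolding g_def by (rule orthonormal_combination_L2[OF on F(2)])
  have vL2: "v \<in> L2_space M" unfolding v_def by (rule potential_L2[OF bk gL2 z])
  have N0: "N \<ge> 0" unfolding N_def by (rule energy_nonneg[OF bk fin z gL2])
  have H0: "H \<ge> 0" unfolding H_def by (intro sum_nonneg) simp
  have "N = (\<integral>x. g x * v x \<partial>M)"
    unfolding N_def v_def by (rule energy_of_vanishing[OF fin z gL2 vanish])
  then have "N = (\<integral>x. v x * g x \<partial>M)" by (simp only: mult.commute)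
  also have "\<dots> = (\<Sum>k\<in>F. h k * (\<mu> k powr (r - 1) * c k))"
    unfolding g_def inner_orthonormal_combination[OF on F vL2] c_def by (intro sum.cong refl) (simp add: mult_ac)
  finally have "N\<^sup>2 \<le> H * (\<Sum>k\<in>F. (\<mu> k powr (r - 1) * c k)\<^sup>2)"
    unfolding H_def by (simp only: Cauchy_Schwarz_ineq_sum)
  also have "(\<Sum>k\<in>F. (\<mu> k powr (r - 1) * c k)\<^sup>2) \<le> (\<Sum>k\<in>F. L powr - \<theta> * ((c k)\<^sup>2 + L * ((c k)\<^sup>2 / \<mu> k)))"
  proof (rule sum_mono)
    fix k assume k: "k \<in> F"
    have m: "\<mu> k > 0" by (rule pos[OF k])
    have "(\<mu> k powr (r - 1))\<^sup>2 = \<mu> k powr - \<theta>"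
      using m by (simp add: \<theta>_def power2_eq_square powr_add[symmetric])
    also have "\<dots> = L powr - \<theta> * (L / \<mu> k) powr \<theta>"
      using m L by (simp add: powr_divide powr_minus field_simps)
    also have "\<dots> \<le> L powr - \<theta> * (1 + L / \<mu> k)"
    proof (rule mult_left_mono)
      have t: "L / \<mu> k > 0" using m L by simp
      have \<theta>: "0 \<le> \<theta>" "\<theta> \<le> 1" using r by (auto simp: \<theta>_def)
      show "(L / \<mu> k) powr \<theta> \<le> 1 + L / \<mu> k"
      proof (cases "L / \<mu> k \<le> 1")
        case True
        then have "(L / \<mu> k) powr \<theta> \<le> 1" using t \<theta> by (intro powr_le1) auto
        then show ?thesis using t by linarith
      next
        case False
        then have "(L / \<mu> k) powr \<theta> \<le> (L / \<mu> k) powr 1" using \<theta> by (intro powr_mono) auto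
        then show ?thesis using t by simp
      qed
    qed simp
    finally have "(\<mu> k powr (r - 1))\<^sup>2 * (c k)\<^sup>2 \<le> L powr - \<theta> * (1 + L / \<mu> k) * (c k)\<^sup>2"
      by (rule mult_right_mono) simp
    then show "(\<mu> k powr (r - 1) * c k)\<^sup>2 \<le> L powr - \<theta> * ((c k)\<^sup>2 + L * ((c k)\<^sup>2 / \<mu> k))"
      by (simp add: power_mult_distrib algebra_simps)
  qed
  also have "\<dots> = L powr - \<theta> * ((\<Sum>k\<in>F. (c k)\<^sup>2) + L * (\<Sum>k\<in>F. (c k)\<^sup>2 / \<mu> k))"
    by (simp only: sum_distrib_left sum.distrib distrib_left)
  also have "\<dots> \<le> L powr - \<theta> * (L * N + L * N)"
  proof (intro mult_left_mono add_mono)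
    show "(\<Sum>k\<in>F. (c k)\<^sup>2) \<le> L * N"
      using Bessel_inequality[OF on F vL2] V unfolding c_def N_def v_def by linarith
    show "(\<Sum>k\<in>F. (c k)\<^sup>2 / \<mu> k) \<le> N"
      unfolding c_def N_def v_def by (rule sum_coefficients_over_eigenvalues_le[OF fin z gL2 F pos])
  qed (use L in auto)
  finally have N2: "N\<^sup>2 \<le> H * (L powr - \<theta> * (L * N + L * N))"
    using H0 by (simp add: mult_left_mono)
  have "N \<le> 2 * H * (L powr - \<theta> * L)"
  proof (cases "N = 0")
    case True
    then show ?thesis using H0 L by simp
  next
    case False
    then have "N > 0" using N0 by simp
    moreover have "N * N \<le> (2 * H * (L powr - \<theta> * L)) * N"
      using N2 by (simp add: power2_eq_square algebra_simps)
    ultimately show ?thesis by (rule mult_right_le_imp_le[rotated])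
  qed
  then have "L * N \<le> L * (2 * H * (L powr - \<theta> * L))" using L by (intro mult_left_mono) auto
  also have "\<dots> = 2 * H * (L powr 1 * L powr - \<theta> * L powr 1)" using L by simp
  also have "\<dots> = 2 * H * L powr (2 * r)"
    unfolding powr_add[symmetric] by (simp add: \<theta>_def)
  finally show ?thesis using V by (simp add: N_def H_def)
qed

lemma source_energy_le:
  assumes F: "finite F" "F \<subseteq> I" and pos: "\<And>k. k \<in> F \<Longrightarrow> \<mu> k > 0" and r: "1 / 2 \<le> r"
  shows "energy M K B z (\<lambda>x. \<Sum>k\<in>F. (\<mu> k powr (r - 1) * h k) * e k x) (\<lambda>_. 0) \<le> C powr (2 * r - 1) * (\<Sum>k\<in>F. (h k)\<^sup>2)"
proof -
  have "energy M K B z (\<lambda>x. \<Sum>k\<in>F. (\<mu> k powr (r - 1) * h k) * e k x) (\<lambda>_. 0)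
      = (\<Sum>k\<in>F. \<mu> k powr (2 * r - 1) * (h k)\<^sup>2)"
    unfolding energy_density combination_operator_form[OF F]
  proof (intro sum.cong refl)
    fix k assume "k \<in> F"
    then have "\<mu> k powr 1 * (\<mu> k powr (r - 1) * \<mu> k powr (r - 1)) = \<mu> k powr (2 * r - 1)" "\<mu> k powr 1 = \<mu> k"
      using pos[of k] by (simp_all only: powr_add[symmetric]) (simp_all add: field_simps)
    then show "\<mu> k * (\<mu> k powr (r - 1) * h k)\<^sup>2 = \<mu> k powr (2 * r - 1) * (h k)\<^sup>2"
      by (simp add: power2_eq_square mult_ac)
  qed
  also have "\<dots> \<le> (\<Sum>k\<in>F. C powr (2 * r - 1) * (h k)\<^sup>2)"
    using F pos r by (intro sum_mono mult_right_mono powr_mono2 eigenvalue_le) (auto simp: less_imp_le)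
  finally show ?thesis by (simp add: sum_distrib_left)
qed

lemma source_norm_le:
  assumes F: "finite F" "F \<subseteq> I" and pos: "\<And>k. k \<in> F \<Longrightarrow> \<mu> k > 0" and r: "1 \<le> r"
  shows "(\<integral>x. (\<Sum>k\<in>F. (\<mu> k powr (r - 1) * h k) * e k x)\<^sup>2 \<partial>M) \<le> C powr (2 * r - 2) * (\<Sum>k\<in>F. (h k)\<^sup>2)"
proof -
  have "(\<integral>x. (\<Sum>k\<in>F. (\<mu> k powr (r - 1) * h k) * e k x)\<^sup>2 \<partial>M) = (\<Sum>k\<in>F. \<mu> k powr (2 * r - 2) * (h k)\<^sup>2)"
    unfolding orthonormal_combination_norm[OF on F]
    by (intro sum.cong refl) (simp add: power_mult_distrib power2_eq_square powr_add[symmetric])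
  also have "\<dots> \<le> (\<Sum>k\<in>F. C powr (2 * r - 2) * (h k)\<^sup>2)"
    using F pos r by (intro sum_mono mult_right_mono powr_mono2 eigenvalue_le) (auto simp: less_imp_le)
  finally show ?thesis by (simp add: sum_distrib_left)
qed

lemma energy_add_le:
  fixes B :: "'i set"
  assumes fin: "finite B" and z: "\<And>i. i \<in> B \<Longrightarrow> z i \<in> space M" and g: "g \<in> L2_space M" and g': "g' \<in> L2_space M"
  shows "energy M K B z (\<lambda>x. g x + g' x) b \<le> 2 * energy M K B z g b + 2 * energy M K B z g' (\<lambda>_. 0)"
proof -
  have p: "energy M K B z (\<lambda>x. g x + t * g' x) b
      = energy M K B z g b + 2 * t * mutual_energy M K B z g b g' (\<lambda>_. 0) + t\<^sup>2 * energy M K B z g' (\<lambda>_. 0)" for t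
    using energy_add[where t = t and b = b and b' = "\<lambda>_. 0", OF bk fin z g g'] by simp
  have "0 \<le> energy M K B z (\<lambda>x. g x + (-1) * g' x) b"
    by (intro energy_nonneg[OF bk fin z] L2_space_add L2_space_scale g g')
  then show ?thesis using p[of 1] p[of "-1"] by simp
qed

section \<open>The events on which the sample is good\<close>

text \<open>The scale is the smallest \<open>C / 2 ^ j\<close> that is at least \<open>C / n\<close> and satisfies the upper bound of the
  dimension.  At half of it one of these two conditions fails, which is the alternative.  Dyadic
  fractions replace the solution of the equation \<open>dimension lam = n * lam / C\<close> at the cost of a factor two.\<close>

lemma dimension_scale_choice:
  assumes C: "C > 0" and n: "n \<ge> (1 :: real)"
  obtains lam where "lam > 0" "dimension lam \<le> n * lam / C"
    "n * lam \<le> 2 * C \<or> (C \<le> n * (lam / 2) \<and> n * (lam / 2) / C < dimension (lam / 2))"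
proof -
  define good where "good j \<longleftrightarrow> 2 ^ j \<le> n \<and> dimension (C / 2 ^ j) \<le> n / 2 ^ j" for j :: nat
  have "dimension (C / 2 ^ 0) \<le> 1" using dimension_le[of C] C by simp
  then have "good 0" using n by (simp add: good_def)
  moreover have "j \<le> nat \<lceil>n\<rceil>" if "good j" for j
  proof -
    have "real j < 2 ^ j" by (rule of_nat_less_two_power)
    also have "2 ^ j \<le> n" using that by (simp add: good_def)
    finally show ?thesis by linarith
  qed
  ultimately obtain j where j: "good j" "\<And>i. good i \<Longrightarrow> i \<le> j"
    using GreatestI_nat[of good 0 "nat \<lceil>n\<rceil>"] Greatest_le_nat[of good _ "nat \<lceil>n\<rceil>"] by blast
  define lam where "lam = C / 2 ^ j"
  have half: "lam / 2 = C / 2 ^ Suc j" by (simp add: lam_def)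
  have "\<not> good (Suc j)" using j(2)[of "Suc j"] by auto
  then have "n < 2 ^ Suc j \<or> (2 ^ Suc j \<le> n \<and> n / 2 ^ Suc j < dimension (lam / 2))"
    unfolding good_def half by linarith
  moreover have "n * lam \<le> 2 * C" if "n < 2 ^ Suc j"
  proof -
    have "n * lam \<le> 2 ^ Suc j * lam" using that C by (intro mult_right_mono) (auto simp: lam_def)
    then show ?thesis by (simp add: lam_def)
  qed
  moreover have "C \<le> n * (lam / 2)" if "2 ^ Suc j \<le> n"
  proof -
    have "2 ^ Suc j * (lam / 2) \<le> n * (lam / 2)" using that C by (intro mult_right_mono) (auto simp: lam_def)
    then show ?thesis by (simp add: lam_def)
  qed
  moreover have "n * (lam / 2) / C = n / 2 ^ Suc j" using C by (simp add: lam_def)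
  ultimately have "n * lam \<le> 2 * C \<or> (C \<le> n * (lam / 2) \<and> n * (lam / 2) / C < dimension (lam / 2))"
    by auto
  moreover have "dimension lam \<le> n * lam / C" using j(1) C by (simp add: good_def lam_def)
  moreover have "lam > 0" using C by (simp add: lam_def)
  ultimately show thesis by (intro that)
qed

context
  fixes lam :: real
  assumes lam: "lam > 0"
begin

text \<open>To be useful, \<open>effective_dimension_lower_bound\<close> needs the trace of the capped kernel matrix from below
  and its Frobenius norm from above; a bound for the sum of these two terms gives both.\<close>

definition trace_statistic :: "'i set \<Rightarrow> ('i \<Rightarrow> 'a) \<Rightarrow> real" where
  "trace_statistic B x = ((\<Sum>i\<in>B. capped lam (x i) (x i)) - real (card B) * dimension lam)\<^sup>2
    + (\<Sum>i\<in>B. \<Sum>j\<in>B. (capped lam (x i) (x j))\<^sup>2)"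

lemma dimension_nonneg: "0 \<le> dimension lam"
  unfolding dimension_def[OF lam]
  using psd_kernel_diag[OF capped_psd[OF lam]] by (intro integral_nonneg_AE AE_I2) auto

lemma capped_diag_square:
  "integrable M (\<lambda>x. (capped lam x x)\<^sup>2)"
  "(\<integral>x. (capped lam x x)\<^sup>2 \<partial>M) \<le> C / lam * dimension lam"
proof -
  have m: "(\<lambda>x. capped lam x x) \<in> borel_measurable M"
    by (rule borel_measurable_integrable[OF capped_diag_integrable[OF lam]])
  have b: "\<bar>capped lam x x\<bar> \<le> C / lam" if "x \<in> space M" for x
    by (rule kernel_abs_le[OF capped_bounded[OF lam] that that])
  show i: "integrable M (\<lambda>x. (capped lam x x)\<^sup>2)"
    by (rule L2_spaceD(2)[OF L2_space_bounded[OF m b]])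
  have "(\<integral>x. (capped lam x x)\<^sup>2 \<partial>M) \<le> (\<integral>x. C / lam * capped lam x x \<partial>M)"
  proof (rule integral_mono[OF i])
    show "integrable M (\<lambda>x. C / lam * capped lam x x)" using capped_diag_integrable[OF lam] by simp
    fix x assume x: "x \<in> space M"
    show "(capped lam x x)\<^sup>2 \<le> C / lam * capped lam x x"
      unfolding power2_eq_square using b[OF x] psd_kernel_diag[OF capped_psd[OF lam] x]
      by (intro mult_right_mono) auto
  qed
  then show "(\<integral>x. (capped lam x x)\<^sup>2 \<partial>M) \<le> C / lam * dimension lam"
    by (simp add: dimension_def[OF lam])
qed

text \<open>The trace is a sum of \<open>n\<close> independent terms, and the variance of each is at most
  \<open>C / lam * dimension lam\<close>.  In the Frobenius norm a pair of distinct points contributes at most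
  \<open>dimension lam\<close>, since the square integral of a row of the capped kernel is at most its diagonal entry,
  and a repeated point at most \<open>C / lam * dimension lam\<close>.  The assumption on \<open>n\<close> says that \<open>C / lam \<le> n\<close>.\<close>

lemma expected_trace_statistic:
  fixes B :: "'i set"
  assumes B: "finite B" "B \<noteq> {}" "B \<subseteq> U" and n: "C \<le> real (card B) * lam"
  shows "integrable (PiM U (\<lambda>_. M)) (trace_statistic B)"
    and "(\<integral>x. trace_statistic B x \<partial>PiM U (\<lambda>_. M)) \<le> 3 * (real (card B))\<^sup>2 * dimension lam"
proof -
  define D where "D = dimension lam"
  define n where "n = real (card B)"
  define d where "d x = capped lam x x - D" for x
  define w where "w x y = d x * d y" for x y
  have npos: "n > 0" using B by (simp add: n_def card_gt_0_iff)
  have D0: "D \<ge> 0" using dimension_nonneg by (simp add: D_def)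
  have CD: "C / lam * D \<le> n * D"
    using n lam D0 by (intro mult_right_mono) (simp_all add: n_def pos_divide_le_eq)
  have dd: "integrable M (\<lambda>x. w x x)" "(\<integral>x. w x x \<partial>M) \<le> n * D"
  proof -
    have e: "(\<lambda>x. w x x) = (\<lambda>x. (capped lam x x)\<^sup>2 - 2 * D * capped lam x x + D\<^sup>2)"
      by (simp add: fun_eq_iff w_def d_def power2_eq_square algebra_simps)
    show "integrable M (\<lambda>x. w x x)"
      unfolding e using capped_diag_square(1) capped_diag_integrable[OF lam] by simp
    have "(\<integral>x. w x x \<partial>M) = (\<integral>x. (capped lam x x)\<^sup>2 \<partial>M) - 2 * D * D + D\<^sup>2"
      unfolding e using capped_diag_square(1) capped_diag_integrable[OF lam]
      by (simp add: prob_space D_def dimension_def[OF lam])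
    also have "\<dots> \<le> (\<integral>x. (capped lam x x)\<^sup>2 \<partial>M)" by (simp add: power2_eq_square)
    also have "\<dots> \<le> n * D" using capped_diag_square(2) CD by (simp add: D_def)
    finally show "(\<integral>x. w x x \<partial>M) \<le> n * D" .
  qed
  have di: "integrable M d" unfolding d_def[abs_def] using capped_diag_integrable[OF lam] by simp
  have Id: "(\<integral>x. d x \<partial>M) = 0"
    unfolding d_def using capped_diag_integrable[OF lam] by (simp add: prob_space D_def dimension_def[OF lam])
  have dL2: "d \<in> L2_space M"
    unfolding d_def[abs_def]
    by (intro L2_space_diff L2_space_const L2_space_bounded[where C = "C / lam"] kernel_abs_le[OF capped_bounded[OF lam]]
      borel_measurable_integrable[OF capped_diag_integrable[OF lam]])
  have one: "bounded_psd_kernel M (\<lambda>_ _. 1) 1"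
    using psd_kernel_rank_one[of "space M" "\<lambda>_. 1"] by (simp add: bounded_psd_kernel_def)
  have wi: "integrable (M \<Otimes>\<^sub>M M) (\<lambda>(x, y). w x y)"
    using integrable_kernel_pair[OF one dL2 dL2] by (simp add: w_def)
  have Iw: "(\<integral>p. (\<lambda>(x, y). w x y) p \<partial>(M \<Otimes>\<^sub>M M)) = 0"
    using integral_kernel_pair[OF one dL2 dL2] by (simp add: w_def Id)
  note S1 = sample_double_sum[OF B(1) B(3) wi dd(1)]
  note S2 = sample_double_sum[OF B(1) B(3) capped_pair_square_le(1)[OF lam] capped_diag_square(1)]
  have eq: "trace_statistic B = (\<lambda>x. (\<Sum>i\<in>B. \<Sum>j\<in>B. w (x i) (x j)) + (\<Sum>i\<in>B. \<Sum>j\<in>B. (capped lam (x i) (x j))\<^sup>2))"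
  proof (rule ext)
    fix x
    have "(\<Sum>i\<in>B. capped lam (x i) (x i)) - real (card B) * dimension lam = (\<Sum>i\<in>B. d (x i))"
      by (simp add: d_def sum_subtractf D_def)
    then show "trace_statistic B x = (\<Sum>i\<in>B. \<Sum>j\<in>B. w (x i) (x j)) + (\<Sum>i\<in>B. \<Sum>j\<in>B. (capped lam (x i) (x j))\<^sup>2)"
      unfolding trace_statistic_def by (simp only: power2_eq_square[of "sum _ B"] sum_product w_def)
  qed
  show "integrable (PiM U (\<lambda>_. M)) (trace_statistic B)"
    unfolding eq using S1(1) S2(1) by simp
  have "(\<integral>x. trace_statistic B x \<partial>PiM U (\<lambda>_. M))
      = n * (\<integral>x. w x x \<partial>M) + (n * (n - 1) * (\<integral>p. (\<lambda>(x, y). (capped lam x y)\<^sup>2) p \<partial>(M \<Otimes>\<^sub>M M)) + n * (\<integral>x. (capped lam x x)\<^sup>2 \<partial>M))"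
    unfolding eq using S1 S2 Iw by (simp add: n_def)
  also have "\<dots> \<le> n * (n * D) + (n * (n - 1) * D + n * (n * D))"
  proof -
    have n1: "n \<ge> 1" using B by (simp add: n_def card_gt_0_iff Suc_le_eq)
    show ?thesis
      using dd(2) capped_pair_square_le(2)[OF lam] capped_diag_square(2) CD npos n1
      by (intro add_mono mult_left_mono) (auto simp: D_def)
  qed
  also have "\<dots> \<le> 3 * n\<^sup>2 * D"
    using npos D0 by (simp add: power2_eq_square algebra_simps)
  finally show "(\<integral>x. trace_statistic B x \<partial>PiM U (\<lambda>_. M)) \<le> 3 * (real (card B))\<^sup>2 * dimension lam"
    by (simp add: n_def D_def)
qed

text \<open>The bound for the trace statistic is twice the one for its mean.  With \<open>D\<close> the dimension and \<open>n\<close> the number of points, the condition \<open>D \<ge> 24\<close> gives \<open>6 * n\<^sup>2 * D \<le> (n * D / 2)\<^sup>2\<close>, so that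
  the trace \<open>t\<close> of the capped matrix is at least \<open>n * D / 2\<close> and the squared Frobenius norm is at most
  \<open>12 * n * t\<close>.  The general lower bound then reads \<open>t\<^sup>2 / (13 * n * t)\<close>, which is at least \<open>D / 26\<close>.\<close>

lemma effective_dimension_from_trace_statistic:
  fixes B :: "'i set"
  assumes B: "finite B" "B \<noteq> {}" and x: "\<And>i. i \<in> B \<Longrightarrow> x i \<in> space M"
    and T: "trace_statistic B x \<le> 6 * (real (card B))\<^sup>2 * dimension lam" and D: "24 \<le> dimension lam"
    and eb: "orthonormal_eigenbasis B (\<lambda>i j. K (x i) (x j)) \<tau> u"
  shows "dimension lam / 26 \<le> (\<Sum>l\<in>B. \<tau> l / (real (card B) * lam + \<tau> l))"
proof -
  define D' where "D' = dimension lam"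
  define n where "n = real (card B)"
  define t where "t = (\<Sum>i\<in>B. capped lam (x i) (x i))"
  define q where "q = (\<Sum>i\<in>B. \<Sum>j\<in>B. (capped lam (x i) (x j))\<^sup>2)"
  define E where "E = (\<Sum>l\<in>B. \<tau> l / (n * lam + \<tau> l))"
  have n: "n > 0" using B by (simp add: n_def card_gt_0_iff)
  have T': "(t - n * D')\<^sup>2 + q \<le> 6 * n\<^sup>2 * D'" using T by (simp add: trace_statistic_def t_def q_def n_def D'_def)
  have q0: "q \<ge> 0" unfolding q_def by (intro sum_nonneg) simp
  have main: "t\<^sup>2 \<le> E * (n * t + q)"
    unfolding t_def q_def E_def
  proof (rule effective_dimension_lower_bound[OF B(1) eb n lam])
    fix y :: "'i \<Rightarrow> real"
    show "0 \<le> (\<Sum>i\<in>B. \<Sum>k\<in>B. y i * y k * capped lam (x i) (x k))"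
      by (rule psd_kernel_family[OF capped_psd[OF lam] B(1) x])
    have "0 \<le> (\<Sum>i\<in>B. \<Sum>k\<in>B. y i * y k * (K (x i) (x k) - lam * capped lam (x i) (x k)))"
      by (rule psd_kernel_family[OF kernel_minus_capped_psd[OF lam] B(1) x])
    then show "lam * (\<Sum>i\<in>B. \<Sum>k\<in>B. y i * y k * capped lam (x i) (x k)) \<le> (\<Sum>i\<in>B. \<Sum>k\<in>B. y i * y k * K (x i) (x k))"
      by (simp add: right_diff_distrib sum_subtractf sum_distrib_left mult_ac)
  qed
  have "(t - n * D')\<^sup>2 \<le> (n * D' / 2)\<^sup>2"
  proof -
    have "6 * n\<^sup>2 * D' \<le> (n * D' / 2)\<^sup>2"
    proof -
      have "6 * D' \<le> D' * D' / 4" using mult_right_mono[of 24 D' D'] D by (simp add: D'_def)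
      then have "n\<^sup>2 * (6 * D') \<le> n\<^sup>2 * (D' * D' / 4)" by (intro mult_left_mono) auto
      then show ?thesis by (simp add: power2_eq_square mult_ac)
    qed
    then show ?thesis using T' q0 by linarith
  qed
  then have "\<bar>t - n * D'\<bar> \<le> n * D' / 2"
    using abs_le_square_iff[of "t - n * D'" "n * D' / 2"] n D by (simp add: D'_def)
  then have t: "t \<ge> n * D' / 2" by linarith
  have tpos: "t > 0" using t n D by (intro less_le_trans[OF _ t]) (simp add: D'_def)
  have "q \<le> 12 * (n * t)"
  proof -
    have "q \<le> 6 * n\<^sup>2 * D'" using T' zero_le_power2[of "t - n * D'"] by linarith
    also have "\<dots> = 12 * (n * (n * D' / 2))" by (simp add: power2_eq_square)
    also have "\<dots> \<le> 12 * (n * t)" using n t by (intro mult_left_mono) auto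
    finally show ?thesis .
  qed
  have E0: "E \<ge> 0"
  proof (rule ccontr)
    assume "\<not> E \<ge> 0"
    then have "E * (n * t + q) \<le> 0" using n tpos q0 by (intro mult_nonpos_nonneg) auto
    then show False using main tpos by (smt (verit) zero_less_power)
  qed
  have "t * t \<le> E * (n * t + q)" using main by (simp add: power2_eq_square)
  also have "\<dots> \<le> E * (n * t + 12 * (n * t))" using E0 \<open>q \<le> 12 * (n * t)\<close> by (intro mult_left_mono) auto
  also have "\<dots> = (E * (13 * n)) * t" by simp
  finally have "t \<le> E * (13 * n)" using tpos by simp
  then have "n * D' / 2 \<le> E * (13 * n)" using t by linarith
  then have "D' / 2 \<le> E * 13" using n by (simp add: field_simps)
  then show ?thesis by (simp add: E_def D'_def n_def)
qed

end

end

section \<open>The setting of the theorem\<close>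

lemma compact_of_compactin_Euclidean_space:
  assumes "compactin (Euclidean_space d) X"
  shows "compact X"
proof -
  have "compactin (product_topology (\<lambda>i. euclidean) UNIV) X"
    using assms unfolding Euclidean_space_def by (simp add: compactin_subtopology)
  then show ?thesis by (simp add: euclidean_product_topology)
qed

lemma continuous_kernel_measurable:
  fixes X :: "point set"
  assumes cont: "continuous_on (X \<times> X) (\<lambda>(x, x'). K x x' :: real)"
    and sets: "sets \<rho> = sets (restrict_space borel X)"
  shows "(\<lambda>(x, y). K x y) \<in> borel_measurable (\<rho> \<Otimes>\<^sub>M \<rho>)"
proof -
  have sp: "space \<rho> = X" using sets_eq_imp_space_eq[OF sets] by (simp add: space_restrict_space)
  have id: "(\<lambda>x. x) \<in> \<rho> \<rightarrow>\<^sub>M borel"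
    unfolding measurable_cong_sets[OF sets refl] by (rule measurable_restrict_space1) simp
  have "(\<lambda>p. (fst p, snd p)) \<in> \<rho> \<Otimes>\<^sub>M \<rho> \<rightarrow>\<^sub>M borel \<Otimes>\<^sub>M borel"
    by (intro measurable_Pair measurable_compose[OF measurable_fst id] measurable_compose[OF measurable_snd id])
  then have "(\<lambda>p. p) \<in> \<rho> \<Otimes>\<^sub>M \<rho> \<rightarrow>\<^sub>M (borel :: (point \<times> point) measure)"
    by (simp add: borel_prod)
  then have "(\<lambda>p. p) \<in> \<rho> \<Otimes>\<^sub>M \<rho> \<rightarrow>\<^sub>M restrict_space borel (X \<times> X)"
    by (intro measurable_restrict_space2) (auto simp: space_pair_measure sp)
  moreover have "(\<lambda>(x, x'). K x x') \<in> borel_measurable (restrict_space borel (X \<times> X))"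
    using cont by (rule borel_measurable_continuous_on_restrict)
  ultimately show ?thesis by (rule measurable_compose)
qed

lemma strictly_positive_definite_imp_psd:
  assumes "symmetric_kernel X K" "strictly_positive_definite X K"
  shows "psd_kernel X K"
  unfolding psd_kernel_def
proof (intro conjI ballI allI impI)
  fix x y assume "x \<in> X" "y \<in> X"
  then show "K x y = K y x" using assms(1) unfolding symmetric_kernel_def by blast
next
  fix S a assume S: "finite S" "S \<subseteq> X"
  show "0 \<le> (\<Sum>x\<in>S. \<Sum>y\<in>S. a x * a y * K x y)"
  proof (cases "\<exists>x\<in>S. a x \<noteq> 0")
    case True
    then have "0 < (\<Sum>x\<in>S. \<Sum>y\<in>S. a x * a y * K x y)"
      using assms(2) S unfolding strictly_positive_definite_def by blast
    then show ?thesis by simp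
  next
    case False
    then have "(\<Sum>x\<in>S. \<Sum>y\<in>S. a x * a y * K x y) = 0" by (intro sum.neutral ballI) auto
    then show ?thesis by simp
  qed
qed

lemma strictly_positive_definite_family:
  assumes spd: "strictly_positive_definite X K" and B: "finite B" "inj_on x B" "x ` B \<subseteq> X"
    and nz: "\<exists>i\<in>B. b i \<noteq> 0"
  shows "0 < (\<Sum>i\<in>B. \<Sum>j\<in>B. b i * b j * K (x i) (x j))"
proof -
  define a where "a p = b (inv_into B x p)" for p
  have a: "a (x i) = b i" if "i \<in> B" for i
    using that B by (simp add: a_def)
  have "finite (x ` B)" "\<exists>p\<in>x ` B. a p \<noteq> 0" using B nz a by auto
  then have "0 < (\<Sum>p\<in>x ` B. \<Sum>p'\<in>x ` B. a p * a p' * K p p')"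
    using spd B unfolding strictly_positive_definite_def by blast
  also have "\<dots> = (\<Sum>i\<in>B. \<Sum>j\<in>B. b i * b j * K (x i) (x j))"
    using B by (simp add: sum.reindex a)
  finally show ?thesis .
qed

lemma kernel_kappa:
  fixes X :: "point set"
  assumes X: "compact X" "X \<noteq> {}" and cont: "continuous_on (X \<times> X) (\<lambda>(x, x'). K x x' :: real)"
    and spd: "strictly_positive_definite X K"
  shows "0 < kappa X K" "x \<in> X \<Longrightarrow> y \<in> X \<Longrightarrow> K x y \<le> (kappa X K)\<^sup>2"
proof -
  have "compact ((\<lambda>(x, x'). K x x') ` (X \<times> X))"
    by (intro compact_continuous_image cont compact_Times X)
  then have bdd: "bdd_above ((\<lambda>(x, x'). K x x') ` (X \<times> X))"
    by (intro bounded_imp_bdd_above compact_imp_bounded)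
  have le: "K x y \<le> (SUP (x, x') \<in> X \<times> X. K x x')" if "x \<in> X" "y \<in> X" for x y
    using cSUP_upper[OF _ bdd, of "(x, y)"] that by simp
  obtain p where p: "p \<in> X" using X by auto
  have "0 < K p p"
    using strictly_positive_definite_family[OF spd, of "{()}" "\<lambda>_. p" "\<lambda>_. 1"] p by simp
  then have pos: "0 < (SUP (x, x') \<in> X \<times> X. K x x')" using le[OF p p] by linarith
  then show "0 < kappa X K" by (simp add: kappa_def)
  show "x \<in> X \<Longrightarrow> y \<in> X \<Longrightarrow> K x y \<le> (kappa X K)\<^sup>2"
    using le[of x y] pos by (simp add: kappa_def)
qed

section \<open>Passing to the limit of the eigenfunction expansion\<close>

context kernel_eigensystem
begin

text \<open>The operator power of exponent \<open>r - 1\<close> applied to the components of \<open>h\<close> in \<open>F\<close>; the integral operator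
  maps it to the corresponding partial sum of the operator power of exponent \<open>r\<close>.\<close>

definition source :: "real \<Rightarrow> (nat \<Rightarrow> real) \<Rightarrow> nat set \<Rightarrow> 'a \<Rightarrow> real" where
  "source r h F x = (\<Sum>k\<in>F. (\<mu> k powr (r - 1) * h k) * e k x)"

definition head :: "nat \<Rightarrow> nat set" where
  "head N = {k \<in> I. k < N \<and> \<mu> k > 0}"

lemma head: "finite (head N)" "head N \<subseteq> I" "k \<in> head N \<Longrightarrow> \<mu> k > 0"
  by (auto simp: head_def)

lemma head_mono: "N \<le> N' \<Longrightarrow> head N \<subseteq> head N'"
  by (auto simp: head_def)

lemma source_L2: "F \<subseteq> I \<Longrightarrow> source r h F \<in> L2_space M"
  unfolding source_def[abs_def] by (rule orthonormal_combination_L2[OF on])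

lemma source_split:
  assumes "F \<subseteq> F'" "finite F'"
  shows "source r h F' x = source r h F x + source r h (F' - F) x"
  unfolding source_def by (subst sum.subset_diff[OF assms]) (rule add.commute)

lemma operator_source_AE:
  "AE x in M. (\<integral>y. source r h (head N) y * K y x \<partial>M) = (\<Sum>k\<in>I \<inter> {..<N}. \<mu> k powr r * h k * e k x)"
proof -
  have "AE x in M. \<forall>k\<in>head N. (\<integral>y. e k y * K y x \<partial>M) = \<mu> k * e k x"
    using eigen head by (intro AE_finite_allI) auto
  then show ?thesis
  proof (rule AE_mp, intro AE_I2 impI)
    fix x assume x: "x \<in> space M" and E: "\<forall>k\<in>head N. (\<integral>y. e k y * K y x \<partial>M) = \<mu> k * e k x"
    have "(\<integral>y. source r h (head N) y * K y x \<partial>M) = (\<Sum>k\<in>head N. (\<mu> k powr (r - 1) * h k) * (\<integral>y. e k y * K y x \<partial>M))"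
      unfolding source_def by (rule operator_combination[OF head(1,2) x])
    also have "\<dots> = (\<Sum>k\<in>head N. \<mu> k powr r * h k * e k x)"
    proof (intro sum.cong refl)
      fix k assume k: "k \<in> head N"
      have "\<mu> k powr (r - 1) * \<mu> k powr 1 = \<mu> k powr r" unfolding powr_add[symmetric] by simp
      then have "\<mu> k powr (r - 1) * \<mu> k = \<mu> k powr r" using head(3)[OF k] by simp
      then show "(\<mu> k powr (r - 1) * h k) * (\<integral>y. e k y * K y x \<partial>M) = \<mu> k powr r * h k * e k x"
        using E k by (simp add: mult_ac)
    qed
    also have "\<dots> = (\<Sum>k\<in>I \<inter> {..<N}. \<mu> k powr r * h k * e k x)"
      using eigenvalue_nonneg by (intro sum.mono_neutral_left) (auto simp: head_def less_le)
    finally show "(\<integral>y. source r h (head N) y * K y x \<partial>M) = (\<Sum>k\<in>I \<inter> {..<N}. \<mu> k powr r * h k * e k x)" .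
  qed
qed

text \<open>A potential is bounded pointwise by the square root of its energy, and the condition \<open>1 / 2 \<le> r\<close> makes
  the energy of a tail of the source at most a constant times the tail of \<open>h\<close>.  The bound is uniform in \<open>x\<close>.\<close>

lemma operator_source_difference_le:
  assumes NN: "N \<le> N'" and r: "1 / 2 \<le> r" and x: "x \<in> space M"
  shows "((\<integral>y. source r h (head N') y * K y x \<partial>M) - (\<integral>y. source r h (head N) y * K y x \<partial>M))\<^sup>2
    \<le> C * C powr (2 * r - 1) * ((\<Sum>k\<in>head N'. (h k)\<^sup>2) - (\<Sum>k\<in>head N. (h k)\<^sup>2))"
proof -
  let ?F = "head N' - head N"
  let ?u = "undefined :: unit \<Rightarrow> 'a" and ?o = "\<lambda>_::unit. 0::real"
  have F: "finite ?F" "?F \<subseteq> I" "\<And>k. k \<in> ?F \<Longrightarrow> \<mu> k > 0" using head by auto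
  have sL2: "source r h F \<in> L2_space M" if "F \<subseteq> I" for F by (rule source_L2[OF that])
  have "(\<integral>y. source r h (head N') y * K y x \<partial>M) = (\<integral>y. source r h (head N) y * K y x + source r h ?F y * K y x \<partial>M)"
    by (intro Bochner_Integration.integral_cong refl)
      (simp add: source_split[OF head_mono[OF NN] head(1)] distrib_right)
  also have "\<dots> = (\<integral>y. source r h (head N) y * K y x \<partial>M) + (\<integral>y. source r h ?F y * K y x \<partial>M)"
    by (intro Bochner_Integration.integral_add integrable_L2_mult sL2 head F kernel_L2_left[OF bk x])
  finally have d: "(\<integral>y. source r h (head N') y * K y x \<partial>M) - (\<integral>y. source r h (head N) y * K y x \<partial>M) = (\<integral>y. source r h ?F y * K y x \<partial>M)"
    by simp
  have p: "psd_kernel (space M) (\<lambda>x y. energy M K {} ?u (source r h ?F) ?o * K x y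
      - potential M K (source r h ?F) {} ?o ?u x * potential M K (source r h ?F) {} ?o ?u y)"
    by (rule potential_dominated_psd[OF bk _ _ sL2[OF F(2)]]) auto
  have "(\<integral>y. source r h ?F y * K y x \<partial>M)\<^sup>2 \<le> energy M K {} ?u (source r h ?F) ?o * K x x"
    using psd_kernel_diag[OF p x] by (simp add: potential_def power2_eq_square)
  also have "\<dots> \<le> energy M K {} ?u (source r h ?F) ?o * C"
    by (intro mult_left_mono kernel_diag_le[OF bk x] energy_nonneg[OF bk _ _ sL2[OF F(2)]]) auto
  also have "\<dots> \<le> (C powr (2 * r - 1) * (\<Sum>k\<in>?F. (h k)\<^sup>2)) * C"
    unfolding source_def[abs_def]
    by (intro mult_right_mono source_energy_le F r kernel_bound_nonneg[OF bk])
  also have "(\<Sum>k\<in>?F. (h k)\<^sup>2) = (\<Sum>k\<in>head N'. (h k)\<^sup>2) - (\<Sum>k\<in>head N. (h k)\<^sup>2)"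
    by (rule sum_diff[OF head(1) head_mono[OF NN]])
  finally show ?thesis unfolding d by (simp add: mult_ac)
qed

text \<open>The expansion converges in the mean to \<open>f\<close> and uniformly on the whole space; hence its pointwise
  limit is \<open>f\<close> almost everywhere, in particular at almost all samples.\<close>

theorem operator_source_converges_AE:
  assumes r: "1 / 2 \<le> r" and f: "f \<in> L2_space M"
    and H: "\<And>N. (\<Sum>k\<in>head N. (h k)\<^sup>2) \<le> H"
    and lim: "(\<lambda>N. L2_norm M (\<lambda>x. f x - (\<Sum>k\<in>I \<inter> {..<N}. \<mu> k powr r * h k * e k x))) \<longlonglongrightarrow> 0"
  shows "AE x in M. (\<lambda>N. \<integral>y. source r h (head N) y * K y x \<partial>M) \<longlonglongrightarrow> f x"
    and "(\<lambda>N. L2_norm M (\<lambda>x. f x - (\<integral>y. source r h (head N) y * K y x \<partial>M))) \<longlonglongrightarrow> 0"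
proof -
  define s where "s N x = (\<integral>y. source r h (head N) y * K y x \<partial>M)" for N x
  define a where "a N = (\<Sum>k\<in>head N. (h k)\<^sup>2)" for N
  define c where "c = C * C powr (2 * r - 1)"
  have c0: "c \<ge> 0" using kernel_bound_nonneg[OF bk] by (simp add: c_def)
  have sL2: "s N \<in> L2_space M" for N
    unfolding s_def by (rule density_potential_L2[OF bk source_L2[OF head(2)]])
  have eq: "L2_norm M (\<lambda>x. f x - s N x) = L2_norm M (\<lambda>x. f x - (\<Sum>k\<in>I \<inter> {..<N}. \<mu> k powr r * h k * e k x))" for N
  proof -
    have pL2: "(\<lambda>x. \<Sum>k\<in>I \<inter> {..<N}. \<mu> k powr r * h k * e k x) \<in> L2_space M"
      by (rule orthonormal_combination_L2[OF on]) auto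
    have "AE x in M. (f x - s N x)\<^sup>2 = (f x - (\<Sum>k\<in>I \<inter> {..<N}. \<mu> k powr r * h k * e k x))\<^sup>2"
      using operator_source_AE[of r h N, folded s_def] by (rule eventually_mono) (simp only:)
    then have "(\<integral>x. (f x - s N x)\<^sup>2 \<partial>M) = (\<integral>x. (f x - (\<Sum>k\<in>I \<inter> {..<N}. \<mu> k powr r * h k * e k x))\<^sup>2 \<partial>M)"
      by (intro integral_cong_AE borel_measurable_power borel_measurable_diff L2_spaceD(1)[OF f] L2_spaceD(1)[OF sL2] L2_spaceD(1)[OF pL2])
    then show ?thesis by (simp only: L2_norm_def)
  qed
  show lim': "(\<lambda>N. L2_norm M (\<lambda>x. f x - (\<integral>y. source r h (head N) y * K y x \<partial>M))) \<longlonglongrightarrow> 0"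
    using lim unfolding eq[symmetric] s_def .
  have "incseq a"
    unfolding a_def by (intro incseq_SucI sum_mono2 head head_mono) auto
  then obtain A where A: "a \<longlonglongrightarrow> A" "\<And>N. a N \<le> A"
    using incseq_convergent[of a H] H unfolding a_def by blast
  have tail: "(\<lambda>N. sqrt (c * (A - a N))) \<longlonglongrightarrow> 0"
  proof -
    have "(\<lambda>N. sqrt (c * (A - a N))) \<longlonglongrightarrow> sqrt (c * (A - A))"
      by (intro tendsto_intros A(1))
    then show ?thesis by simp
  qed
  have diff: "\<bar>s N' x - s N x\<bar> \<le> sqrt (c * (A - a N))" if "N \<le> N'" "x \<in> space M" for N N' x
  proof -
    have "(s N' x - s N x)\<^sup>2 \<le> c * (a N' - a N)"
      unfolding s_def c_def a_def by (rule operator_source_difference_le[OF that(1) r that(2)])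
    also have "\<dots> \<le> c * (A - a N)" using A(2)[of N'] c0 by (intro mult_left_mono) auto
    finally show ?thesis by (simp add: real_le_rsqrt[of "\<bar>_\<bar>"])
  qed
  define l where "l x = lim (\<lambda>N. s N x)" for x
  have conv: "(\<lambda>N. s N x) \<longlonglongrightarrow> l x" if x: "x \<in> space M" for x
  proof -
    have "Cauchy (\<lambda>N. s N x)"
    proof (rule metric_CauchyI)
      fix \<epsilon> :: real assume e: "0 < \<epsilon>"
      obtain N0 where N0: "\<And>N. N \<ge> N0 \<Longrightarrow> norm (sqrt (c * (A - a N)) - 0) < \<epsilon> / 2"
        using LIMSEQ_D[OF tail, of "\<epsilon> / 2"] e by auto
      have "dist (s N x) (s N' x) < \<epsilon>" if "N \<ge> N0" "N' \<ge> N0" for N N'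
      proof -
        have "\<bar>sqrt (c * (A - a N0))\<bar> < \<epsilon> / 2"
          using N0[of N0] by (simp only: real_norm_def diff_0_right order_refl)
        then have "\<bar>s N x - s N0 x\<bar> < \<epsilon> / 2" "\<bar>s N' x - s N0 x\<bar> < \<epsilon> / 2"
          using diff[OF that(1) x] diff[OF that(2) x] by linarith+
        then show ?thesis unfolding dist_real_def by linarith
      qed
      then show "\<exists>N0. \<forall>N\<ge>N0. \<forall>N'\<ge>N0. dist (s N x) (s N' x) < \<epsilon>" by blast
    qed
    then show ?thesis unfolding l_def by (simp add: Cauchy_convergent_iff convergent_LIMSEQ_iff)
  qed
  have close: "\<bar>l x - s N x\<bar> \<le> sqrt (c * (A - a N))" if x: "x \<in> space M" for x N
  proof (rule tendsto_upperbound)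
    show "(\<lambda>N'. \<bar>s N' x - s N x\<bar>) \<longlonglongrightarrow> \<bar>l x - s N x\<bar>" by (intro tendsto_intros conv x)
    show "\<forall>\<^sub>F N' in sequentially. \<bar>s N' x - s N x\<bar> \<le> sqrt (c * (A - a N))"
      by (rule eventually_sequentiallyI[of N]) (rule diff[OF _ x])
  qed simp
  have lm: "l \<in> borel_measurable M"
    unfolding l_def by (intro borel_measurable_lim_metric L2_spaceD(1)[OF sL2])
  have lsL2: "(\<lambda>x. l x - s N x) \<in> L2_space M" for N
    by (rule L2_space_bounded[OF borel_measurable_diff[OF lm L2_spaceD(1)[OF sL2]] close])
  have lL2: "l \<in> L2_space M"
    using L2_space_add[OF lsL2[of 0] sL2[of 0]] by simp
  have lsn: "L2_norm M (\<lambda>x. l x - s N x) \<le> sqrt (c * (A - a N))" for N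
  proof -
    have "(\<integral>x. (l x - s N x)\<^sup>2 \<partial>M) \<le> (\<integral>x. (sqrt (c * (A - a N)))\<^sup>2 \<partial>M)"
    proof (rule integral_mono[OF L2_spaceD(2)[OF lsL2]])
      fix x assume "x \<in> space M"
      from power_mono[OF close[OF this, of N] abs_ge_zero, of 2]
      show "(l x - s N x)\<^sup>2 \<le> (sqrt (c * (A - a N)))\<^sup>2" by simp
    qed simp
    then show ?thesis
      unfolding L2_norm_def using c0 A(2)[of N] by (simp add: prob_space)
  qed
  have "L2_norm M (\<lambda>x. f x - l x) \<le> L2_norm M (\<lambda>x. f x - s N x) + sqrt (c * (A - a N))" for N
  proof -
    have "L2_norm M (\<lambda>x. (f x - s N x) + (s N x - l x)) \<le> L2_norm M (\<lambda>x. f x - s N x) + L2_norm M (\<lambda>x. s N x - l x)"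
      by (intro L2_norm_triangle L2_space_diff f sL2 lL2)
    then show ?thesis using lsn[of N] unfolding L2_norm_uminus_diff[of M "s N" l] by simp
  qed
  moreover have "(\<lambda>N. L2_norm M (\<lambda>x. f x - s N x) + sqrt (c * (A - a N))) \<longlonglongrightarrow> 0 + 0"
    by (intro tendsto_add tail) (use lim' in \<open>simp add: s_def\<close>)
  ultimately have "L2_norm M (\<lambda>x. f x - l x) \<le> 0 + 0"
    by (intro tendsto_lowerbound[of _ "0 + 0" sequentially]) auto
  then have "L2_norm M (\<lambda>x. f x - l x) = 0" using L2_norm_nonneg[of M "\<lambda>x. f x - l x"] by linarith
  then have "(\<integral>x. (f x - l x)\<^sup>2 \<partial>M) = 0" by (simp add: L2_norm_def)
  then have "AE x in M. (f x - l x)\<^sup>2 = 0"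
    using integral_nonneg_eq_0_iff_AE[OF L2_spaceD(2)[OF L2_space_diff[OF f lL2]]] by simp
  then have "AE x in M. f x = l x" by simp
  then show "AE x in M. (\<lambda>N. \<integral>y. source r h (head N) y * K y x \<partial>M) \<longlonglongrightarrow> f x"
  proof (rule AE_mp, intro AE_I2 impI)
    fix x assume "x \<in> space M" "f x = l x"
    then show "(\<lambda>N. \<integral>y. source r h (head N) y * K y x \<partial>M) \<longlonglongrightarrow> f x"
      using conv[of x] by (simp add: s_def)
  qed
qed

text \<open>The interpolation coefficients depend on the values through a fixed linear map \<open>W\<close>.  Hence the
  convergence of the truncated expansions at the points of the sample carries over to the coefficients
  and to the interpolants in \<open>L\<^sup>2\<close>, and the error bound survives the limit.\<close>

lemma interpolation_error_limit:
  fixes B :: "'i set"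
  assumes fin: "finite B" and z: "\<And>i. i \<in> B \<Longrightarrow> z i \<in> space M" and f: "f \<in> L2_space M" and gN: "\<And>N. g N \<in> L2_space M"
    and pt: "\<And>i. i \<in> B \<Longrightarrow> (\<lambda>N. \<integral>y. g N y * K y (z i) \<partial>M) \<longlonglongrightarrow> f (z i)"
    and mean: "(\<lambda>N. L2_norm M (\<lambda>x. f x - (\<integral>y. g N y * K y x \<partial>M))) \<longlonglongrightarrow> 0"
    and bound: "\<And>N. N \<ge> N0 \<Longrightarrow>
      L2_norm M (potential M K (g N) B (\<lambda>j. - (\<Sum>i\<in>B. W j i * (\<integral>y. g N y * K y (z i) \<partial>M))) z) \<le> R"
  shows "L2_norm M (\<lambda>x. (\<Sum>j\<in>B. (\<Sum>i\<in>B. W j i * f (z i)) * K (z j) x) - f x) \<le> R"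
proof -
  define s where "s N x = (\<integral>y. g N y * K y x \<partial>M)" for N x
  define a where "a j = (\<Sum>i\<in>B. W j i * f (z i))" for j
  define aN where "aN N j = (\<Sum>i\<in>B. W j i * s N (z i))" for N j
  define v where "v N = potential M K (g N) B (\<lambda>j. - aN N j) z" for N
  have sL2: "s N \<in> L2_space M" for N unfolding s_def by (rule density_potential_L2[OF bk gN])
  have vL2: "v N \<in> L2_space M" for N unfolding v_def by (rule potential_L2[OF bk gN z])
  have KL2: "(\<lambda>x. K (z j) x) \<in> L2_space M" if "j \<in> B" for j by (rule kernel_L2_right[OF bk z[OF that]])
  have aconv: "(\<lambda>N. aN N j) \<longlonglongrightarrow> a j" for j
    unfolding aN_def a_def s_def by (intro tendsto_sum tendsto_mult tendsto_const pt)
  define d where "d N x = (\<Sum>j\<in>B. (a j - aN N j) * K (z j) x)" for N x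
  have dL2: "d N \<in> L2_space M" for N unfolding d_def by (intro L2_space_sum L2_space_scale KL2)
  have dn: "L2_norm M (d N) \<le> (\<Sum>j\<in>B. \<bar>a j - aN N j\<bar> * C)" for N
  proof -
    have b: "\<bar>d N x\<bar> \<le> (\<Sum>j\<in>B. \<bar>a j - aN N j\<bar> * C)" if "x \<in> space M" for x
      unfolding d_def using kernel_abs_le[OF bk z that]
      by (intro order_trans[OF sum_abs] sum_mono) (auto simp: abs_mult intro: mult_left_mono)
    have "(\<integral>x. (d N x)\<^sup>2 \<partial>M) \<le> (\<integral>x. (\<Sum>j\<in>B. \<bar>a j - aN N j\<bar> * C)\<^sup>2 \<partial>M)"
    proof (rule integral_mono[OF L2_spaceD(2)[OF dL2]])
      fix x assume "x \<in> space M"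
      from power_mono[OF b[OF this] abs_ge_zero, of 2]
      show "(d N x)\<^sup>2 \<le> (\<Sum>j\<in>B. \<bar>a j - aN N j\<bar> * C)\<^sup>2" by simp
    qed simp
    moreover have "0 \<le> (\<Sum>j\<in>B. \<bar>a j - aN N j\<bar> * C)"
      using kernel_bound_nonneg[OF bk] by (intro sum_nonneg) simp
    ultimately show ?thesis unfolding L2_norm_def by (intro real_le_lsqrt) (auto simp: prob_space)
  qed
  have bnd: "L2_norm M (\<lambda>x. (\<Sum>j\<in>B. a j * K (z j) x) - f x)
      \<le> R + (\<Sum>j\<in>B. \<bar>a j - aN N j\<bar> * C) + L2_norm M (\<lambda>x. f x - s N x)" if N: "N \<ge> N0" for N
  proof -
    have "(\<lambda>x. f x - (\<Sum>j\<in>B. a j * K (z j) x)) = (\<lambda>x. (v N x - d N x) + (f x - s N x))"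
      by (simp add: fun_eq_iff v_def potential_def d_def s_def left_diff_distrib sum_subtractf sum_negf)
    then have "L2_norm M (\<lambda>x. f x - (\<Sum>j\<in>B. a j * K (z j) x)) = L2_norm M (\<lambda>x. (v N x - d N x) + (f x - s N x))"
      by (rule arg_cong)
    also have "\<dots> \<le> L2_norm M (\<lambda>x. v N x - d N x) + L2_norm M (\<lambda>x. f x - s N x)"
      by (intro L2_norm_triangle L2_space_diff vL2 dL2 f sL2)
    finally have 1: "L2_norm M (\<lambda>x. f x - (\<Sum>j\<in>B. a j * K (z j) x))
        \<le> L2_norm M (\<lambda>x. v N x - d N x) + L2_norm M (\<lambda>x. f x - s N x)" .
    have 2: "L2_norm M (\<lambda>x. v N x - d N x) \<le> L2_norm M (v N) + L2_norm M (d N)"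
      using L2_norm_triangle[OF vL2 L2_space_scale[OF dL2, of "-1"], of N N] by (simp add: L2_norm_def)
    have "L2_norm M (\<lambda>x. f x - (\<Sum>j\<in>B. a j * K (z j) x))
        \<le> (L2_norm M (v N) + L2_norm M (d N)) + L2_norm M (\<lambda>x. f x - s N x)"
      by (rule order_trans[OF 1 add_right_mono[OF 2]])
    also have "\<dots> \<le> (R + (\<Sum>j\<in>B. \<bar>a j - aN N j\<bar> * C)) + L2_norm M (\<lambda>x. f x - s N x)"
      using bound[OF N, folded s_def, folded aN_def, folded v_def] dn[of N] by (intro add_mono order_refl)
    finally have "L2_norm M (\<lambda>x. f x - (\<Sum>j\<in>B. a j * K (z j) x))
        \<le> R + (\<Sum>j\<in>B. \<bar>a j - aN N j\<bar> * C) + L2_norm M (\<lambda>x. f x - s N x)" .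
    then show ?thesis
      by (rule ord_eq_le_trans[OF L2_norm_uminus_diff])
  qed
  have blim: "(\<lambda>N. R + (\<Sum>j\<in>B. \<bar>a j - aN N j\<bar> * C) + L2_norm M (\<lambda>x. f x - s N x)) \<longlonglongrightarrow> R + (\<Sum>j\<in>B. \<bar>a j - a j\<bar> * C) + 0"
    by (intro tendsto_intros aconv) (use mean in \<open>simp add: s_def\<close>)
  have "L2_norm M (\<lambda>x. (\<Sum>j\<in>B. a j * K (z j) x) - f x) \<le> R + (\<Sum>j\<in>B. \<bar>a j - a j\<bar> * C) + 0"
    by (rule tendsto_lowerbound[OF blim eventually_sequentiallyI[of N0, OF bnd] trivial_limit_sequentially])
  then show ?thesis by (simp add: a_def)
qed

end

text \<open>Extending coefficients by zero lets the residual on the whole sample be compared with coefficients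
  that live on one block.\<close>

lemma energy_restrict:
  fixes B :: "'i set"
  assumes "finite B" "B' \<subseteq> B"
  shows "energy M P B z g (\<lambda>i. if i \<in> B' then b i else 0) = energy M P B' z g b"
proof -
  have s: "(\<Sum>i\<in>B. (if i \<in> B' then b i else 0) * w i) = (\<Sum>i\<in>B'. b i * w i)" for w :: "'i \<Rightarrow> real"
    using assms by (intro sum.mono_neutral_cong_right) auto
  show ?thesis unfolding mutual_energy_def potential_def[abs_def] s ..
qed

definition block :: "nat \<Rightarrow> nat \<Rightarrow> nat set" where
  "block n j = {j * n..<j * n + n}"

lemma block: "finite (block n j)" "card (block n j) = n" "n > 0 \<Longrightarrow> block n j \<noteq> {}"
  "j < J \<Longrightarrow> J * n \<le> m \<Longrightarrow> block n j \<subseteq> {..<m}" "disjoint_family_on (block n) S"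
proof -
  show "finite (block n j)" "card (block n j) = n" "n > 0 \<Longrightarrow> block n j \<noteq> {}" by (auto simp: block_def)
  show "block n j \<subseteq> {..<m}" if "j < J" "J * n \<le> m"
  proof -
    have "Suc j * n \<le> J * n" using that(1) by (intro mult_le_mono1) simp
    then show ?thesis using that(2) by (auto simp: block_def)
  qed
  have *: "x < y \<Longrightarrow> block n x \<inter> block n y = {}" for x y
  proof -
    assume "x < y"
    then have "Suc x * n \<le> y * n" by (intro mult_le_mono1) simp
    then show "block n x \<inter> block n y = {}" by (auto simp: block_def)
  qed
  show "disjoint_family_on (block n) S"
    unfolding disjoint_family_on_def using * by (metis Int_commute linorder_neqE_nat)
qed

context prob_space
begin

lemma prob_Int_ge:
  assumes "A \<in> events" "B \<in> events"
  shows "prob A + prob B - 1 \<le> prob (A \<inter> B)"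
proof -
  have "prob (A \<union> B) = prob A + prob (B - A)" using assms by (rule finite_measure_Union')
  moreover have "prob B = prob (B - A) + prob (A \<inter> B)"
    using finite_measure_Diff'[OF assms(2) assms(1)] by (simp add: Int_commute)
  moreover have "prob (A \<union> B) \<le> 1" by (rule prob_le_1)
  ultimately show ?thesis by linarith
qed

text \<open>The event does not ask which block is good: one block suffices, and another block may serve for
  another statistic.\<close>

lemma energy_block_event:
  assumes bk: "bounded_psd_kernel M P C" and g: "g \<in> L2_space M"
    and n: "n > 0" and J: "J * n \<le> m" and m: "m > 0"
    and mean: "(\<integral>x. g x * g x * P x x \<partial>M) / real n \<le> c" and c: "c > 0"
  defines "E \<equiv> {x \<in> space (PiM {..<m} (\<lambda>_. M)). \<exists>j<J. energy M P (block n j) x g (\<lambda>i. - g (x i) / real n) \<le> 2 * c}"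
  shows "E \<in> sets (PiM {..<m} (\<lambda>_. M))" "measure (PiM {..<m} (\<lambda>_. M)) E \<ge> 1 - (1 / 2) ^ J"
proof -
  define Y where "Y j x = energy M P (block n j) x g (\<lambda>i. - g (x i) / real n)" for j x
  have sub: "block n j \<subseteq> {..<m}" if "j < J" for j by (rule block(4)[OF that J])
  have Yint: "integrable (PiM U (\<lambda>_. M)) (Y j)" "(\<integral>x. Y j x \<partial>PiM U (\<lambda>_. M)) \<le> (\<integral>x. g x * g x * P x x \<partial>M) / real n"
    if "block n j \<subseteq> U" for U j
    using expected_sampling_energy[OF bk g block(1) block(3)[OF n] that] unfolding Y_def block(2) by auto
  have ev: "E = {x \<in> space (PiM {..<m} (\<lambda>_. M)). \<exists>j<J. Y j x \<le> 2 * c}" unfolding E_def Y_def ..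
  have ne: "{..<m} \<noteq> {}" using m by auto
  have a: "Y j \<in> borel_measurable (PiM (block n j) (\<lambda>_. M))" for j
    by (rule borel_measurable_integrable[OF Yint(1)[OF order_refl]])
  have l: "Y j (restrict x (block n j)) = Y j x" for j x
    unfolding Y_def by (rule energy_cong) simp_all
  have p: "0 \<le> Y j x" if "j < J" "x \<in> space (PiM {..<m} (\<lambda>_. M))" for j x
    unfolding Y_def using sub[OF that(1)] that(2)
    by (intro energy_nonneg[OF bk block(1) _ g]) (auto simp: space_PiM PiE_def Pi_def)
  have mn: "(\<integral>x. Y j x \<partial>PiM {..<m} (\<lambda>_. M)) \<le> c" if "j < J" for j
    using Yint(2)[OF sub[OF that]] mean by linarith
  note blocks = independent_blocks_Markov[where B = "block n" and Y = Y and J = J and U = "{..<m}" and C = c,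
      OF ne sub block(5) a l p Yint(1)[OF sub] mn c]
  show "E \<in> sets (PiM {..<m} (\<lambda>_. M))" unfolding ev by (rule blocks(1))
  show "measure (PiM {..<m} (\<lambda>_. M)) E \<ge> 1 - (1 / 2) ^ J" unfolding ev by (rule blocks(2))
qed

end

context kernel_eigensystem
begin

lemma trace_block_event:
  assumes lam: "lam > 0" and n: "n > 0" and J: "J * n \<le> m" and m: "m > 0"
    and Cn: "C \<le> real n * lam" and D: "dimension lam > 0"
  defines "E \<equiv> {x \<in> space (PiM {..<m} (\<lambda>_. M)). \<exists>j<J. trace_statistic lam (block n j) x \<le> 2 * (3 * (real n)\<^sup>2 * dimension lam)}"
  shows "E \<in> sets (PiM {..<m} (\<lambda>_. M))" "measure (PiM {..<m} (\<lambda>_. M)) E \<ge> 1 - (1 / 2) ^ J"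
proof -
  have sub: "block n j \<subseteq> {..<m}" if "j < J" for j by (rule block(4)[OF that J])
  have Cn': "C \<le> real (card (block n j)) * lam" for j using Cn by (simp add: block(2))
  have Yint: "integrable (PiM U (\<lambda>_. M)) (trace_statistic lam (block n j))"
    "(\<integral>x. trace_statistic lam (block n j) x \<partial>PiM U (\<lambda>_. M)) \<le> 3 * (real n)\<^sup>2 * dimension lam"
    if "block n j \<subseteq> U" for U j
    using expected_trace_statistic[OF lam block(1) block(3)[OF n] that Cn'] unfolding block(2) by auto
  have ne: "{..<m} \<noteq> {}" using m by auto
  have a: "trace_statistic lam (block n j) \<in> borel_measurable (PiM (block n j) (\<lambda>_. M))" for j
    by (rule borel_measurable_integrable[OF Yint(1)[OF order_refl]])
  have l: "trace_statistic lam (block n j) (restrict x (block n j)) = trace_statistic lam (block n j) x" for j x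
    unfolding trace_statistic_def[OF lam] by (simp cong: sum.cong)
  have p: "0 \<le> trace_statistic lam (block n j) x" for j x
    unfolding trace_statistic_def[OF lam] by (intro add_nonneg_nonneg sum_nonneg) simp_all
  have pos: "0 < 3 * (real n)\<^sup>2 * dimension lam" using n D by simp
  note blocks = independent_blocks_Markov[where B = "block n" and Y = "\<lambda>j. trace_statistic lam (block n j)" and J = J
      and U = "{..<m}" and C = "3 * (real n)\<^sup>2 * dimension lam",
      OF ne sub block(5) a l p Yint(1)[OF sub] Yint(2)[OF sub] pos]
  show "E \<in> sets (PiM {..<m} (\<lambda>_. M))" unfolding E_def by (rule blocks(1))
  show "measure (PiM {..<m} (\<lambda>_. M)) E \<ge> 1 - (1 / 2) ^ J" unfolding E_def by (rule blocks(2))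
qed

text \<open>Three statistics are controlled at once, each with exceptional probability at most \<open>2 ^ - J\<close>: the
  deviation energy of the Schur product at the scale \<open>lam\<close>, the energy of the residual of sampling \<open>g\<close>,
  and the trace statistic.  The last one is taken at \<open>lam / 2\<close>, where the choice of the scale guarantees a
  large dimension.  Beyond \<open>n * lam = 48 * C\<close> that dimension is at least 24, as the lower bound for the
  effective dimension requires; below it, \<open>lam\<close> is at most of the order \<open>1 / n\<close>.\<close>

theorem good_sample_event:
  assumes C: "C > 0" and n: "n > 0" and J: "J * n \<le> m" and m: "m > 0" and g: "g \<in> L2_space M"
  shows "\<exists>lam>0. \<exists>E\<in>sets (PiM {..<m} (\<lambda>_. M)). measure (PiM {..<m} (\<lambda>_. M)) E \<ge> 1 - 3 * (1 / 2) ^ J \<and>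
    (\<forall>x\<in>E. \<exists>j<J. energy M (\<lambda>x y. capped lam x y * K x y) (block n j) x (\<lambda>_. 1) (\<lambda>_. - 1 / real n) \<le> 2 * lam) \<and>
    (\<forall>x\<in>E. \<exists>j<J. energy M K (block n j) x g (\<lambda>i. - g (x i) / real n) \<le> 2 * ((C * (\<integral>x. (g x)\<^sup>2 \<partial>M) + 1) / real n)) \<and>
    (real n * lam \<le> 48 * C \<or> (real n * (lam / 2) / C \<le> dimension (lam / 2) \<and> 24 \<le> dimension (lam / 2) \<and>
      (\<forall>x\<in>E. \<exists>j<J. trace_statistic (lam / 2) (block n j) x \<le> 6 * (real n)\<^sup>2 * dimension (lam / 2))))"
proof -
  interpret S: prob_space "PiM {..<m} (\<lambda>_. M)" by (rule prob_space_sample)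
  have n1: "1 \<le> real n" using n by simp
  obtain lam where lam: "lam > 0" and D: "dimension lam \<le> real n * lam / C"
    and alt: "real n * lam \<le> 2 * C \<or> (C \<le> real n * (lam / 2) \<and> real n * (lam / 2) / C < dimension (lam / 2))"
    by (rule dimension_scale_choice[OF C n1])
  have one: "(\<lambda>_. 1) \<in> L2_space M" by (rule L2_space_const)
  have bS: "bounded_psd_kernel M (\<lambda>x y. capped lam x y * K x y) (C / lam * C)"
    unfolding bounded_psd_kernel_def
  proof (intro conjI ballI psd_kernel_mult kernel_psd[OF bk] capped_psd[OF lam])
    show "(\<lambda>(x, y). capped lam x y * K x y) \<in> borel_measurable (M \<Otimes>\<^sub>M M)"
      unfolding split_beta'
      by (intro borel_measurable_times kernel_measurable[OF capped_bounded[OF lam]] kernel_measurable[OF bk] measurable_fst measurable_snd)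
    fix x assume x: "x \<in> space M"
    show "capped lam x x * K x x \<le> C / lam * C"
      using kernel_diag_le[OF capped_bounded[OF lam] x] kernel_diag_le[OF bk x] C lam
        psd_kernel_diag[OF kernel_psd[OF bk] x] by (intro mult_mono) auto
  qed
  have mean1: "(\<integral>x. 1 * 1 * (capped lam x x * K x x) \<partial>M) / real n \<le> lam"
  proof -
    have "(\<integral>x. 1 * 1 * (capped lam x x * K x x) \<partial>M) \<le> (\<integral>x. capped lam x x * C \<partial>M)"
    proof (rule integral_mono)
      show "integrable M (\<lambda>x. 1 * 1 * (capped lam x x * K x x))" by (rule integrable_kernel_diag[OF bS one])
      show "integrable M (\<lambda>x. capped lam x x * C)" using capped_diag_integrable[OF lam] by simp
      fix x assume x: "x \<in> space M"
      show "1 * 1 * (capped lam x x * K x x) \<le> capped lam x x * C"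
        using mult_left_mono[OF kernel_diag_le[OF bk x] psd_kernel_diag[OF capped_psd[OF lam] x]] by simp
    qed
    also have "\<dots> = dimension lam * C" by (simp add: dimension_def[OF lam])
    also have "\<dots> \<le> real n * lam" using D C by (simp add: pos_le_divide_eq)
    finally show ?thesis using n by (simp add: divide_le_eq mult.commute)
  qed
  have i0: "0 \<le> (\<integral>x. (g x)\<^sup>2 \<partial>M)" by (rule integral_nonneg_AE) simp
  \<comment> \<open>The summand 1 keeps the threshold of Markov's inequality positive for \<open>g = 0\<close>.\<close>
  define c3 where "c3 = (C * (\<integral>x. (g x)\<^sup>2 \<partial>M) + 1) / real n"
  have c3: "c3 > 0" unfolding c3_def using C n i0 by (intro divide_pos_pos add_nonneg_pos mult_nonneg_nonneg) auto
  have mean3: "(\<integral>x. g x * g x * K x x \<partial>M) / real n \<le> c3"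
    unfolding c3_def using integral_kernel_diag_le[OF bk g] n by (intro divide_right_mono) auto
  define E1 where "E1 = {x \<in> space (PiM {..<m} (\<lambda>_. M)). \<exists>j<J. energy M (\<lambda>x y. capped lam x y * K x y) (block n j) x (\<lambda>_. 1) (\<lambda>i. - 1 / real n) \<le> 2 * lam}"
  define E3 where "E3 = {x \<in> space (PiM {..<m} (\<lambda>_. M)). \<exists>j<J. energy M K (block n j) x g (\<lambda>i. - g (x i) / real n) \<le> 2 * c3}"
  define E2 where "E2 = (if real n * lam \<le> 48 * C then space (PiM {..<m} (\<lambda>_. M))
    else {x \<in> space (PiM {..<m} (\<lambda>_. M)). \<exists>j<J. trace_statistic (lam / 2) (block n j) x \<le> 2 * (3 * (real n)\<^sup>2 * dimension (lam / 2))})"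
  have E1: "E1 \<in> S.events" "S.prob E1 \<ge> 1 - (1 / 2) ^ J"
    unfolding E1_def by (rule energy_block_event[OF bS one n J m mean1 lam])+
  have E3: "E3 \<in> S.events" "S.prob E3 \<ge> 1 - (1 / 2) ^ J"
    unfolding E3_def by (rule energy_block_event[OF bk g n J m mean3 c3])+
  have big: "C \<le> real n * (lam / 2)" "real n * (lam / 2) / C \<le> dimension (lam / 2)" "24 \<le> dimension (lam / 2)"
    if "\<not> real n * lam \<le> 48 * C"
  proof -
    have alt2: "C \<le> real n * (lam / 2) \<and> real n * (lam / 2) / C < dimension (lam / 2)"
      using alt that C by linarith
    then show "C \<le> real n * (lam / 2)" "real n * (lam / 2) / C \<le> dimension (lam / 2)" by auto
    have "24 \<le> real n * (lam / 2) / C" using that C by (simp add: pos_le_divide_eq)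
    then show "24 \<le> dimension (lam / 2)" using alt2 by linarith
  qed
  have E2: "E2 \<in> S.events" "S.prob E2 \<ge> 1 - (1 / 2) ^ J"
  proof -
    have l2: "lam / 2 > 0" using lam by simp
    have "E2 \<in> S.events \<and> S.prob E2 \<ge> 1 - (1 / 2) ^ J"
    proof (cases "real n * lam \<le> 48 * C")
      case True
      then show ?thesis by (simp add: E2_def S.prob_space)
    next
      case False
      have d: "dimension (lam / 2) > 0" using big(3)[OF False] by linarith
      have "E2 = {x \<in> space (PiM {..<m} (\<lambda>_. M)). \<exists>j<J. trace_statistic (lam / 2) (block n j) x \<le> 2 * (3 * (real n)\<^sup>2 * dimension (lam / 2))}"
        unfolding E2_def by (rule if_not_P[OF False])
      then show ?thesis
        using trace_block_event[OF l2 n J m big(1)[OF False] d] by (simp only: simp_thms)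
    qed
    then show "E2 \<in> S.events" "S.prob E2 \<ge> 1 - (1 / 2) ^ J" by (rule conjunct1, rule conjunct2)
  qed
  define E where "E = E1 \<inter> E2 \<inter> E3"
  have Es: "E \<in> S.events" unfolding E_def by (intro sets.Int E1 E2 E3)
  have "S.prob E \<ge> 1 - 3 * (1 / 2) ^ J"
  proof -
    have "S.prob E1 + S.prob E2 - 1 \<le> S.prob (E1 \<inter> E2)" by (rule S.prob_Int_ge[OF E1(1) E2(1)])
    moreover have "S.prob (E1 \<inter> E2) + S.prob E3 - 1 \<le> S.prob E"
      unfolding E_def by (rule S.prob_Int_ge[OF sets.Int[OF E1(1) E2(1)] E3(1)])
    ultimately show ?thesis using E1(2) E2(2) E3(2) by linarith
  qed
  moreover have "real n * lam \<le> 48 * C \<or> (real n * (lam / 2) / C \<le> dimension (lam / 2) \<and> 24 \<le> dimension (lam / 2) \<and>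
      (\<forall>x\<in>E. \<exists>j<J. trace_statistic (lam / 2) (block n j) x \<le> 6 * (real n)\<^sup>2 * dimension (lam / 2)))"
  proof (cases "real n * lam \<le> 48 * C")
    case False
    then have "\<forall>x\<in>E. \<exists>j<J. trace_statistic (lam / 2) (block n j) x \<le> 6 * (real n)\<^sup>2 * dimension (lam / 2)"
      unfolding E_def E2_def by auto
    then show ?thesis using big[OF False] by blast
  qed simp
  moreover have "\<exists>j<J. energy M (\<lambda>x y. capped lam x y * K x y) (block n j) x (\<lambda>_. 1) (\<lambda>_. - 1 / real n) \<le> 2 * lam" if "x \<in> E" for x
    using that unfolding E_def E1_def by blast
  moreover have "\<exists>j<J. energy M K (block n j) x g (\<lambda>i. - g (x i) / real n) \<le> 2 * ((C * (\<integral>x. (g x)\<^sup>2 \<partial>M) + 1) / real n)" if "x \<in> E" for x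
    using that unfolding E_def E3_def c3_def by blast
  ultimately show ?thesis using lam Es by blast
qed

end

section \<open>The complexity of the sample and the error bound\<close>

lemma A_D_lower_bounds:
  assumes eb: "orthonormal_eigenbasis {..<m} (\<lambda>i j. K (x i) (x j)) \<sigma> u" and \<sigma>: "\<forall>l<m. \<sigma> l > 0"
    and m: "m > 0" and lam: "lam > 0"
  defines "A \<equiv> A_D K m x lam"
  shows "0 \<le> A" "lam \<le> lam * (A + 1)\<^sup>2" "1 / real m \<le> lam * (A + 1)\<^sup>2"
    "(\<Sum>l<m. \<sigma> l / (lam * real m + \<sigma> l)) / real m \<le> lam * (A + 1)\<^sup>2"
proof -
  define N where "N = (\<Sum>l<m. \<sigma> l / (lam * real m + \<sigma> l))"
  define t where "t = real m * lam"
  have t: "t > 0" using m lam by (simp add: t_def)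
  have N0: "N \<ge> 0" unfolding N_def using \<sigma> lam by (intro sum_nonneg divide_nonneg_nonneg add_nonneg_nonneg) (auto simp: less_imp_le)
  have A: "A = (1 / t + 1 / sqrt t) * max 1 (sqrt N)"
    unfolding A_def A_D_def kernel_matrix_def sum_proots_char_poly_eigenbasis[OF eb] N_def t_def ..
  have ge: "1 / sqrt t * max 1 (sqrt N) \<le> A"
    unfolding A using t by (intro mult_right_mono) auto
  have A0: "0 \<le> A" using ge t by (intro order_trans[OF _ ge]) auto
  then show "0 \<le> A" .
  have "1 \<le> (A + 1)\<^sup>2" using A0 by (intro one_le_power) simp
  then show "lam \<le> lam * (A + 1)\<^sup>2" using lam by simp
  have "(1 / sqrt t * max 1 (sqrt N))\<^sup>2 \<le> (A + 1)\<^sup>2"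
    using ge A0 t by (intro power_mono) auto
  then have "lam * ((1 / sqrt t * max 1 (sqrt N))\<^sup>2) \<le> lam * (A + 1)\<^sup>2" using lam by (intro mult_left_mono) auto
  also have "lam * ((1 / sqrt t * max 1 (sqrt N))\<^sup>2) = (max 1 (sqrt N))\<^sup>2 / real m"
    using t m lam by (simp add: power_mult_distrib power_divide t_def)
  finally have b: "(max 1 (sqrt N))\<^sup>2 / real m \<le> lam * (A + 1)\<^sup>2" .
  have "1 \<le> (max 1 (sqrt N))\<^sup>2" by (intro one_le_power) simp
  then have "1 / real m \<le> (max 1 (sqrt N))\<^sup>2 / real m" by (intro divide_right_mono) auto
  then show "1 / real m \<le> lam * (A + 1)\<^sup>2" using b by linarith
  have "(sqrt N)\<^sup>2 \<le> (max 1 (sqrt N))\<^sup>2" using N0 by (intro power_mono) auto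
  then have "N / real m \<le> (max 1 (sqrt N))\<^sup>2 / real m" using N0 by (intro divide_right_mono) auto
  then show "(\<Sum>l<m. \<sigma> l / (lam * real m + \<sigma> l)) / real m \<le> lam * (A + 1)\<^sup>2" using b by (simp add: N_def)
qed

text \<open>This constant, times \<open>ln (16 / \<delta>)\<close> and a lower bound \<open>q\<close> for the complexity term, bounds the ratio of the
  squared \<open>L\<^sup>2\<close> norm of a residual to its energy.  The minimum is the constant of \<open>complexity_ge\<close>, and
  16 is the product of the factor 4 of \<open>vanishing_potential_norm_le\<close> with a factor 4 lost in the division
  of the sample into blocks.  The summand \<open>2 * C\<close> serves samples with fewer points than blocks.\<close>

definition rate_constant :: "real \<Rightarrow> real" where
  "rate_constant C = 2 * C + 16 / min (1 / 2) (1 / (52 * C))"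

lemma rate_constant_ge: "C > 0 \<Longrightarrow> 32 \<le> rate_constant C" "C > 0 \<Longrightarrow> 2 * C \<le> rate_constant C"
proof -
  assume C: "C > 0"
  have p: "0 < min (1 / 2) (1 / (52 * C))" using C by simp
  have "16 / (1 / 2) \<le> 16 / min (1 / 2) (1 / (52 * C))" using p by (intro divide_left_mono) auto
  then show "32 \<le> rate_constant C" "2 * C \<le> rate_constant C" using C p by (auto simp: rate_constant_def)
qed

lemma kernel_matrix_eigenbasis:
  assumes fin: "finite B" and pos: "\<And>b. \<exists>i\<in>B. b i \<noteq> 0 \<Longrightarrow> 0 < (\<Sum>i\<in>B. \<Sum>j\<in>B. b i * b j * A i j)"
    and sym: "\<And>i j. i \<in> B \<Longrightarrow> j \<in> B \<Longrightarrow> A i j = (A j i :: real)"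
  shows "\<exists>\<sigma> u. orthonormal_eigenbasis B A \<sigma> u \<and> (\<forall>l\<in>B. \<sigma> l > 0)"
proof -
  obtain \<sigma> u where eb: "orthonormal_eigenbasis B A \<sigma> u"
    by (rule symmetric_matrix_eigenbasis[OF fin sym])
  have "\<sigma> l > 0" if l: "l \<in> B" for l
  proof -
    have "\<exists>i\<in>B. u l i \<noteq> 0"
    proof (rule ccontr)
      assume "\<not> ?thesis"
      then have "(\<Sum>i\<in>B. u l i * u l i) = 0" by (intro sum.neutral ballI) auto
      then show False using eigenbasis_rows[OF fin eb l l] by simp
    qed
    from pos[OF this] show ?thesis unfolding eigenvalue_as_quadratic_form[OF fin eb l] .
  qed
  with eb show ?thesis by blast
qed

text \<open>There are three regimes.  If \<open>n * lam\<close> is bounded by a multiple of \<open>C\<close>, the lower bound \<open>1 / m\<close> of the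
  complexity term suffices.  If \<open>l * m\<close> exceeds \<open>n * lam / 2\<close>, then \<open>l\<close> itself is large enough.  Otherwise
  the effective dimension of the whole matrix at \<open>l * m\<close> is at least that of a good block at
  \<open>n * lam / 2\<close>, which is at least \<open>1 / 26\<close> of the dimension at \<open>lam / 2\<close> and so at least
  \<open>n * lam / (52 * C)\<close>.\<close>

lemma complexity_ge:
  fixes M :: "point measure"
  assumes "kernel_eigensystem M K C I \<mu> e"
    and C: "C > 0" and n: "n > 0" and J: "J * n \<le> m" and nm: "n \<le> m" and lam: "lam > 0"
    and x: "\<And>i. i < m \<Longrightarrow> x i \<in> space M"
    and pos: "\<And>B b. B \<subseteq> {..<m} \<Longrightarrow> \<exists>i\<in>B. b i \<noteq> 0 \<Longrightarrow> 0 < (\<Sum>i\<in>B. \<Sum>j\<in>B. b i * b j * K (x i) (x j))"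
    and alt: "real n * lam \<le> 48 * C \<or> (real n * (lam / 2) / C \<le> kernel_eigensystem.dimension M K I \<mu> e (lam / 2)
      \<and> 24 \<le> kernel_eigensystem.dimension M K I \<mu> e (lam / 2)
      \<and> (\<exists>j<J. kernel_eigensystem.trace_statistic M K I \<mu> e (lam / 2) (block n j) x
          \<le> 6 * (real n)\<^sup>2 * kernel_eigensystem.dimension M K I \<mu> e (lam / 2)))"
    and l: "l > 0"
  shows "min (1 / 2) (1 / (52 * C)) * (lam * real n / real m) \<le> l * (A_D K m x l + 1)\<^sup>2"
proof -
  interpret kernel_eigensystem M K C I \<mu> e by fact
  have m: "m > 0" using n nm by simp
  define y where "y = lam * real n / real m"
  have y0: "y > 0" using lam n m by (simp add: y_def)
  let ?c = "min (1 / 2) (1 / (52 * C))"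
  have sym: "K (x i) (x j) = K (x j) (x i)" if "i < m" "j < m" for i j
    using kernel_sym[OF bk] x that by auto
  have sym': "K (x i) (x j) = K (x j) (x i)" if "i \<in> {..<m}" "j \<in> {..<m}" for i j
    using sym that by simp
  obtain \<sigma> u where eb: "orthonormal_eigenbasis {..<m} (\<lambda>i j. K (x i) (x j)) \<sigma> u" and \<sigma>: "\<forall>l\<in>{..<m}. \<sigma> l > 0"
    using kernel_matrix_eigenbasis[OF finite_lessThan pos[OF order_refl] sym'] by blast
  have \<sigma>': "\<forall>l<m. \<sigma> l > 0" using \<sigma> by simp
  define Z where "Z = l * (A_D K m x l + 1)\<^sup>2"
  note A = A_D_lower_bounds[OF eb \<sigma>' m l, folded Z_def]
  define c where "c = ?c * y"
  have c1: "c \<le> y / 2" "c \<le> y / (52 * C)"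
    unfolding c_def using mult_right_mono[of ?c "1 / 2" y] mult_right_mono[of ?c "1 / (52 * C)" y] y0 by auto
  have "c \<le> Z"
  proof (cases "real n * lam \<le> 48 * C")
    case True
    have "y \<le> 48 * C / real m" unfolding y_def using True m by (intro divide_right_mono) (auto simp: mult.commute)
    then have "y / (52 * C) \<le> (48 * C / real m) / (52 * C)" using C by (intro divide_right_mono) auto
    also have "\<dots> = (48 / 52) * (1 / real m)" using C by simp
    also have "\<dots> \<le> 1 * (1 / real m)" by (intro mult_right_mono) auto
    finally show ?thesis using c1(2) A(3) by linarith
  next
    case False
    have l2: "lam / 2 > 0" using lam by simp
    from alt False obtain j where D1: "real n * (lam / 2) / C \<le> dimension (lam / 2)" and D2: "24 \<le> dimension (lam / 2)"
      and j: "j < J" and T: "trace_statistic (lam / 2) (block n j) x \<le> 6 * (real n)\<^sup>2 * dimension (lam / 2)"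
      by blast
    show ?thesis
    proof (cases "l * real m \<le> real n * (lam / 2)")
      case False
      then have "real n * (lam / 2) / real m \<le> l" using m by (simp add: pos_divide_le_eq)
      then have "y / 2 \<le> l" by (simp add: y_def mult.commute)
      then show ?thesis using c1(1) A(2) by linarith
    next
      case True
      define B where "B = block n j"
      have sub: "B \<subseteq> {..<m}" unfolding B_def by (rule block(4)[OF j J])
      have finB: "finite B" "B \<noteq> {}" "card B = n" using block(1-3)[of n j] n by (auto simp: B_def)
      have symB: "K (x i) (x j) = K (x j) (x i)" if "i \<in> B" "j \<in> B" for i j
        using sym that sub by auto
      obtain \<tau> v where ebB: "orthonormal_eigenbasis B (\<lambda>i j. K (x i) (x j)) \<tau> v" and \<tau>: "\<forall>l\<in>B. \<tau> l > 0"
        using kernel_matrix_eigenbasis[OF finB(1) pos[OF sub] symB] by blast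
      have xB: "x i \<in> space M" if "i \<in> B" for i using x sub that by auto
      have T': "trace_statistic (lam / 2) B x \<le> 6 * (real (card B))\<^sup>2 * dimension (lam / 2)"
        using T by (simp add: finB B_def[symmetric])
      have "dimension (lam / 2) / 26 \<le> (\<Sum>k\<in>B. \<tau> k / (real (card B) * (lam / 2) + \<tau> k))"
        by (rule effective_dimension_from_trace_statistic[OF l2 finB(1,2) xB T' D2 ebB])
      also have "\<dots> = (\<Sum>k\<in>B. \<tau> k / (real n * (lam / 2) + \<tau> k))" by (simp only: finB)
      also have "\<dots> \<le> (\<Sum>k<m. \<sigma> k / (real n * (lam / 2) + \<sigma> k))"
        using n lam \<sigma> \<tau> by (intro effective_dimension_submatrix_le[OF _ sub eb ebB]) auto
      also have "\<dots> \<le> (\<Sum>k<m. \<sigma> k / (l * real m + \<sigma> k))"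
        using True \<sigma>' l m n lam by (intro sum_mono divide_left_mono) (auto simp: less_imp_le intro!: mult_pos_pos add_pos_pos)
      finally have "dimension (lam / 2) / 26 \<le> (\<Sum>k<m. \<sigma> k / (l * real m + \<sigma> k))" .
      then have "real n * (lam / 2) / C / 26 \<le> (\<Sum>k<m. \<sigma> k / (l * real m + \<sigma> k))"
        by (rule order_trans[rotated]) (rule divide_right_mono[OF D1], simp)
      then have "real n * (lam / 2) / C / 26 / real m \<le> (\<Sum>k<m. \<sigma> k / (l * real m + \<sigma> k)) / real m"
        by (intro divide_right_mono) auto
      moreover have "real n * (lam / 2) / C / 26 / real m = y / (52 * C)" by (simp add: y_def mult_ac)
      ultimately show ?thesis using c1(2) A(4) by linarith
    qed
  qed
  then show ?thesis by (simp only: c_def y_def Z_def)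
qed

context kernel_eigensystem
begin

lemma residual_low:
  fixes x :: "'i \<Rightarrow> 'a"
  assumes fin: "finite B" and x: "\<And>i. i \<in> B \<Longrightarrow> x i \<in> space M" and Q: "Q > 0"
    and V: "(\<integral>t. (potential M K (source r h (head N)) B b x t)\<^sup>2 \<partial>M) \<le> Q * energy M K B x (source r h (head N)) b"
    and vanish: "\<And>i. i \<in> B \<Longrightarrow> potential M K (source r h (head N)) B b x (x i) = 0"
    and H: "(\<Sum>k\<in>head N. (h k)\<^sup>2) \<le> H" and r: "1 / 2 \<le> r" "r \<le> 1"
  shows "L2_norm M (potential M K (source r h (head N)) B b x) \<le> sqrt (2 * H) * Q powr r"
proof -
  have "(\<integral>t. (potential M K (source r h (head N)) B b x t)\<^sup>2 \<partial>M) \<le> 2 * (\<Sum>k\<in>head N. (h k)\<^sup>2) * Q powr (2 * r)"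
    using V vanish unfolding source_def[abs_def]
    by (intro source_condition_low[OF fin x head r Q]) auto
  also have "\<dots> \<le> 2 * H * Q powr (2 * r)" using H by (intro mult_right_mono) auto
  also have "\<dots> = (2 * H) * (Q powr r)\<^sup>2" by (simp add: power2_eq_square powr_add[symmetric])
  finally have "L2_norm M (potential M K (source r h (head N)) B b x) \<le> sqrt ((2 * H) * (Q powr r)\<^sup>2)"
    unfolding L2_norm_def by (rule real_sqrt_le_mono)
  then show ?thesis by (simp add: real_sqrt_mult)
qed

text \<open>The comparison coefficients only have to fit the source up to \<open>N0\<close>; the components beyond \<open>N0\<close> are
  paid for with their own energy.  This allows coefficients, and events for the sample, that do not
  depend on \<open>N\<close>.\<close>

lemma residual_energy_le:
  fixes x :: "'i \<Rightarrow> 'a"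
  assumes fin: "finite B" and x: "\<And>i. i \<in> B \<Longrightarrow> x i \<in> space M" and r: "1 / 2 \<le> r"
    and vanish: "\<And>i. i \<in> B \<Longrightarrow> potential M K (source r h (head N)) B b x (x i) = 0"
    and N: "N0 \<le> N"
  shows "energy M K B x (source r h (head N)) b
    \<le> 2 * energy M K B x (source r h (head N0)) b' + 2 * (C powr (2 * r - 1) * ((\<Sum>k\<in>head N. (h k)\<^sup>2) - (\<Sum>k\<in>head N0. (h k)\<^sup>2)))"
proof -
  let ?F = "head N - head N0"
  have F: "finite ?F" "?F \<subseteq> I" "\<And>k. k \<in> ?F \<Longrightarrow> \<mu> k > 0" using head by auto
  have eq: "source r h (head N) = (\<lambda>x. source r h (head N0) x + source r h ?F x)"
    by (rule ext) (rule source_split[OF head_mono[OF N] head(1)])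
  have "energy M K B x (source r h (head N)) b \<le> energy M K B x (source r h (head N)) b'"
    by (rule vanishing_energy_minimal[OF fin x source_L2[OF head(2)] vanish])
  also have "\<dots> \<le> 2 * energy M K B x (source r h (head N0)) b' + 2 * energy M K B x (source r h ?F) (\<lambda>_. 0)"
    unfolding eq by (rule energy_add_le[OF fin x source_L2[OF head(2)] source_L2[OF F(2)]])
  also have "energy M K B x (source r h ?F) (\<lambda>_. 0) \<le> C powr (2 * r - 1) * (\<Sum>k\<in>?F. (h k)\<^sup>2)"
    unfolding source_def[abs_def] by (rule source_energy_le[OF F r])
  also have "(\<Sum>k\<in>?F. (h k)\<^sup>2) = (\<Sum>k\<in>head N. (h k)\<^sup>2) - (\<Sum>k\<in>head N0. (h k)\<^sup>2)"
    by (rule sum_diff[OF head(1) head_mono[OF N]])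
  finally show ?thesis by simp
qed

lemma residual_energy_trivial:
  fixes x :: "'i \<Rightarrow> 'a"
  assumes fin: "finite B" and x: "\<And>i. i \<in> B \<Longrightarrow> x i \<in> space M" and r: "1 / 2 \<le> r"
    and vanish: "\<And>i. i \<in> B \<Longrightarrow> potential M K (source r h (head N)) B b x (x i) = 0"
    and H: "(\<Sum>k\<in>head N. (h k)\<^sup>2) \<le> H"
  shows "energy M K B x (source r h (head N)) b \<le> C powr (2 * r - 1) * H"
proof -
  have "energy M K B x (source r h (head N)) b \<le> energy M K B x (source r h (head N)) (\<lambda>_. 0)"
    by (rule vanishing_energy_minimal[OF fin x source_L2[OF head(2)] vanish])
  also have "\<dots> \<le> C powr (2 * r - 1) * (\<Sum>k\<in>head N. (h k)\<^sup>2)"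
    unfolding source_def[abs_def] by (rule source_energy_le[OF head r])
  also have "\<dots> \<le> C powr (2 * r - 1) * H" using H by (rule mult_left_mono) simp
  finally show ?thesis .
qed

lemma head_tail_small:
  fixes h :: "nat \<Rightarrow> real"
  assumes H: "\<And>N. (\<Sum>k\<in>head N. (h k)\<^sup>2) \<le> H" and \<epsilon>: "\<epsilon> > 0"
  obtains N0 where "\<And>N. (\<Sum>k\<in>head N. (h k)\<^sup>2) - (\<Sum>k\<in>head N0. (h k)\<^sup>2) \<le> \<epsilon>"
proof -
  define a where "a N = (\<Sum>k\<in>head N. (h k)\<^sup>2)" for N
  have "incseq a"
    unfolding a_def by (intro incseq_SucI sum_mono2 head head_mono) auto
  then obtain A where A: "a \<longlonglongrightarrow> A" "\<And>N. a N \<le> A"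
    using incseq_convergent[of a H] H unfolding a_def by blast
  obtain N0 where N0: "\<And>N. N \<ge> N0 \<Longrightarrow> norm (a N - A) < \<epsilon>" using LIMSEQ_D[OF A(1) \<epsilon>] by blast
  have "a N - a N0 \<le> \<epsilon>" for N
    using N0[OF order_refl] A(2)[of N] A(2)[of N0] unfolding real_norm_def by linarith
  then show thesis by (intro that[of N0]) (simp only: a_def)
qed

end

lemma interpolant_error_le:
  fixes M :: "point measure"
  assumes "kernel_eigensystem M K C I \<mu> e" and f: "f \<in> L2_space M"
    and x: "\<And>i. i < m \<Longrightarrow> x i \<in> space M"
    and pos: "\<And>b. \<exists>i<m. b i \<noteq> 0 \<Longrightarrow> 0 < (\<Sum>i<m. \<Sum>j<m. b i * b j * K (x i) (x j))"
    and y: "\<And>i. i < m \<Longrightarrow> y i = f (x i)" and gN: "\<And>N. g N \<in> L2_space M"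
    and pt: "\<And>i. i < m \<Longrightarrow> (\<lambda>N. \<integral>t. g N t * K t (x i) \<partial>M) \<longlonglongrightarrow> f (x i)"
    and mean: "(\<lambda>N. L2_norm M (\<lambda>x. f x - (\<integral>t. g N t * K t x \<partial>M))) \<longlonglongrightarrow> 0"
    and bound: "\<And>N b. N \<ge> N0 \<Longrightarrow> (\<And>i. i < m \<Longrightarrow> potential M K (g N) {..<m} b x (x i) = 0) \<Longrightarrow>
      L2_norm M (potential M K (g N) {..<m} b x) \<le> R"
  shows "L2_norm M (\<lambda>t. interpolant K m x y t - f t) \<le> R"
proof -
  interpret kernel_eigensystem M K C I \<mu> e by fact
  have nz: "(\<Sum>i<m. \<Sum>j<m. v i * v j * K (x i) (x j)) \<noteq> 0" if "\<exists>i<m. v i \<noteq> 0" for v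
    using pos[OF that] by simp
  obtain W where W: "\<And>y j. j < m \<Longrightarrow> vec_index (the (mat_inverse (Matrix.mat m m (\<lambda>(i, j). K (x i) (x j)))) *\<^sub>v Matrix.vec m y) j = (\<Sum>i<m. W j i * y i)"
    and solves: "\<And>y i. i < m \<Longrightarrow> (\<Sum>j<m. K (x i) (x j) * (\<Sum>k<m. W j k * y k)) = y i"
    using mat_inverse_linear[of m "\<lambda>i j. K (x i) (x j)", OF nz] by blast
  have int: "interpolant K m x y = (\<lambda>t. \<Sum>j<m. (\<Sum>i<m. W j i * f (x i)) * K (x j) t)"
    unfolding interpolant_def kernel_matrix_def Let_def
    by (rule ext, rule sum.cong[OF refl]) (simp add: W y)
  have xx: "\<And>i. i \<in> {..<m} \<Longrightarrow> x i \<in> space M" using x by simp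
  have ptt: "\<And>i. i \<in> {..<m} \<Longrightarrow> (\<lambda>N. \<integral>t. g N t * K t (x i) \<partial>M) \<longlonglongrightarrow> f (x i)" using pt by simp
  show ?thesis
    unfolding int
  proof (rule interpolation_error_limit[OF finite_lessThan xx f gN ptt mean])
    fix N assume N: "N0 \<le> N"
    let ?s = "\<lambda>i. \<integral>t. g N t * K t (x i) \<partial>M"
    show "L2_norm M (potential M K (g N) {..<m} (\<lambda>j. - (\<Sum>i<m. W j i * ?s i)) x) \<le> R"
    proof (rule bound[OF N])
      fix i assume i: "i < m"
      define a where "a j = (\<Sum>k<m. W j k * ?s k)" for j
      have "(\<Sum>j<m. (- a j) * K (x j) (x i)) = - (\<Sum>j<m. K (x i) (x j) * a j)"
        unfolding sum_negf[symmetric]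
      proof (intro sum.cong refl)
        fix j assume "j \<in> {..<m}"
        then show "(- a j) * K (x j) (x i) = - (K (x i) (x j) * a j)"
          using kernel_sym[OF bk x x, of j i] i by simp
      qed
      also have "\<dots> = - ?s i" unfolding a_def solves[OF i] ..
      finally show "potential M K (g N) {..<m} (\<lambda>j. - (\<Sum>i<m. W j i * ?s i)) x (x i) = 0"
        unfolding potential_def a_def by simp
    qed
  qed
qed

text \<open>The number of blocks for which three events with exceptional probability \<open>2 ^ - J\<close> hold together with
  confidence \<open>1 - \<delta>\<close>.\<close>

lemma block_count:
  assumes "0 < \<delta>" "\<delta> < (1 :: real)"
  defines "J \<equiv> nat \<lceil>log 2 (3 / \<delta>)\<rceil>"
  shows "0 < J" "real J \<le> 2 * ln (16 / \<delta>)" "1 - \<delta> \<le> 1 - 3 * (1 / 2) ^ J" "1 \<le> ln (16 / \<delta>)"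
proof -
  have big: "3 / \<delta> > 3" using assms by (simp add: less_divide_eq)
  have lg: "log 2 (3 / \<delta>) > 0"
    using big assms(1,2) zero_less_log_cancel_iff[of 2 "3 / \<delta>"] by simp
  then show "0 < J" by (simp add: J_def)
  have "real J \<le> log 2 (3 / \<delta>) + 1" using lg unfolding J_def by linarith
  also have "\<dots> = log 2 (6 / \<delta>)"
    using assms(1) log_mult[of 2 "3 / \<delta>" 2] by simp
  also have "\<dots> = ln (6 / \<delta>) / ln 2" by (simp add: log_def)
  also have "\<dots> \<le> ln (6 / \<delta>) / (1 / 2)"
    using ln2_ge_two_thirds assms by (intro divide_left_mono) (auto simp: field_simps)
  also have "\<dots> \<le> 2 * ln (16 / \<delta>)"
    using assms by (simp add: divide_right_mono)
  finally show "real J \<le> 2 * ln (16 / \<delta>)" .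
  have "3 / \<delta> = 2 powr (log 2 (3 / \<delta>))" using assms by simp
  also have "\<dots> \<le> 2 powr real J" unfolding J_def by (intro powr_mono) (auto simp: real_nat_ceiling_ge)
  also have "\<dots> = 2 ^ J" by (simp add: powr_realpow)
  finally have "3 / \<delta> \<le> 2 ^ J" .
  then have "3 * (1 / 2) ^ J \<le> \<delta>" using assms(1) by (simp add: field_simps power_divide)
  then show "1 - \<delta> \<le> 1 - 3 * (1 / 2) ^ J" by simp
  have "exp 1 \<le> (16 :: real)" using exp_le by simp
  also have "\<dots> \<le> 16 / \<delta>" using assms by (simp add: le_divide_eq)
  finally show "1 \<le> ln (16 / \<delta>)" using assms by (subst ln_ge_iff) auto
qed

text \<open>The first summand covers \<open>r \<le> 1\<close> and comes from \<open>source_condition_low\<close>.  The second covers \<open>r > 1\<close>, where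
  the energy is at most \<open>\<Theta> * ln (16 / \<delta>) / m\<close> with \<open>\<Theta>\<close> the second factor under the root: \<open>16\<close> collects the
  factors 2 from splitting off the tail of the source, 2 from Markov's inequality, and 4 from the ratio
  of \<open>m\<close> to the block length, while \<open>2 * (\<kappa>\<^sup>2) powr (2 * r - 1)\<close> is the contribution of the tail.\<close>

definition error_constant :: "real \<Rightarrow> real \<Rightarrow> real \<Rightarrow> real" where
  "error_constant \<kappa> \<eta> r =
    sqrt 2 * \<eta> * rate_constant (\<kappa>\<^sup>2) powr r
    + sqrt (rate_constant (\<kappa>\<^sup>2) * (16 * (\<kappa>\<^sup>2) powr (2 * r - 1) * \<eta>\<^sup>2 + 16 + 2 * (\<kappa>\<^sup>2) powr (2 * r - 1)))"

lemma rate_bound_low: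
  assumes q: "q > 0" "\<And>lam. lam > 0 \<Longrightarrow> 0 \<le> A lam \<and> q \<le> lam * (A lam + 1)\<^sup>2"
    and r: "1 / 2 \<le> r" "r \<le> (1 :: real)" and L: "1 \<le> L" and G: "G > 0" and c: "c * G powr r \<le> c'" "0 \<le> c"
  shows "c * (G * L * q) powr r \<le> c' * L ^ 6 * (INF lam\<in>{0<..}. lam powr r * (A lam + 1) powr (2 * r))"
proof -
  have inf: "q powr r \<le> (INF lam\<in>{0<..}. lam powr r * (A lam + 1) powr (2 * r))"
  proof (rule cINF_greatest)
    fix lam :: real assume "lam \<in> {0<..}"
    then have l: "lam > 0" by simp
    have A: "0 \<le> A lam" "q \<le> lam * (A lam + 1)\<^sup>2" using q(2)[OF l] by auto
    have "q powr r \<le> (lam * (A lam + 1)\<^sup>2) powr r" using q(1) A r by (intro powr_mono2) auto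
    also have "\<dots> = lam powr r * ((A lam + 1)\<^sup>2) powr r" using l A by (simp add: powr_mult)
    also have "((A lam + 1)\<^sup>2) powr r = (A lam + 1) powr (2 * r)"
      using A by (simp add: powr_powr powr_realpow[symmetric] flip: powr_numeral)
    finally show "q powr r \<le> lam powr r * (A lam + 1) powr (2 * r)" .
  qed simp
  have "c * (G * L * q) powr r = (c * G powr r) * L powr r * q powr r"
    using G L q(1) by (simp add: powr_mult mult_ac)
  also have "\<dots> \<le> c' * L powr 6 * (INF lam\<in>{0<..}. lam powr r * (A lam + 1) powr (2 * r))"
    using c L r inf G by (intro mult_mono powr_mono mult_nonneg_nonneg) (auto intro: order_trans[OF _ c(1)])
  also have "L powr 6 = L ^ 6" using L powr_realpow[of L 6] by simp
  finally show ?thesis .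
qed

lemma rate_bound_high:
  assumes q: "q > 0" "\<And>lam. lam > 0 \<Longrightarrow> 0 \<le> A lam \<and> q \<le> lam * (A lam + 1)\<^sup>2"
    and L: "1 \<le> L" and G: "G > 0" and T: "T > 0" and m: "m > (0 :: real)" and c: "sqrt (G * T) \<le> c'"
  shows "sqrt (G * L * q * (T * L / m)) \<le> c' * L ^ 6 * (1 / sqrt m * (INF lam\<in>{0<..}. sqrt lam * (A lam + 1)))"
proof -
  have inf: "sqrt q \<le> (INF lam\<in>{0<..}. sqrt lam * (A lam + 1))"
  proof (rule cINF_greatest)
    fix lam :: real assume "lam \<in> {0<..}"
    then have l: "lam > 0" by simp
    have A: "0 \<le> A lam" "q \<le> lam * (A lam + 1)\<^sup>2" using q(2)[OF l] by auto
    have "sqrt q \<le> sqrt (lam * (A lam + 1)\<^sup>2)" using A(2) by (rule real_sqrt_le_mono)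
    also have "\<dots> = sqrt lam * (A lam + 1)" using A(1) by (simp add: real_sqrt_mult)
    finally show "sqrt q \<le> sqrt lam * (A lam + 1)" .
  qed simp
  have "G * L * q * (T * L / m) = (G * T) * L\<^sup>2 * (q / m)" by (simp add: power2_eq_square)
  then have "sqrt (G * L * q * (T * L / m)) = sqrt (G * T) * L * (1 / sqrt m * sqrt q)"
    using L by (simp only: real_sqrt_mult real_sqrt_divide) (simp add: mult_ac)
  also have "\<dots> \<le> c' * L ^ 6 * (1 / sqrt m * (INF lam\<in>{0<..}. sqrt lam * (A lam + 1)))"
  proof -
    have c0: "0 \<le> c'" using c G T by (intro order_trans[OF _ c]) simp
    have "L ^ 1 \<le> L ^ 6" using L by (intro power_increasing) auto
    then have "L \<le> L ^ 6" by simp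
    then have 1: "sqrt (G * T) * L \<le> c' * L ^ 6" using L by (intro mult_mono[OF c _ c0]) auto
    have 2: "1 / sqrt m * sqrt q \<le> 1 / sqrt m * (INF lam\<in>{0<..}. sqrt lam * (A lam + 1))"
      using m by (intro mult_left_mono[OF inf]) simp
    show ?thesis using c0 L m q(1) by (intro mult_mono[OF 1 2]) auto
  qed
  finally show ?thesis .
qed

text \<open>Since the sample has to be good for all truncations at once, the event is built from the scale and
  from one fixed truncation only; the null set where two sample points coincide or the expansion fails
  to converge at a sample point is removed from it at the end.\<close>

theorem interpolation_error_event:
  fixes X :: "point set" and K :: kernel and \<rho> :: "point measure" and h f :: "point \<Rightarrow> real"
  assumes X: "compact X" and cont: "continuous_on (X \<times> X) (\<lambda>(x, x'). K x x')"
    and sym: "symmetric_kernel X K" and spd: "strictly_positive_definite X K"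
    and ps: "prob_space \<rho>" and sets: "sets \<rho> = sets (restrict_space borel X)"
    and h: "h \<in> L2_space \<rho>" and r: "1 / 2 \<le> r" and pow: "is_LK_power K \<rho> r h f"
    and m: "1 \<le> m" and \<delta>: "0 < \<delta>" "\<delta> < 1"
    and inj: "AE x in PiM {..<m} (\<lambda>_. \<rho>). inj_on x {..<m}"
  shows "\<exists>E \<in> sets (PiM {..<m} (\<lambda>_. \<rho>)). measure (PiM {..<m} (\<lambda>_. \<rho>)) E \<ge> 1 - \<delta> \<and>
        (\<forall>x \<in> E. \<forall>y. (\<forall>i<m. y i = f (x i)) \<longrightarrow>
          L2_norm \<rho> (\<lambda>t. interpolant K m x y t - f t)
            \<le> error_constant (kappa X K) (L2_norm \<rho> h) r * (ln (16 / \<delta>)) ^ 6 *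
              (if r \<le> 1
               then (INF lam\<in>{0<..}. lam powr r * (A_D K m x lam + 1) powr (2 * r))
               else 1 / sqrt (real m) * (INF lam\<in>{0<..}. sqrt lam * (A_D K m x lam + 1))))"
proof -
  interpret prob_space \<rho> by (rule ps)
  let ?S = "PiM {..<m} (\<lambda>_. \<rho>)"
  interpret S: prob_space ?S by (rule prob_space_sample)
  have sp: "space \<rho> = X" using sets_eq_imp_space_eq[OF sets] by (simp add: space_restrict_space)
  have Xne: "X \<noteq> {}" using not_empty sp by simp
  define C where "C = (kappa X K)\<^sup>2"
  have C: "C > 0" unfolding C_def using kernel_kappa(1)[OF X Xne cont spd] by simp
  have bk: "bounded_psd_kernel \<rho> K C"
    unfolding bounded_psd_kernel_def sp C_def
    using strictly_positive_definite_imp_psd[OF sym spd] continuous_kernel_measurable[OF cont sets]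
      kernel_kappa(2)[OF X Xne cont spd] by blast
  have f: "f \<in> L2_space \<rho>" using pow by (simp add: is_LK_power_def)
  obtain I \<mu> e where eb: "LK_eigenbasis K \<rho> I \<mu> e"
    and lim: "(\<lambda>n. L2_norm \<rho> (\<lambda>x. f x - (\<Sum>k\<in>I \<inter> {..<n}. \<mu> k powr r * L2_inner \<rho> h (e k) * e k x))) \<longlonglongrightarrow> 0"
    using pow unfolding is_LK_power_def by blast
  have on: "orthonormal_family \<rho> I e"
    using eb unfolding LK_eigenbasis_def orthonormal_family_def L2_inner_def by blast
  have sys: "kernel_eigensystem \<rho> K C I \<mu> e"
  proof unfold_locales
    show "bounded_psd_kernel \<rho> K C" by (rule bk)
    show "orthonormal_family \<rho> I e" by (rule on)
    show "AE x in \<rho>. g x = 0" if "g \<in> L2_space \<rho>" "\<And>k. k \<in> I \<Longrightarrow> (\<integral>x. g x * e k x \<partial>\<rho>) = 0" for g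
      using eb that unfolding LK_eigenbasis_def L2_inner_def by blast
    show "AE x in \<rho>. (\<integral>y. e k y * K y x \<partial>\<rho>) = \<mu> k * e k x" if "k \<in> I" for k
      using eb that unfolding LK_eigenbasis_def LK_def by blast
  qed
  interpret kernel_eigensystem \<rho> K C I \<mu> e by (rule sys)
  define hk where "hk k = L2_inner \<rho> h (e k)" for k
  define H where "H = (L2_norm \<rho> h)\<^sup>2"
  define g where "g N = source r hk (head N)" for N
  have gL2: "g N \<in> L2_space \<rho>" for N unfolding g_def by (rule source_L2[OF head(2)])
  have Hb: "(\<Sum>k\<in>head N. (hk k)\<^sup>2) \<le> H" for N
    unfolding hk_def H_def L2_inner_def L2_norm_power2 by (rule Bessel_inequality[OF on head(1,2) h])
  have H0: "H \<ge> 0" by (simp add: H_def)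
  note conv = operator_source_converges_AE[OF r f Hb lim[folded hk_def], folded g_def]
  define L where "L = ln (16 / \<delta>)"
  define J where "J = nat \<lceil>log 2 (3 / \<delta>)\<rceil>"
  have J: "0 < J" "real J \<le> 2 * L" "1 - \<delta> \<le> 1 - 3 * (1 / 2) ^ J" and L: "1 \<le> L"
    unfolding J_def L_def by (rule block_count[OF \<delta>])+
  define G where "G = rate_constant C"
  define T where "T = C powr (2 * r - 1)"
  define \<Theta> where "\<Theta> = 16 * T * H + 16 + 2 * T"
  have T0: "T \<ge> 0" by (simp add: T_def)
  have G: "G \<ge> 32" "G \<ge> 2 * C" unfolding G_def using rate_constant_ge[OF C] by auto
  have TH: "T * H \<ge> 0" using T0 H0 by simp
  have \<Theta>: "\<Theta> > 0" "16 * (T * H) \<le> \<Theta>" unfolding \<Theta>_def using TH T0 by auto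
  have m0: "real m > 0" using m by simp
  define nice where "nice x \<longleftrightarrow> inj_on x {..<m} \<and> (\<forall>i<m. (\<lambda>N. \<integral>y. g N y * K y (x i) \<partial>\<rho>) \<longlonglongrightarrow> f (x i))" for x
  have "AE x in ?S. \<forall>i\<in>{..<m}. (\<lambda>N. \<integral>y. g N y * K y (x i) \<partial>\<rho>) \<longlonglongrightarrow> f (x i)"
    using conv(1) ps by (intro AE_finite_allI AE_PiM_component[where P = "\<lambda>t. (\<lambda>N. \<integral>y. g N y * K y t \<partial>\<rho>) \<longlonglongrightarrow> f t"]) auto
  with inj have "AE x in ?S. nice x" by eventually_elim (simp add: nice_def)
  then obtain Z where Z: "{x \<in> space ?S. \<not> nice x} \<subseteq> Z" "emeasure ?S Z = 0" "Z \<in> sets ?S"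
    by (rule AE_E)

  \<comment> \<open>Here \<open>q\<close> is a lower bound for the complexity term at every parameter, and up to \<open>G * L\<close> also
    compares the squared norm of the residuals with their energy.\<close>
  define good where "good x q N0 \<longleftrightarrow> q > 0 \<and> (\<forall>l>0. q \<le> l * (A_D K m x l + 1)\<^sup>2) \<and>
      (\<forall>N\<ge>N0. \<forall>b. (\<forall>i<m. potential \<rho> K (g N) {..<m} b x (x i) = 0) \<longrightarrow>
        (\<integral>t. (potential \<rho> K (g N) {..<m} b x t)\<^sup>2 \<partial>\<rho>) \<le> G * L * q * energy \<rho> K {..<m} x (g N) b \<and>
        (r > 1 \<longrightarrow> energy \<rho> K {..<m} x (g N) b \<le> \<Theta> * L / real m))" for x q N0
  have sample_in: "x i \<in> space \<rho>" if "x \<in> space ?S" "i < m" for x i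
    using that by (auto simp: space_PiM PiE_def)
  have pos: "0 < (\<Sum>i\<in>B. \<Sum>j\<in>B. b i * b j * K (x i) (x j))"
    if "x \<in> space ?S" "inj_on x {..<m}" "B \<subseteq> {..<m}" "\<exists>i\<in>B. b i \<noteq> 0" for x B and b :: "nat \<Rightarrow> real"
    by (rule strictly_positive_definite_family[OF spd])
      (use that sample_in sp in \<open>auto intro: finite_subset inj_on_subset\<close>)
  have "\<exists>E\<in>sets ?S. measure ?S E \<ge> 1 - \<delta> \<and> (\<forall>x\<in>E. nice x \<longrightarrow> (\<exists>q N0. good x q N0))"
  proof (cases "m < J")
    case True
    \<comment> \<open>Then \<open>1 / m\<close> is at least of order \<open>1 / L\<close>, and the trivial bounds of norm and energy suffice.\<close>
    have mL: "real m \<le> 2 * L" using True J(2) by linarith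
    have "\<exists>q N0. good x q N0" if x: "x \<in> space ?S" and nx: "nice x" for x
    proof -
      have inj': "inj_on x {..<m}" using nx by (simp add: nice_def)
      have xx: "\<And>i. i \<in> {..<m} \<Longrightarrow> x i \<in> space \<rho>" using sample_in[OF x] by simp
      have sym': "K (x i) (x j) = K (x j) (x i)" if "i \<in> {..<m}" "j \<in> {..<m}" for i j
        using kernel_sym[OF bk xx xx] that by simp
      obtain \<sigma> u where ebm: "orthonormal_eigenbasis {..<m} (\<lambda>i j. K (x i) (x j)) \<sigma> u" and \<sigma>: "\<forall>l\<in>{..<m}. \<sigma> l > 0"
        using kernel_matrix_eigenbasis[OF finite_lessThan pos[OF x inj' order_refl] sym'] by blast
      have \<sigma>': "\<forall>l<m. \<sigma> l > 0" using \<sigma> by simp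
      have m': "m > 0" using m by simp
      have "good x (1 / real m) 0"
        unfolding good_def
      proof (intro conjI allI impI)
        show "0 < 1 / real m" using m0 by simp
        show "1 / real m \<le> l * (A_D K m x l + 1)\<^sup>2" if "l > 0" for l
          by (rule A_D_lower_bounds(3)[OF ebm \<sigma>' m' that])
        fix N b assume "\<forall>i<m. potential \<rho> K (g N) {..<m} b x (x i) = 0"
        then have v: "potential \<rho> K (g N) {..<m} b x (x i) = 0" if "i \<in> {..<m}" for i
          using that by simp
        have E0: "0 \<le> energy \<rho> K {..<m} x (g N) b" by (rule energy_nonneg[OF bk finite_lessThan xx gL2])
        have "C \<le> G * L * (1 / real m)"
        proof -
          have "real m * C \<le> (2 * L) * C" using mL C by (intro mult_right_mono) auto
          also have "\<dots> = (2 * C) * L" by simp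
          also have "\<dots> \<le> G * L" using G(2) L by (intro mult_right_mono) auto
          finally show ?thesis using m0 by (simp add: field_simps)
        qed
        then have "C * energy \<rho> K {..<m} x (g N) b \<le> G * L * (1 / real m) * energy \<rho> K {..<m} x (g N) b"
          using E0 by (rule mult_right_mono)
        from order_trans[OF potential_square_integral_le[OF bk finite_lessThan xx gL2] this]
        show "(\<integral>t. (potential \<rho> K (g N) {..<m} b x t)\<^sup>2 \<partial>\<rho>) \<le> G * L * (1 / real m) * energy \<rho> K {..<m} x (g N) b" .
        have "energy \<rho> K {..<m} x (g N) b \<le> T * H"
          unfolding T_def g_def
          by (rule residual_energy_trivial[OF finite_lessThan xx r v[unfolded g_def] Hb])
        also have "\<dots> \<le> \<Theta> * L / real m"
        proof -
          have "(T * H) * real m \<le> (T * H) * (2 * L)" using mL TH by (intro mult_left_mono) auto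
          also have "\<dots> = (2 * (T * H)) * L" by simp
          also have "\<dots> \<le> \<Theta> * L" using \<Theta>(2) TH L by (intro mult_right_mono) auto
          finally show ?thesis using m0 by (simp add: pos_le_divide_eq)
        qed
        finally show "energy \<rho> K {..<m} x (g N) b \<le> \<Theta> * L / real m" .
      qed
      then show ?thesis by blast
    qed
    moreover have "measure ?S (space ?S) \<ge> 1 - \<delta>" using \<delta> by (simp add: S.prob_space)
    ultimately show ?thesis by (intro bexI[of _ "space ?S"]) auto
  next
    case False
    define n where "n = m div J"
    have n: "n > 0" unfolding n_def using False J(1) by (simp add: div_greater_zero_iff)
    have Jn: "J * n \<le> m" unfolding n_def by simp
    have nm: "n \<le> m" unfolding n_def by simp
    have mn: "real m \<le> 4 * L * real n"
    proof -
      have "m < J * n + J" unfolding n_def using J(1) by (metis dividend_less_times_div add.commute mult_Suc_right)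
      also have "\<dots> \<le> 2 * J * n" using n J(1) by simp
      finally have "real m \<le> real (2 * J * n)" by linarith
      also have "\<dots> = 2 * real J * real n" by simp
      also have "\<dots> \<le> 2 * (2 * L) * real n" using J(2) by (intro mult_right_mono mult_left_mono) auto
      finally show ?thesis by simp
    qed
    \<comment> \<open>The truncation at \<open>N0\<close> is fixed before the event, which involves the source \<open>g N0\<close>; the tail
      is small compared with the energy that is aimed at.\<close>
    obtain N0 where N0: "\<And>N. (\<Sum>k\<in>head N. (hk k)\<^sup>2) - (\<Sum>k\<in>head N0. (hk k)\<^sup>2) \<le> 1 / real m"
      using head_tail_small[OF Hb, of "1 / real m"] m0 by (metis zero_less_divide_1_iff)
    have m': "m > 0" using m by simp
    obtain lam E where lam: "lam > 0" and E: "E \<in> sets ?S" "measure ?S E \<ge> 1 - 3 * (1 / 2) ^ J"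
      and E1: "\<forall>x\<in>E. \<exists>j<J. energy \<rho> (\<lambda>x y. capped lam x y * K x y) (block n j) x (\<lambda>_. 1) (\<lambda>_. - 1 / real n) \<le> 2 * lam"
      and E3: "\<forall>x\<in>E. \<exists>j<J. energy \<rho> K (block n j) x (g N0) (\<lambda>i. - g N0 (x i) / real n) \<le> 2 * ((C * (\<integral>x. (g N0 x)\<^sup>2 \<partial>\<rho>) + 1) / real n)"
      and E2: "real n * lam \<le> 48 * C \<or> (real n * (lam / 2) / C \<le> dimension (lam / 2) \<and> 24 \<le> dimension (lam / 2) \<and>
        (\<forall>x\<in>E. \<exists>j<J. trace_statistic (lam / 2) (block n j) x \<le> 6 * (real n)\<^sup>2 * dimension (lam / 2)))"
      using good_sample_event[OF C n Jn m' gL2[of N0]] by blast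
    define c1 where "c1 = min (1 / 2) (1 / (52 * C))"
    have c1: "c1 > 0" unfolding c1_def using C by simp
    define q where "q = c1 * (lam * real n / real m)"
    have q0: "q > 0" unfolding q_def using c1 lam n m0 by simp
    have lamq: "4 * lam \<le> G * L * q"
    proof -
      have "lam * real m \<le> lam * (4 * L * real n)" using mn lam by (intro mult_left_mono) auto
      then have "lam \<le> 4 * L * (lam * real n / real m)" using m0 by (simp add: field_simps)
      also have "\<dots> = 4 * L * (q / c1)" unfolding q_def using c1 by simp
      finally have "4 * lam \<le> 4 * (4 * L * (q / c1))" by linarith
      also have "\<dots> = (16 / c1) * (L * q)" by simp
      also have "\<dots> \<le> G * (L * q)"
        unfolding G_def rate_constant_def c1_def[symmetric] using C L q0 by (intro mult_right_mono) auto
      finally show ?thesis by simp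
    qed
    have "\<exists>q N0. good x q N0" if xE: "x \<in> E" and nx: "nice x" for x
    proof -
      have x: "x \<in> space ?S" using xE sets.sets_into_space[OF E(1)] by auto
      have inj': "inj_on x {..<m}" using nx by (simp add: nice_def)
      have xx: "\<And>i. i \<in> {..<m} \<Longrightarrow> x i \<in> space \<rho>" using sample_in[OF x] by simp
      have alt: "real n * lam \<le> 48 * C \<or> (real n * (lam / 2) / C \<le> dimension (lam / 2) \<and> 24 \<le> dimension (lam / 2) \<and>
          (\<exists>j<J. trace_statistic (lam / 2) (block n j) x \<le> 6 * (real n)\<^sup>2 * dimension (lam / 2)))"
        using E2 xE by blast
      obtain j1 where j1: "j1 < J" "energy \<rho> (\<lambda>x y. capped lam x y * K x y) (block n j1) x (\<lambda>_. 1) (\<lambda>_. - 1 / real n) \<le> 2 * lam"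
        using E1 xE by blast
      obtain j3 where j3: "j3 < J" "energy \<rho> K (block n j3) x (g N0) (\<lambda>i. - g N0 (x i) / real n) \<le> 2 * ((C * (\<integral>x. (g N0 x)\<^sup>2 \<partial>\<rho>) + 1) / real n)"
        using E3 xE by blast
      have "good x q N0"
        unfolding good_def
      proof (intro conjI allI impI)
        show "0 < q" by (rule q0)
        show "q \<le> l * (A_D K m x l + 1)\<^sup>2" if "l > 0" for l
          unfolding q_def c1_def
          by (rule complexity_ge[OF sys C n Jn nm lam sample_in[OF x] pos[OF x inj'] alt that])
        fix N b assume N: "N0 \<le> N" and "\<forall>i<m. potential \<rho> K (g N) {..<m} b x (x i) = 0"
        then have v: "potential \<rho> K (g N) {..<m} b x (x i) = 0" if "i \<in> {..<m}" for i
          using that by simp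
        have E0: "0 \<le> energy \<rho> K {..<m} x (g N) b" by (rule energy_nonneg[OF bk finite_lessThan xx gL2])
        have sub: "block n j1 \<subseteq> {..<m}" by (rule block(4)[OF j1(1) Jn])
        have "(\<integral>t. (potential \<rho> K (g N) {..<m} b x t)\<^sup>2 \<partial>\<rho>) \<le> 4 * lam * energy \<rho> K {..<m} x (g N) b"
          by (rule vanishing_potential_norm_le[OF finite_lessThan xx gL2 lam sub v[OF subsetD[OF sub]] j1(2)])
        also have "\<dots> \<le> G * L * q * energy \<rho> K {..<m} x (g N) b" by (rule mult_right_mono[OF lamq E0])
        finally show "(\<integral>t. (potential \<rho> K (g N) {..<m} b x t)\<^sup>2 \<partial>\<rho>) \<le> G * L * q * energy \<rho> K {..<m} x (g N) b" .
        assume r1: "r > 1"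
        have sub3: "block n j3 \<subseteq> {..<m}" by (rule block(4)[OF j3(1) Jn])
        define b' where "b' i = (if i \<in> block n j3 then - g N0 (x i) / real n else 0)" for i
        have "energy \<rho> K {..<m} x (g N) b
          \<le> 2 * energy \<rho> K {..<m} x (g N0) b' + 2 * (T * ((\<Sum>k\<in>head N. (hk k)\<^sup>2) - (\<Sum>k\<in>head N0. (hk k)\<^sup>2)))"
          unfolding T_def g_def
          by (rule residual_energy_le[OF finite_lessThan xx r v[unfolded g_def] N])
        also have "energy \<rho> K {..<m} x (g N0) b' = energy \<rho> K (block n j3) x (g N0) (\<lambda>i. - g N0 (x i) / real n)"
          unfolding b'_def by (rule energy_restrict[OF finite_lessThan sub3])
        also have "2 * energy \<rho> K (block n j3) x (g N0) (\<lambda>i. - g N0 (x i) / real n) + 2 * (T * ((\<Sum>k\<in>head N. (hk k)\<^sup>2) - (\<Sum>k\<in>head N0. (hk k)\<^sup>2)))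
          \<le> 2 * (2 * ((T * H + 1) / real n)) + 2 * (T * (1 / real m))"
        proof (intro add_mono mult_left_mono order_trans[OF j3(2)] divide_right_mono add_right_mono N0 T0)
          have "C * (\<integral>x. (g N0 x)\<^sup>2 \<partial>\<rho>) \<le> C * (C powr (2 * r - 2) * (\<Sum>k\<in>head N0. (hk k)\<^sup>2))"
            unfolding g_def source_def using C r1 by (intro mult_left_mono source_norm_le head) auto
          also have "\<dots> \<le> C * (C powr (2 * r - 2) * H)"
            using C Hb by (intro mult_left_mono) auto
          also have "\<dots> = (C powr 1 * C powr (2 * r - 2)) * H" using C by simp
          also have "\<dots> = T * H" unfolding powr_add[symmetric] T_def by (simp add: algebra_simps)
          finally show "C * (\<integral>x. (g N0 x)\<^sup>2 \<partial>\<rho>) \<le> T * H" .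
        qed auto
        also have "\<dots> \<le> \<Theta> * L / real m"
        proof -
          have "1 / real n \<le> 4 * L / real m" using mn n m0 by (simp add: field_simps)
          then have "(T * H + 1) * (1 / real n) \<le> (T * H + 1) * (4 * L / real m)"
            using TH by (intro mult_left_mono) auto
          then have "4 * ((T * H + 1) * (1 / real n)) \<le> 4 * ((T * H + 1) * (4 * L / real m))" by linarith
          moreover have "2 * (2 * ((T * H + 1) / real n)) = 4 * ((T * H + 1) * (1 / real n))" by simp
          moreover have "4 * ((T * H + 1) * (4 * L / real m)) = (16 * (T * H) + 16) * L / real m"
            by (simp add: algebra_simps add_divide_distrib)
          ultimately have "2 * (2 * ((T * H + 1) / real n)) \<le> (16 * (T * H) + 16) * L / real m" by linarith
          moreover have "2 * (T * (1 / real m)) \<le> 2 * T * L / real m"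
            using T0 L m0 mult_left_mono[of 1 L "2 * T"] by (simp add: divide_right_mono)
          moreover have "(16 * (T * H) + 16) * L / real m + 2 * T * L / real m = \<Theta> * L / real m"
            by (simp add: \<Theta>_def add_divide_distrib distrib_right)
          ultimately show ?thesis by linarith
        qed
        finally show "energy \<rho> K {..<m} x (g N) b \<le> \<Theta> * L / real m" .
      qed
      then show ?thesis by blast
    qed
    then show ?thesis using E J(3) by (intro bexI[of _ E]) auto
  qed
  then obtain E where E: "E \<in> sets ?S" "measure ?S E \<ge> 1 - \<delta>" and Eg: "\<And>x. x \<in> E \<Longrightarrow> nice x \<Longrightarrow> \<exists>q N0. good x q N0"
    by blast
  have "measure ?S (E - Z) = measure ?S E"
    using Z(2,3) E(1) by (intro measure_Diff_null_set) (auto intro: null_setsI)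
  moreover have "E - Z \<in> sets ?S" using E Z by auto
  moreover have "L2_norm \<rho> (\<lambda>t. interpolant K m x y t - f t)
      \<le> error_constant (kappa X K) (L2_norm \<rho> h) r * L ^ 6 *
        (if r \<le> 1 then (INF lam\<in>{0<..}. lam powr r * (A_D K m x lam + 1) powr (2 * r))
         else 1 / sqrt (real m) * (INF lam\<in>{0<..}. sqrt lam * (A_D K m x lam + 1)))"
    if xEZ: "x \<in> E - Z" and y: "\<forall>i<m. y i = f (x i)" for x y
  proof -
    have x: "x \<in> space ?S" using xEZ sets.sets_into_space[OF E(1)] by auto
    have nx: "nice x" using xEZ Z(1) x by auto
    have inj': "inj_on x {..<m}" and pt: "\<And>i. i < m \<Longrightarrow> (\<lambda>N. \<integral>y. g N y * K y (x i) \<partial>\<rho>) \<longlonglongrightarrow> f (x i)"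
      using nx by (auto simp: nice_def)
    have xx: "\<And>i. i \<in> {..<m} \<Longrightarrow> x i \<in> space \<rho>" using sample_in[OF x] by simp
    obtain q N0 where gd: "good x q N0" using Eg[OF _ nx] xEZ by blast
    then have q0: "q > 0" and qA: "\<And>l. l > 0 \<Longrightarrow> q \<le> l * (A_D K m x l + 1)\<^sup>2"
      and V: "\<And>N b. N \<ge> N0 \<Longrightarrow> (\<And>i. i < m \<Longrightarrow> potential \<rho> K (g N) {..<m} b x (x i) = 0) \<Longrightarrow>
        (\<integral>t. (potential \<rho> K (g N) {..<m} b x t)\<^sup>2 \<partial>\<rho>) \<le> G * L * q * energy \<rho> K {..<m} x (g N) b"
      and W: "\<And>N b. N \<ge> N0 \<Longrightarrow> r > 1 \<Longrightarrow> (\<And>i. i < m \<Longrightarrow> potential \<rho> K (g N) {..<m} b x (x i) = 0) \<Longrightarrow>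
        energy \<rho> K {..<m} x (g N) b \<le> \<Theta> * L / real m"
      unfolding good_def by auto
    have sym': "K (x i) (x j) = K (x j) (x i)" if "i \<in> {..<m}" "j \<in> {..<m}" for i j
      using kernel_sym[OF bk xx xx] that by simp
    obtain \<sigma> u where ebm: "orthonormal_eigenbasis {..<m} (\<lambda>i j. K (x i) (x j)) \<sigma> u" and \<sigma>: "\<forall>l\<in>{..<m}. \<sigma> l > 0"
      using kernel_matrix_eigenbasis[OF finite_lessThan pos[OF x inj' order_refl] sym'] by blast
    have A0: "0 \<le> A_D K m x l \<and> q \<le> l * (A_D K m x l + 1)\<^sup>2" if "l > 0" for l
      using A_D_lower_bounds(1)[OF ebm _ _ that] \<sigma> m qA[OF that] by simp
    have pos': "0 < (\<Sum>i<m. \<Sum>j<m. b i * b j * K (x i) (x j))" if "\<exists>i<m. b i \<noteq> 0" for b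
      using pos[OF x inj' order_refl, of b] that by auto
    note err = interpolant_error_le[OF sys f sample_in[OF x] pos' y[rule_format] gL2 pt conv(2)]
    have GL: "G * L * q > 0" using G L q0 by simp
    show ?thesis
    proof (cases "r \<le> 1")
      case True
      have "L2_norm \<rho> (\<lambda>t. interpolant K m x y t - f t) \<le> sqrt (2 * H) * (G * L * q) powr r"
      proof (rule err)
        fix N b assume N: "N0 \<le> N" and v: "\<And>i. i < m \<Longrightarrow> potential \<rho> K (g N) {..<m} b x (x i) = 0"
        show "L2_norm \<rho> (potential \<rho> K (g N) {..<m} b x) \<le> sqrt (2 * H) * (G * L * q) powr r"
          unfolding g_def
          by (rule residual_low[OF finite_lessThan xx GL V[OF N v, unfolded g_def] v[unfolded g_def] Hb r True]) auto
      qed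
      also have "\<dots> \<le> error_constant (kappa X K) (L2_norm \<rho> h) r * L ^ 6 *
          (INF lam\<in>{0<..}. lam powr r * (A_D K m x lam + 1) powr (2 * r))"
      proof (rule rate_bound_low[OF q0 A0 r True L])
        show "sqrt (2 * H) * G powr r \<le> error_constant (kappa X K) (L2_norm \<rho> h) r"
          unfolding error_constant_def C_def[symmetric] G_def[symmetric]
          using G by (simp add: H_def real_sqrt_mult)
      qed (use G H0 in auto)
      finally show ?thesis using True by simp
    next
      case False
      have "L2_norm \<rho> (\<lambda>t. interpolant K m x y t - f t) \<le> sqrt (G * L * q * (\<Theta> * L / real m))"
      proof (rule err)
        fix N b assume N: "N0 \<le> N" and v: "\<And>i. i < m \<Longrightarrow> potential \<rho> K (g N) {..<m} b x (x i) = 0"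
        have "energy \<rho> K {..<m} x (g N) b \<le> \<Theta> * L / real m" using False by (intro W[OF N _ v]) auto
        then have "G * L * q * energy \<rho> K {..<m} x (g N) b \<le> G * L * q * (\<Theta> * L / real m)"
          using GL by (intro mult_left_mono) auto
        then show "L2_norm \<rho> (potential \<rho> K (g N) {..<m} b x) \<le> sqrt (G * L * q * (\<Theta> * L / real m))"
          unfolding L2_norm_def by (intro real_sqrt_le_mono order_trans[OF V[OF N v]]) auto
      qed
      also have "\<dots> \<le> error_constant (kappa X K) (L2_norm \<rho> h) r * L ^ 6 *
          (1 / sqrt (real m) * (INF lam\<in>{0<..}. sqrt lam * (A_D K m x lam + 1)))"
      proof (rule rate_bound_high[OF q0 A0 L _ \<Theta>(1) m0])
        show "sqrt (G * \<Theta>) \<le> error_constant (kappa X K) (L2_norm \<rho> h) r"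
          unfolding error_constant_def C_def[symmetric] G_def[symmetric] T_def[symmetric] H_def[symmetric] \<Theta>_def[symmetric]
          using G by simp
      qed (use G in auto)
      finally show ?thesis using False by simp
    qed
  qed
  ultimately show ?thesis
    using E(2) unfolding L_def by (intro bexI[of _ "E - Z"]) auto
qed

theorem theorem3p1:
  shows "\<exists>C1 :: real \<Rightarrow> real \<Rightarrow> real \<Rightarrow> real.
    \<forall>(d :: nat) (X :: point set) (K :: kernel) (\<rho> :: point measure)
      (h :: point \<Rightarrow> real) (f :: point \<Rightarrow> real) (r :: real) (m :: nat) (\<delta> :: real).
      d \<ge> 1 \<longrightarrow> compact_lipschitz_domain d X \<longrightarrow>
      continuous_on (X \<times> X) (\<lambda>(x, x'). K x x') \<longrightarrow>
      symmetric_kernel X K \<longrightarrow> strictly_positive_definite X K \<longrightarrow>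
      prob_space \<rho> \<longrightarrow> sets \<rho> = sets (restrict_space borel X) \<longrightarrow>
      h \<in> L2_space \<rho> \<longrightarrow> r \<ge> 1 / 2 \<longrightarrow> is_LK_power K \<rho> r h f \<longrightarrow>
      m \<ge> 1 \<longrightarrow> 0 < \<delta> \<longrightarrow> \<delta> < 1 \<longrightarrow>
      (AE x in PiM {..<m} (\<lambda>_. \<rho>). inj_on x {..<m}) \<longrightarrow>
      (\<exists>E \<in> sets (PiM {..<m} (\<lambda>_. \<rho>)). measure (PiM {..<m} (\<lambda>_. \<rho>)) E \<ge> 1 - \<delta> \<and>
        (\<forall>x \<in> E. \<forall>y. (\<forall>i<m. y i = f (x i)) \<longrightarrow>
          L2_norm \<rho> (\<lambda>t. interpolant K m x y t - f t)
            \<le> C1 (kappa X K) (L2_norm \<rho> h) r * (ln (16 / \<delta>)) ^ 6 *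
              (if r \<le> 1
               then (INF lam\<in>{0<..}. lam powr r * (A_D K m x lam + 1) powr (2 * r))
               else 1 / sqrt (real m) * (INF lam\<in>{0<..}. sqrt lam * (A_D K m x lam + 1)))))"
proof (intro exI[of _ error_constant] allI impI)
  fix d :: nat and X :: "point set" and K :: kernel and \<rho> :: "point measure"
    and h f :: "point \<Rightarrow> real" and r :: real and m :: nat and \<delta> :: real
  assume dom: "compact_lipschitz_domain d X"
    and hyps: "continuous_on (X \<times> X) (\<lambda>(x, x'). K x x')"
      "symmetric_kernel X K" "strictly_positive_definite X K"
      "prob_space \<rho>" "sets \<rho> = sets (restrict_space borel X)"
      "h \<in> L2_space \<rho>" "r \<ge> 1 / 2" "is_LK_power K \<rho> r h f" "m \<ge> 1" "0 < \<delta>" "\<delta> < 1"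
      "AE x in PiM {..<m} (\<lambda>_. \<rho>). inj_on x {..<m}"
  have "compact X"
    using dom unfolding compact_lipschitz_domain_def by (blast intro: compact_of_compactin_Euclidean_space)
  from interpolation_error_event[OF this hyps]
  show "\<exists>E \<in> sets (PiM {..<m} (\<lambda>_. \<rho>)). measure (PiM {..<m} (\<lambda>_. \<rho>)) E \<ge> 1 - \<delta> \<and>
        (\<forall>x \<in> E. \<forall>y. (\<forall>i<m. y i = f (x i)) \<longrightarrow>
          L2_norm \<rho> (\<lambda>t. interpolant K m x y t - f t)
            \<le> error_constant (kappa X K) (L2_norm \<rho> h) r * (ln (16 / \<delta>)) ^ 6 *
              (if r \<le> 1
               then (INF lam\<in>{0<..}. lam powr r * (A_D K m x lam + 1) powr (2 * r))
               else 1 / sqrt (real m) * (INF lam\<in>{0<..}. sqrt lam * (A_D K m x lam + 1))))" .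
qed

end
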